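(* Let $X$ be a positive recurrent diffusion on $\mathbb{R}$ with generator $L=a\partial^2+b\partial$ and initial distribution $m_0$, let $m_0^*$ be a probability on $E^*$ with $m_0^*\Lambda=m_0$, and let $Z^*$ be the dual process with initial distribution $m_0^*$, coupled with $X$ by an intertwining through $\Lambda$. If $I<+\infty$, then the random time $\tau^*=\inf\{t\ge0:\ Z^*_t=(-\infty,+\infty)\}$ is a.s. finite, and consequently it is a strong stationary time for $X$.
   Context: Let $a,b:\mathbb{R}\to\mathbb{R}$ be smooth with $a>0$, $L=a\partial^2+b\partial$, $c(x)=\int_0^x \frac{b(y)}{a(y)}dy$, $m=\int_{\mathbb{R}}\frac{\exp(c(x))}{a(x)}dx$. $X$ is positive recurrent if $m<+\infty$ and $\int_{-\infty}^0e^{-c(y)}dy=\int_0^{+\infty}e^{-c(y)}dy=+\infty$. $\mu$ is the probability measure with density $\mu(x)=\frac{\exp(c(x))}{m\,a(x)}$. Put $I_-=\int_{-\infty}^0(\int_x^0e^{-c(y)}dy)\mu(dx)$, $I_+=\int_0^{+\infty}(\int_0^xe^{-c(y)}dy)\mu(dx)$, $I=\max(I_-,I_+)$. A stopping time for $X$ is a random time $\tau$ on a filtered probability space $(\bar\Omega,\bar{\mathcal F},\bar{\mathbb P},(\bar{\mathcal F}_t)_{t\ge0})$ (possibly an enlargement carrying extra randomness) on which $X$ is a continuous process, Markovian with respect to $(\bar{\mathcal F}_t)$ with generator $L$, such that $\{\tau\le t\}\in\bar{\mathcal F}_t$ for all $t\ge 0$. A $[0,+\infty)$-valued (a.s. finite)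 stopping time $\tau$ is a strong stationary time if $\tau$ and $X_\tau$ are independent and $X_\tau$ has law $\mu$. Let $E^*=\{(x,y):\ x,y\in[-\infty,+\infty],\ x\le y\}\setminus\{(-\infty,-\infty),(+\infty,+\infty)\}$, $\mathring{E}^*=\{(x,y)\in\mathbb{R}^2: x<y\}$, $D^*=\{(x,x):x\in\mathbb{R}\}$. The Markov kernel $\Lambda$ from $E^*$ to $\mathbb{R}$ is $\Lambda((x,x),\cdot)=\delta_x$ and $\Lambda((x,y),A)=\mu([x,y]\cap A)/\mu([x,y])$ if $x<y$. The operator $L^*$ (squares are compositions): on $\mathring{E}^*$, $L^*=(\sqrt{a(y)}\partial_y-\sqrt{a(x)}\partial_x)^2+(\frac{a'(x)}2-b(x))\partial_x+(\frac{a'(y)}2-b(y))\partial_y+2\frac{\sqrt{a(x)}\mu(x)+\sqrt{a(y)}\mu(y)}{\mu([x,y])}(\sqrt{a(y)}\partial_y-\sqrt{a(x)}\partial_x)$; on $\mathbb{R}\times\{+\infty\}$, $L^*=(\sqrt{a(x)}\partial_x)^2+(\frac{a'(x)}2-b(x))\partial_x-2\frac{\sqrt{a(x)}\mu(x)}{\mu([x,+\infty))}\sqrt{a(x)}\partial_x$; on $\{-\infty\}\times\mathbb{R}$, $L^*=(\sqrt{a(y)}\partial_y)^2+(\frac{a'(y)}2-b(y))\partial_y+2\frac{\sqrt{a(y)}\mu(y)}{\mu((-\infty,y])}\sqrt{a(y)}\partial_y$; $(-\infty,+\infty)$ is absorbing. For $z\in E^*$, the dual process $Z^*$ started from $z$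 is the (unique in law) continuous $E^*$-valued Markov process started from $z$ which lies in $E^*\setminus D^*$ for all $t>0$, has generator $L^*$ in the sense of martingale problems on each of $\mathring{E}^*$, $\mathbb{R}\times\{+\infty\}$, $\{-\infty\}\times\mathbb{R}$, stays in $[-\infty,+\infty)\times\{+\infty\}$ (resp. $\{-\infty\}\times(-\infty,+\infty]$) after entering $\mathbb{R}\times\{+\infty\}$ (resp. $\{-\infty\}\times\mathbb{R}$), and stays at $(-\infty,+\infty)$ after reaching it. The dual process with initial distribution $m_0^*$ is defined by mixture. An intertwining of $X$ and $Z^*$ through $\Lambda$ is a coupling of $X$ and $Z^*$ such that for all $t\ge0$: the conditional law of $X_t$ knowing $Z^*_{[0,t]}=(Z^*_s)_{s\in[0,t]}$ is $\Lambda(Z^*_t,\cdot)$, and the conditional law of $Z^*_{[0,t]}$ knowing the whole trajectory $X$ depends only on $X_{[0,t]}$. *)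

theory Defs
  imports "HOL-Probability.Probability"
begin

definition smooth :: "(real \<Rightarrow> real) \<Rightarrow> bool" where
  "smooth f \<longleftrightarrow> (\<forall>n x. ((deriv ^^ n) f) differentiable (at x))"

definition dx :: "(real \<Rightarrow> real \<Rightarrow> real) \<Rightarrow> real \<Rightarrow> real \<Rightarrow> real" where
  "dx f = (\<lambda>x y. deriv (\<lambda>u. f u y) x)"

definition dy :: "(real \<Rightarrow> real \<Rightarrow> real) \<Rightarrow> real \<Rightarrow> real \<Rightarrow> real" where
  "dy f = (\<lambda>x y. deriv (\<lambda>v. f x v) y)"

primrec Ck2 :: "nat \<Rightarrow> (real \<Rightarrow> real \<Rightarrow> real) \<Rightarrow> bool" where
  "Ck2 0 f \<longleftrightarrow> continuous_on UNIV (\<lambda>(x, y). f x y)"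
| "Ck2 (Suc n) f \<longleftrightarrow>
     continuous_on UNIV (\<lambda>(x, y). f x y) \<and>
     (\<forall>x y. (\<lambda>u. f u y) differentiable (at x) \<and> (\<lambda>v. f x v) differentiable (at y)) \<and>
     Ck2 n (dx f) \<and> Ck2 n (dy f)"

definition smooth2 :: "(real \<Rightarrow> real \<Rightarrow> real) \<Rightarrow> bool" where
  "smooth2 f \<longleftrightarrow> (\<forall>n. Ck2 n f)"

definition test_fun :: "(real \<Rightarrow> real) \<Rightarrow> bool" where
  "test_fun f \<longleftrightarrow> smooth f \<and> (\<exists>K. compact K \<and> (\<forall>x. x \<notin> K \<longrightarrow> f x = 0))"

definition test_fun2 :: "(real \<Rightarrow> real \<Rightarrow> real) \<Rightarrow> bool" where
  "test_fun2 f \<longleftrightarrow> smooth2 f \<and>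
     (\<exists>K. compact K \<and> K \<subseteq> {(x, y). x < y} \<and> (\<forall>x y. (x, y) \<notin> K \<longrightarrow> f x y = 0))"

text \<open>The interval integral is oriented, so \<open>c_fun a b x\<close> is minus the integral over
  \<open>[x, 0]\<close> when \<open>x < 0\<close>.\<close>

definition c_fun :: "(real \<Rightarrow> real) \<Rightarrow> (real \<Rightarrow> real) \<Rightarrow> real \<Rightarrow> real" where
  "c_fun a b x = (LBINT y=ereal 0..ereal x. b y / a y)"

definition m_mass :: "(real \<Rightarrow> real) \<Rightarrow> (real \<Rightarrow> real) \<Rightarrow> ennreal" where
  "m_mass a b = (\<integral>\<^sup>+x. ennreal (exp (c_fun a b x) / a x) \<partial>lborel)"

definition positive_recurrent :: "(real \<Rightarrow> real) \<Rightarrow> (real \<Rightarrow> real) \<Rightarrow> bool" where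
  "positive_recurrent a b \<longleftrightarrow>
     m_mass a b < \<infinity> \<and>
     (\<integral>\<^sup>+y\<in>{..0}. ennreal (exp (- c_fun a b y)) \<partial>lborel) = \<infinity> \<and>
     (\<integral>\<^sup>+y\<in>{0..}. ennreal (exp (- c_fun a b y)) \<partial>lborel) = \<infinity>"

definition mu_dens :: "(real \<Rightarrow> real) \<Rightarrow> (real \<Rightarrow> real) \<Rightarrow> real \<Rightarrow> real" where
  "mu_dens a b x = exp (c_fun a b x) / (enn2real (m_mass a b) * a x)"

definition mu :: "(real \<Rightarrow> real) \<Rightarrow> (real \<Rightarrow> real) \<Rightarrow> real measure" where
  "mu a b = density lborel (\<lambda>x. ennreal (mu_dens a b x))"

definition I_minus :: "(real \<Rightarrow> real) \<Rightarrow> (real \<Rightarrow> real) \<Rightarrow> ennreal" where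
  "I_minus a b =
     (\<integral>\<^sup>+x\<in>{..0}. (\<integral>\<^sup>+y\<in>{x..0}. ennreal (exp (- c_fun a b y)) \<partial>lborel) \<partial>mu a b)"

definition I_plus :: "(real \<Rightarrow> real) \<Rightarrow> (real \<Rightarrow> real) \<Rightarrow> ennreal" where
  "I_plus a b =
     (\<integral>\<^sup>+x\<in>{0..}. (\<integral>\<^sup>+y\<in>{0..x}. ennreal (exp (- c_fun a b y)) \<partial>lborel) \<partial>mu a b)"

definition I_max :: "(real \<Rightarrow> real) \<Rightarrow> (real \<Rightarrow> real) \<Rightarrow> ennreal" where
  "I_max a b = max (I_minus a b) (I_plus a b)"

definition gen_sigma ::
  "'w measure \<Rightarrow> (real \<Rightarrow> 'w \<Rightarrow> 'b::topological_space) \<Rightarrow> real set \<Rightarrow> 'w measure" where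
  "gen_sigma M Y T =
     sigma (space M) {Y s -` B \<inter> space M | s B. s \<in> T \<and> B \<in> sets borel}"

definition natural_filtration ::
  "'w measure \<Rightarrow> (real \<Rightarrow> 'w \<Rightarrow> 'b::topological_space) \<Rightarrow> real \<Rightarrow> 'w measure" where
  "natural_filtration M Y t = gen_sigma M Y {0..t}"

definition filtration_of :: "'w measure \<Rightarrow> (real \<Rightarrow> 'w measure) \<Rightarrow> bool" where
  "filtration_of M F \<longleftrightarrow> filtration (space M) F \<and> (\<forall>t. subalgebra M (F t))"

definition continuous_process ::
  "'w measure \<Rightarrow> (real \<Rightarrow> 'w \<Rightarrow> 'b::topological_space) \<Rightarrow> bool" where
  "continuous_process M Y \<longleftrightarrow>
     (\<forall>t\<ge>0. Y t \<in> borel_measurable M) \<and>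
     (\<forall>\<omega>\<in>space M. continuous_on {0..} (\<lambda>t. Y t \<omega>))"

definition markov_process ::
  "'w measure \<Rightarrow> (real \<Rightarrow> 'w measure) \<Rightarrow> (real \<Rightarrow> 'w \<Rightarrow> 'b::topological_space) \<Rightarrow> bool" where
  "markov_process M F Y \<longleftrightarrow>
     (\<forall>t\<ge>0. Y t \<in> borel_measurable (F t)) \<and>
     (\<exists>P :: real \<Rightarrow> 'b \<Rightarrow> 'b measure.
        (\<forall>t\<ge>0. P t \<in> borel \<rightarrow>\<^sub>M prob_algebra borel) \<and>
        (\<forall>s\<ge>0. \<forall>t\<ge>0. \<forall>B\<in>sets borel.
           AE \<omega> in M. real_cond_exp M (F s) (\<lambda>\<omega>'. indicator B (Y (s + t) \<omega>')) \<omega>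
                     = measure (P t (Y s \<omega>)) B))"

text \<open>The process \<open>\<phi>(Y\<^sub>t) - \<integral>\<^sub>0\<^sup>t \<psi>(Y\<^sub>u) du\<close> behaves as a martingale from every time
  at which \<open>Y\<close> is in \<open>S\<close>. It need not be a martingale from time \<open>0\<close> on: when \<open>Y\<close> enters \<open>S\<close>
  from outside, \<open>\<phi>(Y)\<close> may jump, \<open>\<phi>\<close> being extended by \<open>0\<close> outside \<open>S\<close>.\<close>

definition martingale_from ::
  "'w measure \<Rightarrow> (real \<Rightarrow> 'w measure) \<Rightarrow> (real \<Rightarrow> 'w \<Rightarrow> 'b) \<Rightarrow> 'b set \<Rightarrow>
    ('b \<Rightarrow> real) \<Rightarrow> ('b \<Rightarrow> real) \<Rightarrow> bool" where
  "martingale_from M F Y S \<phi> \<psi> \<longleftrightarrow>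
     (\<forall>s t. 0 \<le> s \<and> s \<le> t \<longrightarrow>
        (let D = (\<lambda>\<omega>. \<phi> (Y t \<omega>) - \<phi> (Y s \<omega>) - (LINT u:{s..t}|lborel. \<psi> (Y u \<omega>)))
         in integrable M D \<and>
            (AE \<omega> in M. Y s \<omega> \<in> S \<longrightarrow> real_cond_exp M (F s) D \<omega> = 0)))"

definition L_gen :: "(real \<Rightarrow> real) \<Rightarrow> (real \<Rightarrow> real) \<Rightarrow> (real \<Rightarrow> real) \<Rightarrow> real \<Rightarrow> real" where
  "L_gen a b f x = a x * deriv (deriv f) x + b x * deriv f x"

definition diffusion ::
  "(real \<Rightarrow> real) \<Rightarrow> (real \<Rightarrow> real) \<Rightarrow> 'w measure \<Rightarrow> (real \<Rightarrow> 'w measure) \<Rightarrow>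
    (real \<Rightarrow> 'w \<Rightarrow> real) \<Rightarrow> bool" where
  "diffusion a b M F X \<longleftrightarrow>
     continuous_process M X \<and> markov_process M F X \<and>
     (\<forall>f. test_fun f \<longrightarrow> martingale_from M F X UNIV f (L_gen a b f))"

text \<open>\<open>\<tau>\<close> may take the value \<open>\<infinity>\<close> on a null set, where \<open>real_of_ereal \<infinity> = 0\<close> makes
  \<open>X\<^sub>\<tau>\<close> a harmless default.\<close>

definition strong_stationary_time ::
  "(real \<Rightarrow> real) \<Rightarrow> (real \<Rightarrow> real) \<Rightarrow> 'w measure \<Rightarrow> (real \<Rightarrow> 'w measure) \<Rightarrow>
    (real \<Rightarrow> 'w \<Rightarrow> real) \<Rightarrow> ('w \<Rightarrow> ereal) \<Rightarrow> bool" where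
  "strong_stationary_time a b M F X \<tau> \<longleftrightarrow>
     prob_space M \<and> filtration_of M F \<and> diffusion a b M F X \<and>
     (\<forall>t\<ge>0. {\<omega> \<in> space M. \<tau> \<omega> \<le> ereal t} \<in> sets (F t)) \<and>
     (\<forall>\<omega>\<in>space M. 0 \<le> \<tau> \<omega>) \<and> (AE \<omega> in M. \<tau> \<omega> < \<infinity>) \<and>
     prob_space.indep_var M borel \<tau> borel (\<lambda>\<omega>. X (real_of_ereal (\<tau> \<omega>)) \<omega>) \<and>
     distr M borel (\<lambda>\<omega>. X (real_of_ereal (\<tau> \<omega>)) \<omega>) = mu a b"

definition Estar :: "(ereal \<times> ereal) set" where
  "Estar = {(x, y). x \<le> y} - {(-\<infinity>, -\<infinity>), (\<infinity>, \<infinity>)}"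

definition Eint :: "(ereal \<times> ereal) set" where
  "Eint = {(ereal x, ereal y) | x y. x < y}"

definition Eright :: "(ereal \<times> ereal) set" where
  "Eright = {(ereal x, \<infinity>) | x. True}"

definition Eleft :: "(ereal \<times> ereal) set" where
  "Eleft = {(-\<infinity>, ereal y) | y. True}"

definition Dstar :: "(ereal \<times> ereal) set" where
  "Dstar = {(ereal x, ereal x) | x. True}"

definition Lambda :: "(real \<Rightarrow> real) \<Rightarrow> (real \<Rightarrow> real) \<Rightarrow> ereal \<times> ereal \<Rightarrow> real measure" where
  "Lambda a b z =
     (if fst z = snd z then return borel (real_of_ereal (fst z))
      else uniform_measure (mu a b) {u. fst z \<le> ereal u \<and> ereal u \<le> snd z})"

definition nabla ::
  "(real \<Rightarrow> real) \<Rightarrow> (real \<Rightarrow> real \<Rightarrow> real) \<Rightarrow> real \<Rightarrow> real \<Rightarrow> real" where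
  "nabla a f = (\<lambda>x y. sqrt (a y) * dy f x y - sqrt (a x) * dx f x y)"

definition Lstar_int ::
  "(real \<Rightarrow> real) \<Rightarrow> (real \<Rightarrow> real) \<Rightarrow> (real \<Rightarrow> real \<Rightarrow> real) \<Rightarrow> real \<Rightarrow> real \<Rightarrow> real" where
  "Lstar_int a b f x y =
     nabla a (nabla a f) x y
     + (deriv a x / 2 - b x) * dx f x y
     + (deriv a y / 2 - b y) * dy f x y
     + 2 * ((sqrt (a x) * mu_dens a b x + sqrt (a y) * mu_dens a b y)
            / measure (mu a b) {x..y}) * nabla a f x y"

definition nabla1 :: "(real \<Rightarrow> real) \<Rightarrow> (real \<Rightarrow> real) \<Rightarrow> real \<Rightarrow> real" where
  "nabla1 a f = (\<lambda>x. sqrt (a x) * deriv f x)"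

definition Lstar_right ::
  "(real \<Rightarrow> real) \<Rightarrow> (real \<Rightarrow> real) \<Rightarrow> (real \<Rightarrow> real) \<Rightarrow> real \<Rightarrow> real" where
  "Lstar_right a b f x =
     nabla1 a (nabla1 a f) x + (deriv a x / 2 - b x) * deriv f x
     - 2 * (sqrt (a x) * mu_dens a b x / measure (mu a b) {x..}) * nabla1 a f x"

definition Lstar_left ::
  "(real \<Rightarrow> real) \<Rightarrow> (real \<Rightarrow> real) \<Rightarrow> (real \<Rightarrow> real) \<Rightarrow> real \<Rightarrow> real" where
  "Lstar_left a b f y =
     nabla1 a (nabla1 a f) y + (deriv a y / 2 - b y) * deriv f y
     + 2 * (sqrt (a y) * mu_dens a b y / measure (mu a b) {..y}) * nabla1 a f y"

definition ext_int :: "(real \<Rightarrow> real \<Rightarrow> real) \<Rightarrow> ereal \<times> ereal \<Rightarrow> real" where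
  "ext_int f z = (if z \<in> Eint then f (real_of_ereal (fst z)) (real_of_ereal (snd z)) else 0)"

definition ext_right :: "(real \<Rightarrow> real) \<Rightarrow> ereal \<times> ereal \<Rightarrow> real" where
  "ext_right f z = (if z \<in> Eright then f (real_of_ereal (fst z)) else 0)"

definition ext_left :: "(real \<Rightarrow> real) \<Rightarrow> ereal \<times> ereal \<Rightarrow> real" where
  "ext_left f z = (if z \<in> Eleft then f (real_of_ereal (snd z)) else 0)"

definition dual_process ::
  "(real \<Rightarrow> real) \<Rightarrow> (real \<Rightarrow> real) \<Rightarrow> 'w measure \<Rightarrow> (real \<Rightarrow> 'w \<Rightarrow> ereal \<times> ereal) \<Rightarrow> bool" where
  "dual_process a b M Z \<longleftrightarrow>
     continuous_process M Z \<and>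
     (\<forall>\<omega>\<in>space M. \<forall>t\<ge>0. Z t \<omega> \<in> Estar) \<and>
     markov_process M (natural_filtration M Z) Z \<and>
     (AE \<omega> in M. \<forall>t>0. Z t \<omega> \<notin> Dstar) \<and>
     (\<forall>f. test_fun2 f \<longrightarrow>
        martingale_from M (natural_filtration M Z) Z Eint
          (ext_int f) (ext_int (Lstar_int a b f))) \<and>
     (\<forall>f. test_fun f \<longrightarrow>
        martingale_from M (natural_filtration M Z) Z Eright
          (ext_right f) (ext_right (Lstar_right a b f))) \<and>
     (\<forall>f. test_fun f \<longrightarrow>
        martingale_from M (natural_filtration M Z) Z Eleft
          (ext_left f) (ext_left (Lstar_left a b f))) \<and>
     (AE \<omega> in M. \<forall>s t. 0 \<le> s \<and> s \<le> t \<longrightarrow>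
        (Z s \<omega> \<in> Eright \<longrightarrow> Z t \<omega> \<in> {-\<infinity>..<\<infinity>} \<times> {\<infinity>}) \<and>
        (Z s \<omega> \<in> Eleft \<longrightarrow> Z t \<omega> \<in> {-\<infinity>} \<times> {-\<infinity><..\<infinity>}) \<and>
        (Z s \<omega> = (-\<infinity>, \<infinity>) \<longrightarrow> Z t \<omega> = (-\<infinity>, \<infinity>)))"

definition intertwined ::
  "(real \<Rightarrow> real) \<Rightarrow> (real \<Rightarrow> real) \<Rightarrow> 'w measure \<Rightarrow> (real \<Rightarrow> 'w \<Rightarrow> real) \<Rightarrow>
    (real \<Rightarrow> 'w \<Rightarrow> ereal \<times> ereal) \<Rightarrow> bool" where
  "intertwined a b M X Z \<longleftrightarrow>
     (\<forall>t\<ge>0. \<forall>A\<in>sets borel.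
        AE \<omega> in M. real_cond_exp M (natural_filtration M Z t) (\<lambda>\<omega>'. indicator A (X t \<omega>')) \<omega>
                  = measure (Lambda a b (Z t \<omega>)) A) \<and>
     (\<forall>t\<ge>0. \<forall>B\<in>sets (natural_filtration M Z t).
        AE \<omega> in M. real_cond_exp M (gen_sigma M X {0..}) (indicator B) \<omega>
                  = real_cond_exp M (natural_filtration M X t) (indicator B) \<omega>)"

definition tau_star :: "(real \<Rightarrow> 'w \<Rightarrow> ereal \<times> ereal) \<Rightarrow> 'w \<Rightarrow> ereal" where
  "tau_star Z \<omega> = Inf {ereal t | t. 0 \<le> t \<and> Z t \<omega> = (-\<infinity>, \<infinity>)}"

end

theory Submission
  imports Defs
begin

text \<open>
  On the interior \<open>L\<^sup>*\<close> is the Doob transform, by the mass \<open>h (x, y) = \<mu> [x, y]\<close>, of an operator that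
  acts on functions of \<open>x\<close> alone and of \<open>y\<close> alone as \<open>u \<mapsto> a u'' + (a' - b) u'\<close>. If \<open>f\<close> solves
  \<open>L f = - 1\<close> and \<open>W' = f \<mu>\<close>, this operator sends \<open>W y - W x\<close> to \<open>- h\<close> and annihilates constants.
  Finiteness of \<open>I\<close> makes \<open>W\<close> bounded, so for a large constant \<open>C\<close> the function
  \<open>g = (C + W y - W x) / h\<close> is nonnegative with \<open>L\<^sup>* g = - 1\<close>; the same construction works on the two
  faces. Such a \<open>g\<close> bounds the expected exit time from each region, so the dual process leaves the
  interior, then the face it reaches, and is absorbed in finite time.

  On \<open>\<tau>\<^sup>* \<le> t\<close> the dual process sits at \<open>(-\<infinity>, \<infinity>)\<close>, so \<open>X\<^sub>t\<close> has conditional law \<open>\<mu>\<close> given \<open>Z\<^sup>*\<close> up to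
  time \<open>t\<close>. Applied to discretisations of \<open>\<tau>\<^sup>*\<close> from above and combined with the continuity
  of \<open>X\<close>, this gives the law of \<open>X\<close> at \<open>\<tau>\<^sup>*\<close> and its independence of \<open>\<tau>\<^sup>*\<close>. The second half of the
  intertwining says that \<open>Z\<^sup>*\<close> up to time \<open>t\<close> and \<open>X\<close> are conditionally independent given \<open>X\<close> up to
  time \<open>t\<close>, so \<open>X\<close> keeps its Markov property in the joint filtration.
\<close>

section \<open>Smooth functions and cutoffs\<close>

text \<open>The function \<open>g\<close> is not an admissible test function: the martingale
  problems admit only compactly supported smooth functions on a region, and give mean-zero
  increments only from times spent in it. So \<open>g\<close> is cut off to test functions that
  coincide with it near compact sets \<open>K n\<close> exhausting the region. On \<open>K n\<close>
  the generator still yields \<open>- 1\<close>, and on a fixed \<open>K j\<close> the values stay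
  bounded uniformly in \<open>n\<close>. The exit time from \<open>K n\<close> is observed on a time
  grid: the indicator of having been in \<open>K n\<close> at all grid times so far selects
  increments that start in the region. Refining the grid, then letting \<open>n\<close> and the time
  horizon grow, gives exit from the region. The function \<open>g\<close> is explicit because its
  numerator and denominator are sums of one-variable functions, on which the mixed derivative in
  \<open>L\<^sup>*\<close> does not act. Since \<open>(a \<rho>)' = b \<rho>\<close>, the remaining
  operator sends \<open>W\<close> to \<open>a \<rho> f'\<close>, and \<open>L f = - 1\<close> makes
  this a constant \<open>k\<close> minus the distribution function of \<mu>. Normalised at 0,
  \<bar>f\<bar> is at most a multiple of the absolute scale function, and \<bar>W\<bar> at most a
  multiple of the integrals defining \<open>I\<close>.\<close>

lemma Ck2_continuous: "Ck2 n f \<Longrightarrow> continuous_on UNIV (\<lambda>(x, y). f x y)"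
  by (cases n) auto

lemma Ck2_SucD: "Ck2 (Suc n) f \<Longrightarrow> Ck2 n f"
proof (induction n arbitrary: f)
  case (Suc n)
  then have "Ck2 (Suc n) (dx f)" "Ck2 (Suc n) (dy f)"
    using Ck2.simps(2)[THEN iffD1, OF Suc.prems] by blast+
  then have "Ck2 n (dx f)" "Ck2 n (dy f)" by (auto intro: Suc.IH simp del: Ck2.simps)
  with Ck2.simps(2)[THEN iffD1, OF Suc.prems] show ?case
    by (intro Ck2.simps(2)[THEN iffD2]) blast
qed simp

lemma Ck2_has_deriv:
  assumes "Ck2 (Suc n) f"
  shows "((\<lambda>u. f u y) has_real_derivative dx f x y) (at x)"
    and "((\<lambda>v. f x v) has_real_derivative dy f x y) (at y)"
  using assms by (auto simp: dx_def dy_def DERIV_deriv_iff_real_differentiable)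

text \<open>With the partial derivatives given as witnesses, a closure rule reduces to one
  differentiation and an appeal to the same rule one order lower.\<close>

lemma Ck2_SucI:
  assumes "continuous_on UNIV (\<lambda>(x, y). f x y)"
    and "\<And>x y. ((\<lambda>u. f u y) has_real_derivative fx x y) (at x)"
    and "\<And>x y. ((\<lambda>v. f x v) has_real_derivative fy x y) (at y)"
    and "Ck2 n fx" and "Ck2 n fy"
  shows "Ck2 (Suc n) f"
proof -
  have "dx f = fx" "dy f = fy"
    using assms(2,3)[THEN DERIV_imp_deriv] by (simp_all add: dx_def dy_def fun_eq_iff)
  then show ?thesis
    using assms unfolding Ck2.simps real_differentiable_def by metis
qed

lemma Ck2_const: "Ck2 n (\<lambda>x y. k)"
proof (induction n arbitrary: k)
  case (Suc n)
  show ?case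
    by (rule Ck2_SucI[OF _ _ _ Suc[of 0] Suc[of 0]]) (simp_all add: case_prod_beta)
qed (simp add: case_prod_beta)

lemma Ck2_add: "Ck2 n f \<Longrightarrow> Ck2 n g \<Longrightarrow> Ck2 n (\<lambda>x y. f x y + g x y)"
proof (induction n arbitrary: f g)
  case 0
  then show ?case by (auto intro!: continuous_intros simp: case_prod_beta)
next
  case (Suc n)
  show ?case
  proof (rule Ck2_SucI)
    show "continuous_on UNIV (\<lambda>(x, y). f x y + g x y)"
      using Suc.prems[THEN Ck2_continuous] by (auto intro!: continuous_intros simp: case_prod_beta)
    show "((\<lambda>u. f u y + g u y) has_real_derivative dx f x y + dx g x y) (at x)" for x y
      by (intro DERIV_add; rule Ck2_has_deriv, rule Suc.prems)
    show "((\<lambda>v. f x v + g x v) has_real_derivative dy f x y + dy g x y) (at y)" for x y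
      by (intro DERIV_add; rule Ck2_has_deriv, rule Suc.prems)
    show "Ck2 n (\<lambda>x y. dx f x y + dx g x y)" "Ck2 n (\<lambda>x y. dy f x y + dy g x y)"
      by (rule Suc.IH; use Suc.prems in simp)+
  qed
qed

lemma Ck2_mult: "Ck2 n f \<Longrightarrow> Ck2 n g \<Longrightarrow> Ck2 n (\<lambda>x y. f x y * g x y)"
proof (induction n arbitrary: f g)
  case 0
  then show ?case by (auto intro!: continuous_intros simp: case_prod_beta)
next
  case (Suc n)
  have *: "Ck2 n f" "Ck2 n g" using Suc.prems by (auto intro: Ck2_SucD)
  show ?case
  proof (rule Ck2_SucI)
    show "continuous_on UNIV (\<lambda>(x, y). f x y * g x y)"
      using Suc.prems[THEN Ck2_continuous] by (auto intro!: continuous_intros simp: case_prod_beta)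
    show "((\<lambda>u. f u y * g u y) has_real_derivative f x y * dx g x y + dx f x y * g x y) (at x)" for x y
      by (intro DERIV_mult'; rule Ck2_has_deriv, rule Suc.prems)
    show "((\<lambda>v. f x v * g x v) has_real_derivative f x y * dy g x y + dy f x y * g x y) (at y)" for x y
      by (intro DERIV_mult'; rule Ck2_has_deriv, rule Suc.prems)
    show "Ck2 n (\<lambda>x y. f x y * dx g x y + dx f x y * g x y)"
      "Ck2 n (\<lambda>x y. f x y * dy g x y + dy f x y * g x y)"
      by (rule Ck2_add; rule Suc.IH; use Suc.prems * in simp)+
  qed
qed

lemma smooth_deriv: "smooth f \<Longrightarrow> smooth (deriv f)"
  unfolding smooth_def by (metis comp_apply funpow_Suc_right)

lemma smooth_has_deriv: "smooth f \<Longrightarrow> (f has_real_derivative deriv f x) (at x)"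
  unfolding smooth_def by (metis DERIV_deriv_iff_real_differentiable funpow_0)

lemma smooth_continuous: "smooth f \<Longrightarrow> continuous_on S f"
  by (meson DERIV_isCont continuous_at_imp_continuous_on smooth_has_deriv)

text \<open>The chain rule leaves \<open>deriv u\<close> composed with the same \<open>f\<close>, so
  the induction must let \<open>u\<close> vary.\<close>

lemma Ck2_compose: "smooth u \<Longrightarrow> Ck2 n f \<Longrightarrow> Ck2 n (\<lambda>x y. u (f x y))"
proof (induction n arbitrary: f u)
  case 0
  have "continuous_on UNIV (\<lambda>z. u (f (fst z) (snd z)))"
    using 0 by (intro continuous_on_compose2[OF smooth_continuous[of u UNIV]])
      (auto simp: case_prod_beta)
  then show ?case by (simp add: case_prod_beta)
next
  case (Suc n)
  have *: "Ck2 n f" using Suc.prems by (auto intro: Ck2_SucD)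
  show ?case
  proof (rule Ck2_SucI)
    have "continuous_on UNIV (\<lambda>z. u (f (fst z) (snd z)))"
      using Suc.prems(2)[THEN Ck2_continuous]
      by (intro continuous_on_compose2[OF smooth_continuous[OF Suc.prems(1), of UNIV]])
         (auto simp: case_prod_beta)
    then show "continuous_on UNIV (\<lambda>(x, y). u (f x y))" by (simp add: case_prod_beta)
    show "((\<lambda>v. u (f v y)) has_real_derivative (deriv u (f x y) * dx f x y)) (at x)" for x y
      by (rule DERIV_chain2[OF smooth_has_deriv[OF Suc.prems(1)] Ck2_has_deriv(1)[OF Suc.prems(2)]])
    show "((\<lambda>v. u (f x v)) has_real_derivative (deriv u (f x y) * dy f x y)) (at y)" for x y
      by (rule DERIV_chain2[OF smooth_has_deriv[OF Suc.prems(1)] Ck2_has_deriv(2)[OF Suc.prems(2)]])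
    have "Ck2 n (\<lambda>x y. deriv u (f x y))"
      by (rule Suc.IH[OF smooth_deriv[OF Suc.prems(1)] *])
    then show "Ck2 n (\<lambda>x y. deriv u (f x y) * dx f x y)" "Ck2 n (\<lambda>x y. deriv u (f x y) * dy f x y)"
      by (rule Ck2_mult; use Suc.prems in simp)+
  qed
qed

text \<open>\<open>Ck2_compose\<close> does not cover this, the reciprocal not being smooth on the
  whole line. The derivatives of \<open>1 / f\<close> are products of \<open>1 / f\<close> itself
  with derivatives of \<open>f\<close>, so the induction closes.\<close>

lemma Ck2_inverse:
  "Ck2 n f \<Longrightarrow> (\<And>x y. f x y \<noteq> 0) \<Longrightarrow> Ck2 n (\<lambda>x y. inverse (f x y))"
proof (induction n arbitrary: f)
  case 0
  then show ?case by (auto intro!: continuous_intros simp: case_prod_beta)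
next
  case (Suc n)
  have "Ck2 n f" using Suc.prems by (auto intro: Ck2_SucD)
  then have i: "Ck2 n (\<lambda>x y. inverse (f x y))" using Suc by auto
  show ?case
  proof (rule Ck2_SucI)
    show "continuous_on UNIV (\<lambda>(x, y). inverse (f x y))"
      using Suc.prems(1)[THEN Ck2_continuous] Suc.prems(2)
      by (auto intro!: continuous_intros simp: case_prod_beta)
    show "((\<lambda>v. inverse (f v y)) has_real_derivative
        (-1) * (inverse (f x y) * (dx f x y * inverse (f x y)))) (at x)" for x y
      using DERIV_inverse'[OF Ck2_has_deriv(1)[OF Suc.prems(1)] Suc.prems(2)]
      by (simp add: mult.assoc)
    show "((\<lambda>v. inverse (f x v)) has_real_derivative
        (-1) * (inverse (f x y) * (dy f x y * inverse (f x y)))) (at y)" for x y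
      using DERIV_inverse'[OF Ck2_has_deriv(2)[OF Suc.prems(1)] Suc.prems(2)]
      by (simp add: mult.assoc)
    show "Ck2 n (\<lambda>x y. (-1) * (inverse (f x y) * (dx f x y * inverse (f x y))))"
      "Ck2 n (\<lambda>x y. (-1) * (inverse (f x y) * (dy f x y * inverse (f x y))))"
      by (rule Ck2_mult[OF Ck2_const Ck2_mult[OF i Ck2_mult[OF _ i]]]; use Suc.prems in simp)+
  qed
qed

section \<open>Smoothness in one variable and its link with two variables\<close>

lemma smooth_SucI:
  assumes "\<And>x. (f has_real_derivative f' x) (at x)" "smooth f'"
  shows "smooth f"
proof -
  have "deriv f = f'" using assms(1) by (auto intro!: DERIV_imp_deriv)
  then have "((deriv ^^ n) f) differentiable (at x)" for n x
    using assms unfolding smooth_def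
    by (cases n) (auto simp: real_differentiable_def funpow_Suc_right simp del: funpow.simps(2))
  then show ?thesis by (simp add: smooth_def)
qed

text \<open>A class closed under differentiation contains all iterated derivatives of its members,
  so no formula for the n-th derivative has to be found.\<close>

lemma smooth_coinduct:
  assumes "f \<in> C" and "\<And>g. g \<in> C \<Longrightarrow> \<exists>g'\<in>C. \<forall>x. (g has_real_derivative g' x) (at x)"
  shows "smooth f"
proof -
  have "(deriv ^^ n) f \<in> C" for n
  proof (induction n)
    case (Suc n)
    then obtain g' where "g' \<in> C" "\<forall>x. ((deriv ^^ n) f has_real_derivative g' x) (at x)"
      using assms(2) by blast
    moreover from this have "deriv ((deriv ^^ n) f) = g'" by (auto intro!: DERIV_imp_deriv)
    ultimately show ?case by simp
  qed (use assms(1) in simp)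
  then show ?thesis
    using assms(2) unfolding smooth_def real_differentiable_def by blast
qed

lemma Ck2_fst: "smooth f \<Longrightarrow> Ck2 n (\<lambda>x y. f x)"
proof (induction n arbitrary: f)
  case 0
  then show ?case
    by (auto simp: case_prod_beta intro!: continuous_on_compose2[OF smooth_continuous[of f UNIV]]
        continuous_intros)
next
  case (Suc n)
  show ?case
  proof (rule Ck2_SucI)
    show "continuous_on UNIV (\<lambda>(x, y::real). f x)"
      using Suc.prems
      by (auto simp: case_prod_beta intro!: continuous_on_compose2[OF smooth_continuous[of f UNIV]]
        continuous_intros)
    show "((\<lambda>u. f u) has_real_derivative deriv f x) (at x)" for x y :: real
      by (rule smooth_has_deriv[OF Suc.prems])
    show "Ck2 n (\<lambda>x y. 0)" by (rule Ck2_const)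
    show "Ck2 n (\<lambda>x y. deriv f x)" by (rule Suc.IH[OF smooth_deriv[OF Suc.prems]])
  qed simp
qed

lemma Ck2_snd: "smooth f \<Longrightarrow> Ck2 n (\<lambda>x y. f y)"
proof (induction n arbitrary: f)
  case 0
  then show ?case
    by (auto simp: case_prod_beta intro!: continuous_on_compose2[OF smooth_continuous[of f UNIV]]
        continuous_intros)
next
  case (Suc n)
  show ?case
  proof (rule Ck2_SucI)
    show "continuous_on UNIV (\<lambda>(x::real, y). f y)"
      using Suc.prems
      by (auto simp: case_prod_beta intro!: continuous_on_compose2[OF smooth_continuous[of f UNIV]]
        continuous_intros)
    show "((\<lambda>u. f u) has_real_derivative deriv f y) (at y)" for x y :: real
      by (rule smooth_has_deriv[OF Suc.prems])
    show "Ck2 n (\<lambda>x y. 0)" by (rule Ck2_const)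
    show "Ck2 n (\<lambda>x y. deriv f y)" by (rule Suc.IH[OF smooth_deriv[OF Suc.prems]])
  qed simp
qed

text \<open>This transfers the closure rules from two variables to one: a function of
  \<open>x\<close> alone is treated as a function of both.\<close>

lemma smooth_if_smooth2:
  assumes "smooth2 (\<lambda>x y. f x)" shows "smooth f"
proof (rule smooth_coinduct[where C="{f. smooth2 (\<lambda>x y. f x)}"])
  fix g :: "real \<Rightarrow> real" assume "g \<in> {f. smooth2 (\<lambda>x y. f x)}"
  then have s: "Ck2 n (\<lambda>x y. g x)" for n by (simp add: smooth2_def)
  have e: "dx (\<lambda>x y. g x) = (\<lambda>x y. deriv g x)" by (simp add: dx_def fun_eq_iff)
  have "Ck2 n (\<lambda>x y. deriv g x)" for n using s[of "Suc n"] by (simp add: e)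
  moreover have "(g has_real_derivative deriv g x) (at x)" for x
    using Ck2_has_deriv(1)[OF s[of "Suc 0"], of x] by (simp add: e)
  ultimately show "\<exists>g'\<in>{f. smooth2 (\<lambda>x y. f x)}. \<forall>x. (g has_real_derivative g' x) (at x)"
    by (auto simp: smooth2_def)
qed (use assms in simp)

lemma smooth2_const: "smooth2 (\<lambda>x y. k)"
  by (simp add: smooth2_def Ck2_const)

lemma smooth2_add: "smooth2 f \<Longrightarrow> smooth2 g \<Longrightarrow> smooth2 (\<lambda>x y. f x y + g x y)"
  by (simp add: smooth2_def Ck2_add)

lemma smooth2_mult: "smooth2 f \<Longrightarrow> smooth2 g \<Longrightarrow> smooth2 (\<lambda>x y. f x y * g x y)"
  by (simp add: smooth2_def Ck2_mult)

lemma smooth2_compose: "smooth u \<Longrightarrow> smooth2 f \<Longrightarrow> smooth2 (\<lambda>x y. u (f x y))"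
  by (simp add: smooth2_def Ck2_compose)

lemma smooth2_inverse:
  "smooth2 f \<Longrightarrow> (\<And>x y. f x y \<noteq> 0) \<Longrightarrow> smooth2 (\<lambda>x y. inverse (f x y))"
  by (simp add: smooth2_def Ck2_inverse)

lemma smooth2_fst: "smooth u \<Longrightarrow> smooth2 (\<lambda>x y. u x)"
  by (simp add: smooth2_def Ck2_fst)

lemma smooth2_snd: "smooth u \<Longrightarrow> smooth2 (\<lambda>x y. u y)"
  by (simp add: smooth2_def Ck2_snd)

lemma smooth2_diff: "smooth2 f \<Longrightarrow> smooth2 g \<Longrightarrow> smooth2 (\<lambda>x y. f x y - g x y)"
  using smooth2_add[of f "\<lambda>x y. -1 * g x y"] smooth2_mult[OF smooth2_const, of g "-1"] by simp

lemma smooth2_dx: "smooth2 f \<Longrightarrow> smooth2 (dx f)"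
  and smooth2_dy: "smooth2 f \<Longrightarrow> smooth2 (dy f)"
  unfolding smooth2_def using Ck2.simps(2) by blast+

lemma smooth2_continuous: "smooth2 f \<Longrightarrow> continuous_on S (\<lambda>(x, y). f x y)"
  unfolding smooth2_def using Ck2_continuous continuous_on_subset by blast

lemma smooth_const: "smooth (\<lambda>x. k)"
  by (rule smooth_if_smooth2) (rule smooth2_const)

lemma smooth_add: "smooth f \<Longrightarrow> smooth g \<Longrightarrow> smooth (\<lambda>x. f x + g x)"
  by (rule smooth_if_smooth2) (intro smooth2_add smooth2_fst)

lemma smooth_mult: "smooth f \<Longrightarrow> smooth g \<Longrightarrow> smooth (\<lambda>x. f x * g x)"
  by (rule smooth_if_smooth2) (intro smooth2_mult smooth2_fst)

lemma smooth_compose: "smooth u \<Longrightarrow> smooth f \<Longrightarrow> smooth (\<lambda>x. u (f x))"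
  by (rule smooth_if_smooth2, rule smooth2_compose, assumption, rule smooth2_fst)

lemma smooth_inverse: "smooth f \<Longrightarrow> (\<And>x. f x \<noteq> 0) \<Longrightarrow> smooth (\<lambda>x. inverse (f x))"
  by (rule smooth_if_smooth2, rule smooth2_inverse, rule smooth2_fst) auto

lemma smooth_diff: "smooth f \<Longrightarrow> smooth g \<Longrightarrow> smooth (\<lambda>x. f x - g x)"
  by (rule smooth_if_smooth2) (intro smooth2_diff smooth2_fst)

lemma smooth_divide: "smooth f \<Longrightarrow> smooth g \<Longrightarrow> (\<And>x. g x \<noteq> 0) \<Longrightarrow> smooth (\<lambda>x. f x / g x)"
  by (simp add: divide_inverse smooth_mult smooth_inverse)

lemma smooth_ident: "smooth (\<lambda>x. x)"
  by (rule smooth_SucI[where f'="\<lambda>_. 1"]) (auto intro: smooth_const)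

lemma smooth_exp: "smooth exp"
  by (rule smooth_coinduct[where C="{exp}"]) (auto intro: DERIV_exp)

text \<open>The square root is not smooth at 0, but \<open>sqrt f = exp (ln f / 2)\<close>, and
  \<open>ln f\<close> has the smooth derivative \<open>f' / f\<close>.\<close>

lemma smooth_sqrt_compose:
  assumes "smooth f" "\<And>x. f x > 0"
  shows "smooth (\<lambda>x. sqrt (f x))"
proof -
  have *: "smooth (\<lambda>x. ln (f x))"
  proof (rule smooth_SucI)
    show "((\<lambda>x. ln (f x)) has_real_derivative deriv f x / f x) (at x)" for x
      using assms by (auto intro!: derivative_eq_intros smooth_has_deriv)
  qed (use assms in \<open>auto intro!: smooth_divide smooth_deriv simp: less_imp_neq[symmetric]\<close>)
  have "sqrt (f x) = exp (1/2 * ln (f x))" for x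
    using assms(2)[of x] by (simp add: ln_sqrt[symmetric])
  then show ?thesis
    by (simp only:) (intro smooth_compose[OF smooth_exp] smooth_mult smooth_const *)
qed

section \<open>A smooth step function and a smooth cut-off of the reciprocal\<close>

definition flat_poly :: "real poly \<Rightarrow> real \<Rightarrow> real" where
  "flat_poly p x = (if x > 0 then poly p (1 / x) * exp (- (1 / x)) else 0)"

lemma poly_exp_minus_tendsto_0: "((\<lambda>t. poly p t * exp (- t)) \<longlongrightarrow> (0::real)) at_top"
proof -
  have "(\<lambda>t. poly p t * exp (- t)) = (\<lambda>t. \<Sum>i\<le>degree p. coeff p i * (t ^ i / exp t))"
    by (simp add: fun_eq_iff poly_altdef sum_distrib_right exp_minus divide_inverse mult.assoc)
  moreover have "((\<lambda>t. \<Sum>i\<le>degree p. coeff p i * (t ^ i / exp t)) \<longlongrightarrow>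
      (\<Sum>i\<le>degree p. coeff p i * 0)) at_top"
    by (intro tendsto_intros tendsto_power_div_exp_0)
  ultimately show ?thesis by simp
qed

text \<open>The derivative of \<open>p (1/x) * exp (- 1/x)\<close> is
  \<open>(p - p') (1/x) * exp (- 1/x) / x^2\<close>, and the two \<open>pCons 0\<close> multiply by
  the square of \<open>1/x\<close>. Allowing polynomial factors thus makes the family closed under
  differentiation, as \<open>smooth_coinduct\<close> requires; the flat function itself is the case
  \<open>p = 1\<close>.\<close>

lemma flat_poly_has_deriv:
  "(flat_poly p has_real_derivative flat_poly (pCons 0 (pCons 0 (p - pderiv p))) x) (at x)"
proof -
  consider "x > 0" | "x < 0" | "x = 0" by linarith
  then show ?thesis
  proof cases
    case 1
    have "((\<lambda>x. poly p (1 / x) * exp (- (1 / x))) has_real_derivative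
       flat_poly (pCons 0 (pCons 0 (p - pderiv p))) x) (at x)"
      using 1 by (auto intro!: derivative_eq_intros DERIV_chain2[OF poly_DERIV]
        simp: flat_poly_def field_simps power2_eq_square)
    moreover have "\<forall>\<^sub>F u in nhds x. flat_poly p u = poly p (1 / u) * exp (- (1 / u))"
      using eventually_nhds_in_open[of "{0<..}" x] 1
      by (auto simp: flat_poly_def elim!: eventually_mono)
    ultimately show ?thesis by (subst DERIV_cong_ev[OF refl _ refl])
  next
    case 2
    have "\<forall>\<^sub>F u in nhds x. flat_poly p u = 0"
      using eventually_nhds_in_open[of "{..<0}" x] 2
      by (auto simp: flat_poly_def elim!: eventually_mono)
    then have "(flat_poly p has_real_derivative 0) (at x)"
      by (subst DERIV_cong_ev[OF refl _ refl]) auto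
    then show ?thesis using 2 by (simp add: flat_poly_def)
  next
    case 3
    \<comment> \<open>The difference quotient of \<open>flat_poly p\<close> at 0 is
      \<open>flat_poly (pCons 0 p)\<close>, so its limit is the derivative there.\<close>
    have "((\<lambda>x. flat_poly (pCons 0 p) x) \<longlongrightarrow> 0) (at_right 0)"
    proof -
      have "((\<lambda>x. poly (pCons 0 p) (inverse x) * exp (- inverse x)) \<longlongrightarrow> 0) (at_right 0)"
        using filterlim_compose[OF poly_exp_minus_tendsto_0 filterlim_inverse_at_top_right] .
      then show ?thesis
        by (rule Lim_transform_eventually)
           (auto simp: flat_poly_def eventually_at_filter inverse_eq_divide)
    qed
    moreover have "((\<lambda>x. flat_poly (pCons 0 p) x) \<longlongrightarrow> 0) (at_left 0)"
      by (rule tendsto_eventually) (auto simp: flat_poly_def eventually_at_filter)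
    ultimately have "((\<lambda>x. flat_poly (pCons 0 p) x) \<longlongrightarrow> 0) (at 0)"
      by (simp add: filterlim_split_at)
    then have "((\<lambda>y. (flat_poly p y - flat_poly p 0) / (y - 0)) \<longlongrightarrow> 0) (at 0)"
      by (rule Lim_transform_eventually) (auto simp: flat_poly_def eventually_at_filter)
    then have "(flat_poly p has_real_derivative 0) (at 0)" by (simp add: has_field_derivative_iff)
    then show ?thesis using 3 by (simp add: flat_poly_def)
  qed
qed

lemma smooth_flat_poly: "smooth (flat_poly p)"
  by (rule smooth_coinduct[where C="range flat_poly"]) (auto intro: flat_poly_has_deriv)

definition step :: "real \<Rightarrow> real" where
  "step x = flat_poly 1 x / (flat_poly 1 x + flat_poly 1 (1 - x))"

lemma flat_poly_1_nonneg: "flat_poly 1 x \<ge> 0" by (simp add: flat_poly_def)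

lemma step_denom_pos: "flat_poly 1 x + flat_poly 1 (1 - x) > 0"
  by (cases "x > 0") (auto simp: flat_poly_def add_pos_nonneg)

lemma smooth_step: "smooth step"
  unfolding step_def
  by (intro smooth_divide smooth_add smooth_compose[OF smooth_flat_poly] smooth_ident smooth_diff smooth_const)
     (use step_denom_pos in \<open>simp add: less_imp_neq[symmetric]\<close>)

lemma step_eq_0: "x \<le> 0 \<Longrightarrow> step x = 0"
  and step_eq_1: "x \<ge> 1 \<Longrightarrow> step x = 1"
  by (auto simp: step_def flat_poly_def)

lemma step_nonneg: "step x \<ge> 0" and step_le_1: "step x \<le> 1"
  using flat_poly_1_nonneg[of x] flat_poly_1_nonneg[of "1 - x"] step_denom_pos[of x]
  by (auto simp: step_def divide_le_eq)

text \<open>A smooth function on the whole line agreeing with the reciprocal on \<open>[e, \<infinity>)\<close>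
  and vanishing on \<open>(-\<infinity>, e/2]\<close>.\<close>

definition cut_inverse :: "real \<Rightarrow> real \<Rightarrow> real" where
  "cut_inverse e r = step (2 * r / e - 1) * inverse (r * step (4 * r / e - 1) + (1 - step (4 * r / e - 1)))"

text \<open>The denominator is a convex combination of \<open>r\<close> and 1 whose weight on
  \<open>r\<close> vanishes for \<open>r \<le> e / 4\<close>. It has become \<open>r\<close> at
  \<open>e / 2\<close>, before the numerator ceases to be zero.\<close>

lemma cut_inverse_denom_pos:
  assumes "e > 0" shows "r * step (4 * r / e - 1) + (1 - step (4 * r / e - 1)) > 0"
proof (cases "r > 0")
  case True
  then show ?thesis using step_nonneg[of "4 * r / e - 1"] step_le_1[of "4 * r / e - 1"]
    by (cases "step (4 * r / e - 1) = 1") (auto simp: add_nonneg_pos)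
next
  case False
  then have "4 * r / e - 1 \<le> 0" using assms by (simp add: field_simps)
  then show ?thesis by (simp add: step_eq_0)
qed

lemma smooth_cut_inverse: "e > 0 \<Longrightarrow> smooth (cut_inverse e)"
  unfolding cut_inverse_def divide_inverse
  by (intro smooth_mult smooth_inverse smooth_add smooth_compose[OF smooth_step] smooth_ident smooth_diff smooth_const)
     (metis cut_inverse_denom_pos divide_inverse less_irrefl)

lemma cut_inverse_eq_0: "e > 0 \<Longrightarrow> r \<le> e / 2 \<Longrightarrow> cut_inverse e r = 0"
  by (simp add: cut_inverse_def step_eq_0 field_simps)

lemma cut_inverse_eq: "e > 0 \<Longrightarrow> r \<ge> e \<Longrightarrow> cut_inverse e r = 1 / r"
  by (simp add: cut_inverse_def step_eq_1 field_simps)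

lemma cut_inverse_nonneg: "e > 0 \<Longrightarrow> cut_inverse e r \<ge> 0"
  using cut_inverse_denom_pos[of e r] by (auto simp: cut_inverse_def step_nonneg intro!: mult_nonneg_nonneg less_imp_le)

section \<open>Scale, speed and the Poisson equation\<close>

lemma interval_integral_has_real_derivative:
  fixes f :: "real \<Rightarrow> real"
  assumes "continuous_on UNIV f"
  shows "((\<lambda>u. LBINT y=ereal c..ereal u. f y) has_real_derivative f x) (at x)"
proof -
  \<comment> \<open>The interval has to contain \<open>c\<close> and to have \<open>x\<close> in its
    interior.\<close>
  have "((\<lambda>u. LBINT y=ereal c..ereal u. f y) has_vector_derivative f x)
      (at x within {min c (x - 1)..max c (x + 1)})"
    by (intro interval_integral_FTC2 continuous_on_subset[OF assms]) auto
  moreover have "at x within {min c (x - 1)..max c (x + 1)} = at x"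
    by (rule at_within_interior)
       (auto simp: interior_atLeastAtMost_real min_less_iff_disj less_max_iff_disj)
  ultimately show ?thesis by (simp add: has_real_derivative_iff_has_vector_derivative)
qed

text \<open>Both \<open>g - f\<close> and \<open>g + f\<close> are nondecreasing and vanish at 0.
  Hence \<open>\<bar>f\<bar> \<le> g\<close> to the right of 0 and
  \<open>\<bar>f\<bar> \<le> - g\<close> to the left.\<close>

lemma abs_le_of_deriv_le:
  fixes f g :: "real \<Rightarrow> real"
  assumes f: "\<And>x. (f has_real_derivative f' x) (at x)" and g: "\<And>x. (g has_real_derivative g' x) (at x)"
    and le: "\<And>x. \<bar>f' x\<bar> \<le> g' x" and 0: "f 0 = 0" "g 0 = 0"
  shows "\<bar>f x\<bar> \<le> \<bar>g x\<bar>"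
proof -
  have d1: "((\<lambda>x. g x - f x) has_real_derivative g' x - f' x) (at x)"
    and d2: "((\<lambda>x. g x + f x) has_real_derivative g' x + f' x) (at x)" for x
    by (auto intro!: derivative_eq_intros f g)
  have le': "0 \<le> g' x - f' x" "0 \<le> g' x + f' x" for x using le[of x] by linarith+
  have m1: "g x - f x \<le> g y - f y" if "x \<le> y" for x y
    by (rule DERIV_nonneg_imp_nondecreasing[OF that, where f="\<lambda>x. g x - f x"]) (use d1 le' in blast)
  have m2: "g x + f x \<le> g y + f y" if "x \<le> y" for x y
    by (rule DERIV_nonneg_imp_nondecreasing[OF that, where f="\<lambda>x. g x + f x"]) (use d2 le' in blast)
  show ?thesis
    using m1[of 0 x] m1[of x 0] m2[of 0 x] m2[of x 0] 0 by (cases "x \<ge> 0") auto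
qed

locale posrec =
  fixes a b :: "real \<Rightarrow> real"
  assumes smooth_a: "smooth a" and smooth_b: "smooth b" and a_pos: "a x > 0"
    and posrec: "positive_recurrent a b" and I_fin: "I_max a b < \<infinity>"
begin

lemma a_neq_0: "a x \<noteq> 0" using a_pos[of x] by simp

abbreviation "c \<equiv> c_fun a b"

abbreviation "\<rho> \<equiv> mu_dens a b"

definition m :: real where "m = enn2real (m_mass a b)"

lemma c_has_deriv: "(c has_real_derivative b x / a x) (at x)"
  unfolding c_fun_def
  by (intro interval_integral_has_real_derivative smooth_continuous smooth_divide smooth_a smooth_b a_neq_0)

lemma smooth_c: "smooth c"
  by (rule smooth_SucI[OF c_has_deriv]) (intro smooth_divide smooth_a smooth_b a_neq_0)

lemma continuous_c: "continuous_on S c" by (rule smooth_continuous[OF smooth_c])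

lemma borel_a [measurable]: "a \<in> borel_measurable borel"
  and borel_c [measurable]: "c \<in> borel_measurable borel"
  by (intro borel_measurable_continuous_onI smooth_continuous smooth_a smooth_c)+

lemma m_pos: "m > 0"
proof -
  have fin: "m_mass a b < \<infinity>" using posrec by (simp add: positive_recurrent_def)
  have "m_mass a b \<noteq> 0"
  proof
    assume "m_mass a b = 0"
    then have "AE x in lborel. ennreal (exp (c x) / a x) = 0"
      unfolding m_mass_def by (subst (asm) nn_integral_0_iff_AE) auto
    then have "AE x in lborel. x \<in> ({} :: real set)"
      by (rule AE_mp) (use a_pos in \<open>auto simp: ennreal_eq_0_iff divide_le_0_iff not_le intro!: AE_I2\<close>)
    then have "emeasure lborel (UNIV :: real set) = 0" by (simp add: AE_iff_measurable[OF _ refl])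
    then show False by simp
  qed
  then show ?thesis using fin by (simp add: m_def enn2real_positive_iff zero_less_iff_neq_zero)
qed

lemma rho_eq: "\<rho> x = exp (c x) / (m * a x)" by (simp add: mu_dens_def m_def)

lemma rho_pos: "\<rho> x > 0" using m_pos a_pos[of x] by (simp add: rho_eq)

lemma smooth_rho: "smooth \<rho>"
proof -
  have "smooth (\<lambda>x. exp (c x) / (m * a x))"
    using m_pos a_neq_0
    by (intro smooth_divide smooth_compose[OF smooth_exp smooth_c] smooth_mult smooth_const smooth_a) auto
  then show ?thesis by (simp add: rho_eq[abs_def])
qed

lemma continuous_rho: "continuous_on S \<rho>" by (rule smooth_continuous[OF smooth_rho])

lemma borel_rho [measurable]: "\<rho> \<in> borel_measurable borel"
  by (intro borel_measurable_continuous_onI continuous_rho)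

text \<open>The equation \<open>(a \<rho>)' = b \<rho>\<close>, solved for \<open>\<rho>'\<close>.\<close>

lemma rho_has_deriv: "(\<rho> has_real_derivative (b x - deriv a x) / a x * \<rho> x) (at x)"
proof -
  have "((\<lambda>x. exp (c x) / (m * a x)) has_real_derivative (b x - deriv a x) / a x * \<rho> x) (at x)"
    using m_pos a_neq_0[of x]
    by (auto intro!: derivative_eq_intros c_has_deriv smooth_has_deriv smooth_a
        simp: rho_eq field_simps power2_eq_square)
  then show ?thesis by (simp add: rho_eq[abs_def])
qed

section \<open>The invariant distribution and its distribution function\<close>

sublocale mu: prob_space "mu a b"
proof
  have "m_mass a b < \<infinity>" using posrec by (simp add: positive_recurrent_def)
  then have me: "ennreal m = m_mass a b" by (simp add: m_def)
  have "emeasure (mu a b) (space (mu a b)) = (\<integral>\<^sup>+x. ennreal (\<rho> x) \<partial>lborel)"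
    by (simp add: mu_def emeasure_density)
  also have "\<dots> = (\<integral>\<^sup>+x. ennreal (1 / m) * ennreal (exp (c x) / a x) \<partial>lborel)"
    using m_pos a_pos by (intro nn_integral_cong) (simp add: rho_eq ennreal_mult[symmetric] less_imp_le)
  also have "\<dots> = ennreal (1 / m) * ennreal m"
    by (subst nn_integral_cmult) (auto simp: me m_mass_def)
  also have "\<dots> = 1" using m_pos by (simp add: ennreal_mult[symmetric] del: ennreal_mult'')
  finally show "emeasure (mu a b) (space (mu a b)) = 1" .
qed

lemma sets_mu [measurable_cong, simp]: "sets (mu a b) = sets borel"
  and space_mu [simp]: "space (mu a b) = UNIV"
  by (auto simp: mu_def)

definition F :: "real \<Rightarrow> real" where "F x = measure (mu a b) {..x}"

text \<open>Stated for an arbitrary primitive of the density, because \<open>F_has_deriv\<close>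
  deduces from it that \<open>F\<close> is one.\<close>

lemma measure_mu_Icc_primitive:
  assumes "\<And>x. (R has_real_derivative \<rho> x) (at x)" "x \<le> y"
  shows "measure (mu a b) {x..y} = R y - R x"
proof -
  have "emeasure (mu a b) {x..y} = (\<integral>\<^sup>+u. ennreal (\<rho> u) * indicator {x..y} u \<partial>lborel)"
    by (simp add: mu_def emeasure_density)
  also have "\<dots> = ennreal (R y - R x)"
    by (intro nn_integral_FTC_Icc assms(1)[THEN DERIV_subset])
       (use assms rho_pos in \<open>auto intro: less_imp_le has_field_derivative_at_within\<close>)
  finally have "emeasure (mu a b) {x..y} = ennreal (R y - R x)" .
  moreover have "R x \<le> R y"
    by (rule DERIV_nonneg_imp_nondecreasing[OF assms(2)]) (use assms(1) rho_pos less_imp_le in blast)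
  ultimately show ?thesis by (simp add: measure_def)
qed

lemma measure_mu_singleton: "measure (mu a b) {x} = 0"
  using measure_mu_Icc_primitive[OF interval_integral_has_real_derivative[OF continuous_rho], of x x] by simp

lemma measure_mu_Icc: "x \<le> y \<Longrightarrow> measure (mu a b) {x..y} = F y - F x"
proof -
  assume "x \<le> y"
  then have e: "{..y} = {..x} \<union> {x<..y}" "{x..y} = {x} \<union> {x<..y}" by auto
  have "measure (mu a b) {..y} = measure (mu a b) {..x} + measure (mu a b) {x<..y}"
    unfolding e(1) by (rule mu.finite_measure_Union) auto
  moreover have "measure (mu a b) {x..y} = measure (mu a b) {x} + measure (mu a b) {x<..y}"
    unfolding e(2) by (rule mu.finite_measure_Union) auto
  ultimately show ?thesis by (simp add: F_def measure_mu_singleton)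
qed

lemma measure_mu_atLeast: "measure (mu a b) {x..} = 1 - F x"
proof -
  have "measure (mu a b) (UNIV - {..x}) = 1 - F x"
    using mu.prob_compl[of "{..x}"] by (simp add: F_def)
  moreover have "UNIV - {..x} = {x<..}" by auto
  moreover have "{x..} = {x} \<union> {x<..}" by auto
  then have "measure (mu a b) {x..} = measure (mu a b) {x} + measure (mu a b) {x<..}"
    by (simp only:) (subst mu.finite_measure_Union[symmetric], auto)
  ultimately show ?thesis by (simp add: measure_mu_singleton)
qed

lemma F_has_deriv: "(F has_real_derivative \<rho> x) (at x)"
proof -
  define R where "R u = (LBINT y=ereal 0..ereal u. \<rho> y)" for u
  have R: "(R has_real_derivative \<rho> x) (at x)" for x
    unfolding R_def by (intro interval_integral_has_real_derivative continuous_rho)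
  have "F y - F x = R y - R x" if "x \<le> y" for x y
    using measure_mu_Icc_primitive[OF R that] measure_mu_Icc[OF that] by simp
  from this[of 0] this[of _ 0] have "F y = R y + (F 0 - R 0)" for y
    by (cases "y \<ge> 0") (auto simp: algebra_simps)
  then have "F = (\<lambda>y. R y + (F 0 - R 0))" by (rule ext)
  moreover have "((\<lambda>y. R y + (F 0 - R 0)) has_real_derivative \<rho> x) (at x)"
    by (auto intro!: derivative_eq_intros R)
  ultimately show ?thesis by argo
qed

lemma smooth_F: "smooth F"
  by (rule smooth_SucI[OF F_has_deriv smooth_rho])

lemma F_strict: "x < y \<Longrightarrow> F x < F y"
  by (rule DERIV_pos_imp_increasing[where f=F], assumption) (rule exI, rule conjI, rule F_has_deriv, rule rho_pos)

lemma F_mono: "x \<le> y \<Longrightarrow> F x \<le> F y"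
  using F_strict[of x y] by (cases "x = y") auto

lemma F_pos: "0 < F x"
  using F_strict[of "x - 1" x] measure_nonneg[of "mu a b" "{..x - 1}"]
  unfolding F_def by linarith

lemma F_less_1: "F x < 1"
  using F_strict[of x "x + 1"] mu.prob_le_1[of "{..x+1}"]
  unfolding F_def by linarith

text \<open>The function \<open>scale_int\<close> is the scale function of \<open>L\<close>.\<close>

definition scale_int :: "real \<Rightarrow> real" where
  "scale_int x = (LBINT y=ereal 0..ereal x. exp (- c y))"

lemma scale_int_has_deriv: "(scale_int has_real_derivative exp (- c x)) (at x)"
  unfolding scale_int_def
  by (intro interval_integral_has_real_derivative continuous_intros continuous_c)

lemma scale_int_0: "scale_int 0 = 0" by (simp add: scale_int_def)

lemma continuous_scale_int: "continuous_on S scale_int"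
  by (meson DERIV_isCont continuous_at_imp_continuous_on scale_int_has_deriv)

lemma scale_int_mono: "x \<le> y \<Longrightarrow> scale_int x \<le> scale_int y"
  by (rule DERIV_nonneg_imp_nondecreasing[where f=scale_int], assumption) (rule exI, rule conjI, rule scale_int_has_deriv, rule exp_ge_zero)

lemma borel_scale_int [measurable]: "scale_int \<in> borel_measurable borel"
  by (intro borel_measurable_continuous_onI continuous_scale_int)

text \<open>The dominating function for \<open>W\<close>: its limits at plus and minus infinity are
  \<open>I_plus\<close> and minus \<open>I_minus\<close>.\<close>

definition dom_int :: "real \<Rightarrow> real" where
  "dom_int x = (LBINT y=ereal 0..ereal x. \<bar>scale_int y\<bar> * \<rho> y)"

lemma dom_int_has_deriv: "(dom_int has_real_derivative \<bar>scale_int x\<bar> * \<rho> x) (at x)"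
  unfolding dom_int_def
  by (intro interval_integral_has_real_derivative continuous_intros continuous_rho continuous_scale_int)

lemma nn_integral_exp_minus_c:
  "x \<le> y \<Longrightarrow> (\<integral>\<^sup>+u\<in>{x..y}. ennreal (exp (- c u)) \<partial>lborel) = ennreal (scale_int y - scale_int x)"
  by (intro nn_integral_FTC_Icc) (auto intro: scale_int_has_deriv has_field_derivative_at_within)

lemma nn_integral_dom_int:
  "x \<le> y \<Longrightarrow> (\<integral>\<^sup>+u\<in>{x..y}. ennreal (\<bar>scale_int u\<bar> * \<rho> u) \<partial>lborel) = ennreal (dom_int y - dom_int x)"
  by (intro nn_integral_FTC_Icc)
     (auto intro!: dom_int_has_deriv has_field_derivative_at_within mult_nonneg_nonneg
       rho_pos[THEN less_imp_le])

text \<open>The inner integrals of \<open>I_plus\<close> and \<open>I_minus\<close> are the absolute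
  values of \<open>scale_int\<close> on the two half-lines, so \<open>dom_int\<close> is a partial
  integral of one or the other. This is where the finiteness of \<open>I\<close> enters.\<close>

lemma dom_int_bounded: "\<exists>C. \<forall>x. \<bar>dom_int x\<bar> \<le> C"
proof -
  have fin: "I_plus a b < \<infinity>" "I_minus a b < \<infinity>" using I_fin by (auto simp: I_max_def)
  have up: "ennreal (dom_int x) \<le> I_plus a b" if "0 \<le> x" for x
  proof -
    have "ennreal (dom_int x) = (\<integral>\<^sup>+u\<in>{0..x}. ennreal (\<bar>scale_int u\<bar> * \<rho> u) \<partial>lborel)"
      by (subst nn_integral_dom_int[OF that]) (simp add: dom_int_def)
    also have "\<dots> \<le> (\<integral>\<^sup>+u. ennreal (\<rho> u) * (ennreal (scale_int u) * indicator {0..} u) \<partial>lborel)"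
      using scale_int_mono[of 0] scale_int_0 rho_pos
      by (intro nn_integral_mono)
         (auto simp: indicator_def ennreal_mult[symmetric] less_imp_le mult.commute)
    also have "\<dots> = (\<integral>\<^sup>+u. ennreal (scale_int u) * indicator {0..} u \<partial>mu a b)"
      unfolding mu_def by (subst nn_integral_density) auto
    also have "\<dots> = I_plus a b"
      unfolding I_plus_def
      by (intro nn_integral_cong) (simp add: nn_integral_exp_minus_c scale_int_0 split: split_indicator)
    finally show ?thesis .
  qed
  have dn: "ennreal (- dom_int x) \<le> I_minus a b" if "x \<le> 0" for x
  proof -
    have "ennreal (- dom_int x) = (\<integral>\<^sup>+u\<in>{x..0}. ennreal (\<bar>scale_int u\<bar> * \<rho> u) \<partial>lborel)"
      by (subst nn_integral_dom_int[OF that]) (simp add: dom_int_def)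
    also have "\<dots> \<le> (\<integral>\<^sup>+u. ennreal (\<rho> u) * (ennreal (- scale_int u) * indicator {..0} u) \<partial>lborel)"
      using scale_int_mono[of _ 0] scale_int_0 rho_pos
      by (intro nn_integral_mono)
         (auto simp: indicator_def ennreal_mult[symmetric] less_imp_le mult.commute abs_of_nonpos)
    also have "\<dots> = (\<integral>\<^sup>+u. ennreal (- scale_int u) * indicator {..0} u \<partial>mu a b)"
      unfolding mu_def by (subst nn_integral_density) auto
    also have "\<dots> = I_minus a b"
      unfolding I_minus_def
      by (intro nn_integral_cong) (simp add: nn_integral_exp_minus_c scale_int_0 split: split_indicator)
    finally show ?thesis .
  qed
  have "\<bar>dom_int x\<bar> \<le> enn2real (I_plus a b) + enn2real (I_minus a b)" for x
  proof (cases "0 \<le> x")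
    case True
    have "0 \<le> dom_int x"
      using DERIV_nonneg_imp_nondecreasing[OF True, of dom_int] dom_int_has_deriv rho_pos
      by (metis abs_ge_zero dom_int_def interval_integral_endpoints_same less_imp_le mult_nonneg_nonneg)
    then show ?thesis using up[OF True] fin
      by (metis abs_of_nonneg add_increasing2 enn2real_mono enn2real_nonneg enn2real_ennreal infinity_ennreal_def)
  next
    case False
    then have "x \<le> 0" by simp
    then have "dom_int x \<le> 0"
      using DERIV_nonneg_imp_nondecreasing[of x 0 dom_int] dom_int_has_deriv rho_pos
      by (metis abs_ge_zero dom_int_def interval_integral_endpoints_same less_imp_le mult_nonneg_nonneg)
    then show ?thesis using dn[OF \<open>x \<le> 0\<close>] fin
      by (metis abs_of_nonpos add_increasing enn2real_mono enn2real_nonneg enn2real_ennreal infinity_ennreal_def neg_0_le_iff_le)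
  qed
  then show ?thesis by blast
qed

text \<open>\<open>poisson k\<close> solves \<open>L f = - 1\<close>, and \<open>W k\<close> integrates it against \<open>\<mu>\<close>.
  The value \<open>k = 0\<close> suits the interior and the left face, \<open>k = 1\<close> the right face.\<close>

definition poisson :: "real \<Rightarrow> real \<Rightarrow> real" where
  "poisson k x = (LBINT y=ereal 0..ereal x. (k - F y) / (a y * \<rho> y))"

definition W :: "real \<Rightarrow> real \<Rightarrow> real" where
  "W k x = (LBINT y=ereal 0..ereal x. poisson k y * \<rho> y)"

lemma smooth_poisson_integrand: "smooth (\<lambda>y. (k - F y) / (a y * \<rho> y))"
  using a_neq_0 rho_pos
  by (intro smooth_divide smooth_diff smooth_const smooth_F smooth_mult smooth_a smooth_rho)
     (auto simp: less_imp_neq[symmetric])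

text \<open>From \<open>(a \<rho>)' = b \<rho>\<close> one gets
  \<open>(a \<rho> f')' = \<rho> * L f\<close>. Hence \<open>a \<rho> f' = k - F\<close> has
  derivative \<open>- \<rho>\<close>, which is \<open>L f = - 1\<close>.\<close>

lemma poisson_has_deriv: "(poisson k has_real_derivative (k - F x) / (a x * \<rho> x)) (at x)"
  unfolding poisson_def
  by (intro interval_integral_has_real_derivative smooth_continuous smooth_poisson_integrand)

lemma smooth_poisson: "smooth (poisson k)"
  by (rule smooth_SucI[OF poisson_has_deriv smooth_poisson_integrand])

lemma W_has_deriv: "(W k has_real_derivative poisson k x * \<rho> x) (at x)"
  unfolding W_def
  by (intro interval_integral_has_real_derivative smooth_continuous smooth_mult smooth_poisson smooth_rho)

lemma smooth_W: "smooth (W k)"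
  by (rule smooth_SucI[OF W_has_deriv smooth_mult[OF smooth_poisson smooth_rho]])

text \<open>For \<open>k\<close> in [0, 1] one has \<open>\<bar>k - F\<bar> \<le> 1\<close>, and
  \<open>1 / (a \<rho>) = m * exp (- c)\<close> is \<open>m\<close> times the derivative of the
  scale function. Integrating once bounds \<open>poisson k\<close> by \<open>m * scale_int\<close>,
  and integrating against \<mu> bounds \<open>W k\<close> by \<open>m * dom_int\<close>, in absolute
  value.\<close>

lemma W_bounded:
  assumes "0 \<le> k" "k \<le> 1"
  shows "\<exists>C\<ge>0. \<forall>x. \<bar>W k x\<bar> \<le> C"
proof -
  have p: "\<bar>poisson k x\<bar> \<le> \<bar>m * scale_int x\<bar>" for x
  proof (rule abs_le_of_deriv_le[where f="poisson k" and g="\<lambda>x. m * scale_int x"])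
    show "(poisson k has_real_derivative (k - F x) / (a x * \<rho> x)) (at x)" for x
      by (rule poisson_has_deriv)
    show "((\<lambda>x. m * scale_int x) has_real_derivative m * exp (- c x)) (at x)" for x
      by (auto intro!: derivative_eq_intros scale_int_has_deriv)
    have "\<bar>k - F x\<bar> \<le> 1" for x using F_pos[of x] F_less_1[of x] assms by linarith
    moreover have "(k - F x) / (a x * \<rho> x) = (k - F x) * (m * exp (- c x))" for x
      using m_pos a_pos[of x] by (simp add: rho_eq exp_minus field_simps)
    ultimately show "\<bar>(k - F x) / (a x * \<rho> x)\<bar> \<le> m * exp (- c x)" for x
      using m_pos by (simp add: abs_mult mult_left_le_one_le)
  qed (auto simp: poisson_def scale_int_0)
  have w: "\<bar>W k x\<bar> \<le> \<bar>m * dom_int x\<bar>" for x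
  proof (rule abs_le_of_deriv_le[where f="W k" and g="\<lambda>x. m * dom_int x"])
    show "(W k has_real_derivative poisson k x * \<rho> x) (at x)" for x by (rule W_has_deriv)
    show "((\<lambda>x. m * dom_int x) has_real_derivative m * (\<bar>scale_int x\<bar> * \<rho> x)) (at x)" for x
      by (auto intro!: derivative_eq_intros dom_int_has_deriv)
    show "\<bar>poisson k x * \<rho> x\<bar> \<le> m * (\<bar>scale_int x\<bar> * \<rho> x)" for x
      using p[of x] m_pos rho_pos[of x] by (simp add: abs_mult)
  qed (auto simp: W_def dom_int_def)
  obtain C where C: "\<bar>dom_int x\<bar> \<le> C" for x using dom_int_bounded by blast
  have "0 \<le> C" using C[of 0] by linarith
  moreover have "\<bar>W k x\<bar> \<le> m * C" for x
    using w[of x] C[of x] m_pos by (simp add: abs_mult order_trans[OF w[of x, unfolded abs_mult]] mult_left_mono)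
  ultimately show ?thesis using m_pos by (intro exI[of _ "m * C"]) auto
qed

end

section \<open>Superharmonic functions for the dual generator\<close>

lemma deriv_eq_on_open:
  assumes "open U" "x \<in> U" "\<And>u. u \<in> U \<Longrightarrow> f u = g u" "(g has_real_derivative d) (at x)"
  shows "deriv f x = d"
proof -
  have "(f has_real_derivative d) (at x)"
    by (rule has_field_derivative_transform_within_open[OF assms(4,1,2)]) (use assms(3) in simp)
  then show ?thesis by (rule DERIV_imp_deriv)
qed

text \<open>The last term is written as \<open>- 2 * h' / h\<close> times the quotient itself, the
  shape in which it will cancel against the drift of the Doob transform.\<close>

lemma DERIV_divide_square:
  fixes f h :: "real \<Rightarrow> real"
  assumes "(f has_real_derivative f') (at x)" "(h has_real_derivative h') (at x)" "h x \<noteq> 0"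
  shows "((\<lambda>u. f u / (h u)\<^sup>2) has_real_derivative f' / (h x)\<^sup>2 - 2 * h' * (f x / (h x)\<^sup>2) / h x) (at x)"
proof -
  have "((\<lambda>u. f u / (h u)\<^sup>2) has_real_derivative
      (f' * (h x)\<^sup>2 - f x * (2 * h x * h')) / ((h x)\<^sup>2 * (h x)\<^sup>2)) (at x)"
    using assms(3) by (auto intro!: derivative_eq_intros assms(1,2) simp: power2_eq_square)
  moreover have "(f' * (h x)\<^sup>2 - f x * (2 * h x * h')) / ((h x)\<^sup>2 * (h x)\<^sup>2) =
      f' / (h x)\<^sup>2 - 2 * h' * (f x / (h x)\<^sup>2) / h x"
    using assms(3) by (simp add: divide_simps power2_eq_square) (simp add: algebra_simps)
  ultimately show ?thesis by simp
qed

text \<open>Regrouping only: the products \<open>sy * By'\<close> and \<open>sy * By * qy'\<close>,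
  and their counterparts in \<open>x\<close>, become visible units for which closed forms are
  known.\<close>

lemma nabla_quotient_eq:
  fixes h :: real
  assumes "h \<noteq> 0"
  shows "sy * ((By' * Qy + By * (qy' * h) + Bx * (qx * ry - qy * ry)) / h\<^sup>2 - 2 * ry * N / h)
   - sx * ((By * (qx * rx - qy * rx) + Bx' * Qx + Bx * (qx' * h)) / h\<^sup>2 - 2 * - rx * N / h)
  = ((sy * By') * Qy - (sx * Bx') * Qx + (sy * By * qy' - sx * Bx * qx') * h
      + (qx - qy) * (sy * ry * Bx - sx * rx * By)) / h\<^sup>2 - 2 * (sy * ry + sx * rx) * N / h"
  using assms by (simp add: divide_simps) (simp add: algebra_simps)

text \<open>The factor multiplying \<open>z\<close>, which collects the mixed derivatives, is zero,
  and the constant \<open>k\<close> cancels between the two endpoints.\<close>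

lemma nabla_square_eq:
  fixes h :: real
  assumes "h \<noteq> 0"
  shows "(\<beta>y * ry * Qy - \<beta>x * rx * Qx + (k - Fy - (k - Fx)) * h
      + z * (sy * ry * (sx * rx) - sx * rx * (sy * ry))) / h\<^sup>2 - w =
   \<beta>y * (ry * Qy / h\<^sup>2) + \<beta>x * (- rx * Qx / h\<^sup>2) + (Fx - Fy) / h - w"
  using assms by (simp add: divide_simps) (simp add: algebra_simps power2_eq_square)

context posrec
begin

definition sqa :: "real \<Rightarrow> real" where "sqa x = sqrt (a x)"

lemma sqa_pos: "sqa x > 0" and sqa_sq: "sqa x * sqa x = a x"
  using a_pos[of x] by (auto simp: sqa_def)

lemma smooth_sqa: "smooth sqa"
  unfolding sqa_def[abs_def] by (rule smooth_sqrt_compose[OF smooth_a a_pos])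

lemma sqa_has_deriv: "(sqa has_real_derivative deriv a x / (2 * sqa x)) (at x)"
  unfolding sqa_def[abs_def] using a_pos[of x]
  by (auto intro!: derivative_eq_intros smooth_has_deriv smooth_a simp: field_simps)

text \<open>The operator on a one-dimensional face is the Doob transform, by the positive function
  \<open>H\<close>, of an operator that maps \<open>P\<close> to \<open>- H\<close> and \<open>H\<close> to \<open>0\<close>.\<close>

lemma face_generator:
  fixes s k y :: real
  assumes U: "open U" "y \<in> U" and f: "\<And>u. u \<in> U \<Longrightarrow> f u = P u / H u"
    and P: "\<And>u. (P has_real_derivative s * (poisson k u * \<rho> u)) (at u)"
    and H: "\<And>u. (H has_real_derivative s * \<rho> u) (at u)" "\<And>u. H u > 0"
    and sH: "\<And>u. s * (k - F u) = - H u"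
  shows "nabla1 a (nabla1 a f) y + (deriv a y / 2 - b y) * deriv f y
    + 2 * (sqrt (a y) * (s * \<rho> y) / H y) * nabla1 a f y = - 1"
proof -
  define Q where "Q u = poisson k u * H u - P u" for u
  define D where "D u = s * \<rho> u * Q u / (H u)\<^sup>2" for u
  define r' where "r' u = (b u - deriv a u) / a u * \<rho> u" for u
  define q' where "q' u = (k - F u) / (a u * \<rho> u)" for u
  have H0: "H u \<noteq> 0" for u using H(2)[of u] by simp
  \<comment> \<open>Since \<open>P' = poisson k * H'\<close>, the terms in \<open>H'\<close> and
    \<open>P'\<close> cancel.\<close>
  have Q: "(Q has_real_derivative q' u * H u) (at u)" for u
    unfolding Q_def[abs_def]
    by (auto intro!: derivative_eq_intros P H(1) poisson_has_deriv simp: q'_def)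
  have D1: "((\<lambda>u. P u / H u) has_real_derivative D u) (at u)" for u
    using DERIV_divide[OF P H(1) H0] by (simp add: D_def Q_def power2_eq_square algebra_simps)
  have df: "deriv f u = D u" if "u \<in> U" for u
    by (rule deriv_eq_on_open[OF U(1) that _ D1]) (rule f)
  define D' where "D' = s * r' y * Q y / (H y)\<^sup>2 + s * \<rho> y * (q' y * H y) / (H y)\<^sup>2
      - 2 * (s * \<rho> y) * D y / H y"
  have D2: "(D has_real_derivative D') (at y)"
  proof -
    have "((\<lambda>u. s * \<rho> u * Q u) has_real_derivative s * r' y * Q y + s * \<rho> y * (q' y * H y)) (at y)"
      by (auto intro!: derivative_eq_intros rho_has_deriv Q simp: r'_def)
    from DERIV_divide_square[OF this H(1) H0] show ?thesis
      unfolding D_def[abs_def] D'_def by (simp add: add_divide_distrib)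
  qed
  have N: "nabla1 a f u = sqa u * D u" if "u \<in> U" for u
    using df[OF that] by (simp add: nabla1_def sqa_def)
  have "((\<lambda>u. sqa u * D u) has_real_derivative deriv a y / (2 * sqa y) * D y + sqa y * D') (at y)"
    by (auto intro!: derivative_eq_intros sqa_has_deriv D2)
  then have "deriv (nabla1 a f) y = deriv a y / (2 * sqa y) * D y + sqa y * D'"
    by (rule deriv_eq_on_open[OF U, rotated]) (rule N)
  then have "nabla1 a (nabla1 a f) y = sqa y * (deriv a y / (2 * sqa y) * D y + sqa y * D')"
    by (simp add: nabla1_def[of a "nabla1 a f"] sqa_def)
  also have "\<dots> = deriv a y / 2 * D y + (sqa y * sqa y) * D'"
    using sqa_pos[of y] by (simp add: divide_simps algebra_simps)
  also have "sqa y * sqa y = a y" by (rule sqa_sq)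
  also have "a y * D' = (b y - deriv a y) * D y + s * (k - F y) / H y - 2 * (a y * (s * \<rho> y)) * D y / H y"
  proof -
    have e1: "a y * r' y = (b y - deriv a y) * \<rho> y" using a_neq_0[of y] by (simp add: r'_def)
    have e2: "a y * (\<rho> y * q' y) = k - F y"
      using a_neq_0[of y] rho_pos[of y] by (simp add: q'_def)
    have e3: "a y * D' = s * (a y * r' y) * Q y / (H y)\<^sup>2 + s * (a y * (\<rho> y * q' y)) / H y
        - 2 * (a y * (s * \<rho> y)) * D y / H y"
      unfolding D'_def using H0[of y] by (simp add: algebra_simps power2_eq_square)
    have e4: "s * ((b y - deriv a y) * \<rho> y) * Q y / (H y)\<^sup>2 = (b y - deriv a y) * D y"
      by (simp add: D_def ac_simps)
    show ?thesis unfolding e3 e1 e2 e4 ..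
  qed
  also have "s * (k - F y) / H y = - 1" using sH[of y] H0[of y] by simp
  finally have 1: "nabla1 a (nabla1 a f) y = deriv a y / 2 * D y +
     ((b y - deriv a y) * D y + - 1 - 2 * (a y * (s * \<rho> y)) * D y / H y)" .
  \<comment> \<open>This is the drift added by the Doob transform; it cancels the last term of the
    identity just obtained.\<close>
  have "2 * (sqrt (a y) * (s * \<rho> y) / H y) * nabla1 a f y = 2 * (sqa y * sqa y * (s * \<rho> y)) * D y / H y"
    using N[OF U(2)] by (simp add: sqa_def)
  then have 2: "2 * (sqrt (a y) * (s * \<rho> y) / H y) * nabla1 a f y = 2 * (a y * (s * \<rho> y)) * D y / H y"
    by (simp only: sqa_sq)
  show ?thesis unfolding 1 2 df[OF U(2)] by (simp add: algebra_simps)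
qed

text \<open>The squared operator is computed by the quotient rule. The terms in which the
  denominator is differentiated cancel the drift in the mass of \<open>[x, y]\<close>, and the
  first-order terms cancel by \<open>(a \<rho>)' = b \<rho>\<close>. What remains is
  \<open>(F x - F y)\<close> over the mass, that is \<open>- 1\<close>. The quotient formula is
  assumed on an open set only, so that the lemma applies to cut-off functions.\<close>

lemma interior_generator:
  fixes x y C :: real
  assumes U: "open U" "(x, y) \<in> U" "\<And>u v. (u, v) \<in> U \<Longrightarrow> u < v"
    and f: "\<And>u v. (u, v) \<in> U \<Longrightarrow> f u v = (C + W k v - W k u) / (F v - F u)"
  shows "Lstar_int a b f x y = - 1"
proof -
  define h where "h u v = F v - F u" for u v
  define P where "P u v = C + W k v - W k u" for u v
  define q where "q = poisson k"
  define q' where "q' u = (k - F u) / (a u * \<rho> u)" for u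
  \<comment> \<open>Applying \<open>nabla a\<close> to the mass \<open>h\<close> gives
    \<open>B x + B y\<close>, because \<open>h\<close> decreases in \<open>x\<close> and the
    operator subtracts that derivative.\<close>
  define B where "B u = sqa u * \<rho> u" for u
  define B' where "B' u = (b u - deriv a u / 2) * \<rho> u / sqa u" for u
  have B: "(B has_real_derivative B' u) (at u)" for u
  proof -
    have "(B has_real_derivative (deriv a u / (2 * sqa u)) * \<rho> u + sqa u * ((b u - deriv a u) / a u * \<rho> u)) (at u)"
      unfolding B_def[abs_def]
      using DERIV_mult'[OF sqa_has_deriv rho_has_deriv, of u] by (simp add: add.commute)
    also have "(deriv a u / (2 * sqa u)) * \<rho> u + sqa u * ((b u - deriv a u) / a u * \<rho> u) = B' u"
      unfolding B'_def sqa_sq[of u, symmetric] using sqa_pos[of u]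
      by (simp add: divide_simps) (simp add: algebra_simps)
    finally show ?thesis .
  qed
  have q: "(q has_real_derivative q' u) (at u)" for u
    unfolding q_def q'_def by (rule poisson_has_deriv)
  have Wd: "(W k has_real_derivative q u * \<rho> u) (at u)" for u unfolding q_def by (rule W_has_deriv)
  have hy: "((\<lambda>v. h u v) has_real_derivative \<rho> v) (at v)"
    and hx: "((\<lambda>u. h u v) has_real_derivative - \<rho> u) (at u)"
    and Py: "((\<lambda>v. P u v) has_real_derivative q v * \<rho> v) (at v)"
    and Px: "((\<lambda>u. P u v) has_real_derivative - (q u * \<rho> u)) (at u)" for u v
    unfolding h_def P_def by (auto intro!: derivative_eq_intros F_has_deriv Wd)
  have h0: "h u v > 0" if "(u, v) \<in> U" for u v using F_strict[OF U(3)[OF that]] by (simp add: h_def)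
  have Ux: "open {u. (u, v) \<in> U}" and Uy: "open {w. (v, w) \<in> U}" for v
  proof -
    have "open ((\<lambda>u. (u, v)) -` U)" "open (Pair v -` U)"
      by (intro open_vimage U(1) continuous_intros)+
    then show "open {u. (u, v) \<in> U}" "open {w. (v, w) \<in> U}" by (simp_all add: vimage_def)
  qed
  have dyf: "dy f u v = \<rho> v * (q v * h u v - P u v) / (h u v)\<^sup>2" if uv: "(u, v) \<in> U" for u v
    unfolding dy_def
  proof (rule deriv_eq_on_open[OF Uy])
    show "v \<in> {w. (u, w) \<in> U}" using uv by simp
    show "f u w = P u w / h u w" if "w \<in> {w. (u, w) \<in> U}" for w
      using f that by (simp add: P_def h_def)
    show "((\<lambda>w. P u w / h u w) has_real_derivative \<rho> v * (q v * h u v - P u v) / (h u v)\<^sup>2) (at v)"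
      using DERIV_divide[OF Py[of u v] hy[of u v]] h0[OF uv] by (simp add: power2_eq_square algebra_simps)
  qed
  have dxf: "dx f u v = - \<rho> u * (q u * h u v - P u v) / (h u v)\<^sup>2" if uv: "(u, v) \<in> U" for u v
    unfolding dx_def
  proof (rule deriv_eq_on_open[OF Ux])
    show "u \<in> {w. (w, v) \<in> U}" using uv by simp
    show "f w v = P w v / h w v" if "w \<in> {w. (w, v) \<in> U}" for w
      using f that by (simp add: P_def h_def)
    show "((\<lambda>w. P w v / h w v) has_real_derivative - \<rho> u * (q u * h u v - P u v) / (h u v)\<^sup>2) (at u)"
      using DERIV_divide[OF Px[of v u] hx[of v u]] h0[OF uv] by (simp add: power2_eq_square algebra_simps)
  qed
  \<comment> \<open>The numerator of \<open>nabla a (P / h)\<close> over the denominator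
    \<open>h^2\<close>.\<close>
  define E where "E u v = B v * (q v * h u v - P u v) + B u * (q u * h u v - P u v)" for u v
  define N where "N u v = E u v / (h u v)\<^sup>2" for u v
  have nf: "nabla a f u v = N u v" if "(u, v) \<in> U" for u v
    unfolding nabla_def dyf[OF that] dxf[OF that] N_def E_def B_def sqa_def
    by (simp add: add_divide_distrib)
  have h0': "h x y \<noteq> 0" using h0[OF U(2)] by simp
  have Ey: "((\<lambda>v. E x v) has_real_derivative
     B' y * (q y * h x y - P x y) + B y * (q' y * h x y) + B x * (q x * \<rho> y - q y * \<rho> y)) (at y)"
    unfolding E_def by (auto intro!: derivative_eq_intros B q hy Py simp: algebra_simps)
  have Ex: "((\<lambda>u. E u y) has_real_derivative
     B y * (q x * \<rho> x - q y * \<rho> x) + B' x * (q x * h x y - P x y) + B x * (q' x * h x y)) (at x)"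
    unfolding E_def by (auto intro!: derivative_eq_intros B q hx Px simp: algebra_simps)
  note Ny = DERIV_divide_square[OF Ey hy h0', folded N_def]
  note Nx = DERIV_divide_square[OF Ex hx h0', folded N_def]
  have dyN: "dy (nabla a f) x y = (B' y * (q y * h x y - P x y) + B y * (q' y * h x y) + B x * (q x * \<rho> y - q y * \<rho> y)) / (h x y)\<^sup>2
       - 2 * \<rho> y * N x y / h x y"
    unfolding dy_def by (rule deriv_eq_on_open[OF Uy _ _ Ny]) (use U(2) nf in auto)
  have dxN: "dx (nabla a f) x y = (B y * (q x * \<rho> x - q y * \<rho> x) + B' x * (q x * h x y - P x y) + B x * (q' x * h x y)) / (h x y)\<^sup>2
       - 2 * - \<rho> x * N x y / h x y"
    unfolding dx_def by (rule deriv_eq_on_open[OF Ux _ _ Nx]) (use U(2) nf in auto)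
  have sB': "sqa u * B' u = (b u - deriv a u / 2) * \<rho> u" for u
    using sqa_pos[of u] by (simp add: B'_def)
  have sB: "sqa u * B u * q' u = k - F u" for u
    unfolding B_def q'_def sqa_sq[of u, symmetric] using sqa_pos[of u] rho_pos[of u]
    by (simp add: divide_simps)
  have "nabla a (nabla a f) x y = sqa y * dy (nabla a f) x y - sqa x * dx (nabla a f) x y"
    by (simp add: nabla_def[of a "nabla a f"] sqa_def)
  also have "\<dots> = ((sqa y * B' y) * (q y * h x y - P x y) - (sqa x * B' x) * (q x * h x y - P x y)
      + (sqa y * B y * q' y - sqa x * B x * q' x) * h x y
      + (q x - q y) * (sqa y * \<rho> y * B x - sqa x * \<rho> x * B y)) / (h x y)\<^sup>2
      - 2 * (sqa y * \<rho> y + sqa x * \<rho> x) * N x y / h x y"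
    unfolding dyN dxN by (rule nabla_quotient_eq[OF h0'])
  also have "\<dots> = (b y - deriv a y / 2) * dy f x y + (b x - deriv a x / 2) * dx f x y
      + (F x - F y) / h x y - 2 * (sqa y * \<rho> y + sqa x * \<rho> x) * N x y / h x y"
    unfolding sB' sB dyf[OF U(2)] dxf[OF U(2)] unfolding B_def by (rule nabla_square_eq[OF h0'])
  also have "(F x - F y) / h x y = - 1" using h0' by (simp add: h_def divide_simps)
  finally have nn: "nabla a (nabla a f) x y = (b y - deriv a y / 2) * dy f x y
      + (b x - deriv a x / 2) * dx f x y + - 1 - 2 * (sqa y * \<rho> y + sqa x * \<rho> x) * N x y / h x y" .
  \<comment> \<open>This identifies the denominator in the drift of \<open>L\<^sup>*\<close> with
    that of the quotient, so that the terms in \<open>N\<close> cancel.\<close>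
  have "measure (mu a b) {x..y} = h x y"
    unfolding h_def using U(3)[OF U(2)] by (intro measure_mu_Icc) simp
  then show ?thesis
    unfolding Lstar_int_def nn nf[OF U(2)] sqa_def[symmetric] using h0'
    by (simp add: divide_simps) (simp add: algebra_simps)
qed

end

section \<open>Stopping a path on a grid\<close>

lemma set_integral_Icc_add:
  fixes g :: "real \<Rightarrow> real"
  assumes [measurable]: "g \<in> borel_measurable borel" and B: "\<And>u. \<bar>g u\<bar> \<le> B" and "r \<le> s" "s \<le> t"
  shows "(LINT u:{r..t}|lborel. g u) = (LINT u:{r..s}|lborel. g u) + (LINT u:{s..t}|lborel. g u)"
    and "set_integrable lborel {r..t} g"
    and "\<bar>LINT u:{r..t}|lborel. g u\<bar> \<le> B * (t - r)"
proof -
  have siB: "set_integrable lborel {c..d} (\<lambda>_. B)" for c d :: real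
    by (intro borel_integrable_atLeastAtMost' continuous_intros)
  have si: "set_integrable lborel {c..d} g" for c d
  proof (rule set_integrable_bound[OF siB])
  qed (use B in \<open>auto simp: set_borel_measurable_def intro!: AE_I2 order_trans[OF _ abs_ge_self]\<close>)
  then show "set_integrable lborel {r..t} g" .
  have "{r..t} = {r..s} \<union> {s..t}" using assms by auto
  moreover have "AE u in lborel. \<not> (u \<in> {r..s} \<and> u \<in> {s..t})"
    using AE_lborel_singleton[of s] by eventually_elim auto
  ultimately show "(LINT u:{r..t}|lborel. g u) = (LINT u:{r..s}|lborel. g u) + (LINT u:{s..t}|lborel. g u)"
    using set_integral_Un_AE[of "{r..s}" "{s..t}" lborel g] si by simp
  have "norm (LINT u:{r..t}|lborel. g u) \<le> (LINT u:{r..t}|lborel. norm (g u))"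
    by (rule set_integral_norm_bound[OF si])
  also have "\<dots> \<le> (LINT u:{r..t}|lborel. B)"
    using B by (intro set_integral_mono set_integrable_norm si siB) auto
  also have "\<dots> = B * (t - r)" using assms by (simp add: set_lebesgue_integral_def)
  finally show "\<bar>LINT u:{r..t}|lborel. g u\<bar> \<le> B * (t - r)" by simp
qed

text \<open>The weights are 1 strictly before the first index at which \<open>Q\<close> fails and 0
  from it on, so the sum telescopes up to that index; \<open>k = N\<close> if there is no failure
  below \<open>N\<close>.\<close>

lemma stopped_grid_sum:
  fixes G :: "nat \<Rightarrow> real"
  obtains k where "k \<le> N" "\<And>i. i < k \<Longrightarrow> Q i" "k < N \<Longrightarrow> \<not> Q k"
    "(\<Sum>k<N. of_bool (\<forall>i\<le>k. Q i) * (G (Suc k) - G k)) = G k - G 0"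
proof -
  have "\<exists>k\<le>N. (\<forall>i<k. Q i) \<and> (k < N \<longrightarrow> \<not> Q k) \<and>
    (\<Sum>k<N. of_bool (\<forall>i\<le>k. Q i) * (G (Suc k) - G k)) = G k - G 0"
  proof (induction N)
    case (Suc N)
    then obtain k where k: "k \<le> N" "\<forall>i<k. Q i" "k < N \<longrightarrow> \<not> Q k"
      "(\<Sum>k<N. of_bool (\<forall>i\<le>k. Q i) * (G (Suc k) - G k)) = G k - G 0" by blast
    show ?case
    proof (cases "k = N \<and> Q N")
      case True
      then have "\<forall>i\<le>N. Q i" using k(2) by (metis le_neq_implies_less)
      then show ?thesis using True k(4) by (intro exI[of _ "Suc N"]) (auto simp: less_Suc_eq)
    next
      case False
      then have "\<not> Q k" "k < Suc N" using k by auto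
      moreover have "\<not> (\<forall>i\<le>N. Q i)" using \<open>\<not> Q k\<close> k(1) by blast
      ultimately show ?thesis using k by (intro exI[of _ k]) auto
    qed
  qed simp
  then show ?thesis using that by blast
qed

definition grid :: "real \<Rightarrow> real \<Rightarrow> nat \<Rightarrow> nat \<Rightarrow> real" where
  "grid t0 T N i = t0 + real i * (T / real N)"

lemma grid_0 [simp]: "grid t0 T N 0 = t0" by (simp add: grid_def)

lemma grid_N: "N > 0 \<Longrightarrow> grid t0 T N N = t0 + T" by (simp add: grid_def)

lemma grid_mono: "T \<ge> 0 \<Longrightarrow> i \<le> j \<Longrightarrow> grid t0 T N i \<le> grid t0 T N j"
  by (auto simp: grid_def intro!: mult_right_mono divide_right_mono)

lemma grid_approx:
  assumes "T > 0" "t0 \<le> v" "v \<le> t0 + T"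
  obtains p where "\<And>N. N > 0 \<Longrightarrow> p N \<le> N" "\<And>N. v \<le> grid t0 T (Suc N) (p (Suc N))"
    "(\<lambda>N. grid t0 T (Suc N) (p (Suc N))) \<longlonglongrightarrow> v"
proof -
  define p where "p N = nat \<lceil>(v - t0) * real N / T\<rceil>" for N
  have c0: "0 \<le> (v - t0) * real N / T" for N using assms by simp
  then have rp: "real (p N) = of_int \<lceil>(v - t0) * real N / T\<rceil>" for N
    unfolding p_def by (metis ceiling_mono ceiling_zero of_nat_nat of_int_of_nat_eq)
  have 1: "p N \<le> N" if "N > 0" for N
  proof -
    have "(v - t0) * real N / T \<le> real N"
      using assms that by (simp add: divide_le_eq mult.commute mult_left_mono)
    then have "\<lceil>(v - t0) * real N / T\<rceil> \<le> int N" by (simp add: ceiling_le_iff)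
    then show ?thesis unfolding p_def by (subst nat_le_iff)
  qed
  have lo: "v \<le> grid t0 T (Suc N) (p (Suc N))" for N
  proof -
    have "(v - t0) * real (Suc N) / T \<le> real (p (Suc N))" unfolding rp by (rule le_of_int_ceiling)
    then have "(v - t0) * real (Suc N) / T * (T / real (Suc N)) \<le> real (p (Suc N)) * (T / real (Suc N))"
      using assms by (intro mult_right_mono) auto
    then show ?thesis using assms by (simp add: grid_def)
  qed
  have hi: "grid t0 T (Suc N) (p (Suc N)) \<le> v + T / real (Suc N)" for N
  proof -
    have "real (p (Suc N)) \<le> (v - t0) * real (Suc N) / T + 1" unfolding rp by (rule of_int_ceiling_le_add_one)
    then have "real (p (Suc N)) * (T / real (Suc N)) \<le> ((v - t0) * real (Suc N) / T + 1) * (T / real (Suc N))"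
      using assms by (intro mult_right_mono) auto
    also have "\<dots> = (v - t0) + T / real (Suc N)" using assms by (simp add: distrib_right add_divide_distrib del: of_nat_Suc)
    finally show ?thesis by (simp add: grid_def)
  qed
  have "(\<lambda>N. grid t0 T (Suc N) (p (Suc N))) \<longlonglongrightarrow> v"
  proof (rule tendsto_sandwich)
    show "(\<lambda>N. v) \<longlonglongrightarrow> v" by simp
    have "(\<lambda>N. v + T * (1 / real (Suc N))) \<longlonglongrightarrow> v + T * 0"
      by (intro tendsto_intros LIMSEQ_Suc[OF lim_1_over_n])
    then show "(\<lambda>N. v + T / real (Suc N)) \<longlonglongrightarrow> v" by simp
  qed (use lo hi in auto)
  with 1 lo show ?thesis using that by blast
qed

text \<open>The complement of \<open>K\<close> is open, and grid points tending to \<open>v\<close>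
  from the right stay inside the time interval. Every fine enough grid therefore sees the path
  outside \<open>K\<close> shortly after \<open>v\<close>.\<close>

lemma path_grid_leaves:
  fixes z :: "real \<Rightarrow> 'b::topological_space"
  assumes "continuous_on UNIV z" "closed K" "T > 0" "v \<in> {t0..t0+T}" "z v \<notin> K"
  shows "\<forall>\<epsilon>>0. \<exists>N0. \<forall>N\<ge>N0. \<exists>p\<le>Suc N. z (grid t0 T (Suc N) p) \<notin> K \<and> grid t0 T (Suc N) p \<le> v + \<epsilon>"
proof (intro allI impI)
  fix \<epsilon> :: real assume "\<epsilon> > 0"
  obtain p where p: "\<And>N. N > 0 \<Longrightarrow> p N \<le> N"
    "(\<lambda>N. grid t0 T (Suc N) (p (Suc N))) \<longlonglongrightarrow> v"
    by (rule grid_approx[of T t0 v]) (use assms in auto)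
  have "(\<lambda>N. z (grid t0 T (Suc N) (p (Suc N)))) \<longlonglongrightarrow> z v"
    using continuous_on_tendsto_compose[OF assms(1) p(2)] by simp
  then have "\<forall>\<^sub>F N in sequentially. z (grid t0 T (Suc N) (p (Suc N))) \<in> - K"
    using assms by (intro topological_tendstoD) auto
  moreover have "\<forall>\<^sub>F N in sequentially. grid t0 T (Suc N) (p (Suc N)) < v + \<epsilon>"
    using p(2) \<open>\<epsilon> > 0\<close> by (intro order_tendstoD(2)) auto
  ultimately have "\<forall>\<^sub>F N in sequentially. \<exists>p\<le>Suc N. z (grid t0 T (Suc N) p) \<notin> K \<and> grid t0 T (Suc N) p \<le> v + \<epsilon>"
  proof eventually_elim
    case (elim N)
    then show ?case using p(1)[of "Suc N"] by (intro exI[of _ "p (Suc N)"]) auto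
  qed
  then show "\<exists>N0. \<forall>N\<ge>N0. \<exists>p\<le>Suc N. z (grid t0 T (Suc N) p) \<notin> K \<and> grid t0 T (Suc N) p \<le> v + \<epsilon>"
    by (simp add: eventually_sequentially)
qed

text \<open>The integral of \<open>g\<close> along the path up to the first grid time outside
  \<open>K\<close>. The form of a sum matters: each indicator is known at the left end of its cell,
  so each summand can be tested against a martingale increment.\<close>

definition stopped_sum :: "(real \<Rightarrow> 'b) \<Rightarrow> ('b \<Rightarrow> real) \<Rightarrow> 'b set \<Rightarrow> real \<Rightarrow> real \<Rightarrow> nat \<Rightarrow> real" where
  "stopped_sum z g K t0 T N = (\<Sum>k<N. of_bool (\<forall>i\<le>k. z (grid t0 T N i) \<in> K) *
     (LINT u:{grid t0 T N k..grid t0 T N (Suc k)}|lborel. g (z u)))"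

context
  fixes z :: "real \<Rightarrow> 'b::topological_space" and g :: "'b \<Rightarrow> real" and K and t0 T B :: real
  assumes z: "continuous_on UNIV z" and K: "closed K" and T: "T > 0"
    and g: "g \<in> borel_measurable borel" "\<And>x. \<bar>g x\<bar> \<le> B" "\<And>x. x \<in> K \<Longrightarrow> g x \<ge> 1"
begin

definition stopped_G where "stopped_G t = (LINT u:{t0..t}|lborel. g (z u))"

lemma borel_along_path: "(\<lambda>u. g (z u)) \<in> borel_measurable borel"
  using measurable_compose[OF borel_measurable_continuous_onI[OF z] g(1)] .

lemma stopped_bound_nonneg: "0 \<le> B" using g(2)[of "z 0"] by linarith

lemma stopped_G_diff: "t0 \<le> s \<Longrightarrow> s \<le> t \<Longrightarrow> (LINT u:{s..t}|lborel. g (z u)) = stopped_G t - stopped_G s"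
  unfolding stopped_G_def using set_integral_Icc_add(1)[OF borel_along_path g(2), of t0 s t] by linarith

lemma stopped_G_lower: "t0 \<le> s \<Longrightarrow> s \<le> t \<Longrightarrow> stopped_G s - B * (t - s) \<le> stopped_G t"
  using stopped_G_diff[of s t] set_integral_Icc_add(3)[OF borel_along_path g(2), of s t t] by linarith

lemma stopped_G_stay:
  assumes "t0 \<le> t" "\<And>u. t0 \<le> u \<Longrightarrow> u \<le> t \<Longrightarrow> z u \<in> K"
  shows "t - t0 \<le> stopped_G t"
proof -
  have "t - t0 = (LINT u:{t0..t}|lborel. 1)" using assms by (simp add: set_lebesgue_integral_def)
  also have "\<dots> \<le> stopped_G t" unfolding stopped_G_def
    by (rule set_integral_mono)
       (use set_integral_Icc_add(2)[OF borel_along_path g(2)] assms g(3) in \<open>auto simp: set_integrable_def\<close>)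
  finally show ?thesis .
qed

lemma stopped_sum_eq:
  assumes "N > 0"
  obtains k where "k \<le> N" "\<And>i. i < k \<Longrightarrow> z (grid t0 T N i) \<in> K" "k < N \<Longrightarrow> z (grid t0 T N k) \<notin> K"
    "stopped_sum z g K t0 T N = stopped_G (grid t0 T N k)"
proof -
  have G0: "stopped_G t0 = 0" unfolding stopped_G_def using set_integral_Icc_add(3)[OF borel_along_path g(2), of t0 t0 t0] by simp
  have ge: "t0 \<le> grid t0 T N i" for i using grid_mono[of T 0 i t0 N] T by simp
  have "stopped_sum z g K t0 T N = (\<Sum>k<N. of_bool (\<forall>i\<le>k. z (grid t0 T N i) \<in> K) *
      (stopped_G (grid t0 T N (Suc k)) - stopped_G (grid t0 T N k)))"
    unfolding stopped_sum_def using stopped_G_diff[OF ge grid_mono] T by (intro sum.cong) auto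
  then show ?thesis
    using stopped_grid_sum[of N "\<lambda>i. z (grid t0 T N i) \<in> K" "\<lambda>k. stopped_G (grid t0 T N k)"] that
    by (auto simp: G0)
qed

lemma stopped_sum_bounded: "N > 0 \<Longrightarrow> \<bar>stopped_sum z g K t0 T N\<bar> \<le> B * T"
proof -
  assume N: "N > 0"
  obtain k where k: "k \<le> N" "stopped_sum z g K t0 T N = stopped_G (grid t0 T N k)"
    using stopped_sum_eq[OF N] by metis
  have "t0 \<le> grid t0 T N k" "grid t0 T N k \<le> t0 + T"
    using grid_mono[of T 0 k t0 N] grid_mono[of T k N t0 N] T k(1) N by (auto simp: grid_N)
  then have "\<bar>stopped_G (grid t0 T N k)\<bar> \<le> B * (grid t0 T N k - t0)" "B * (grid t0 T N k - t0) \<le> B * T"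
    unfolding stopped_G_def using stopped_bound_nonneg
    by (intro set_integral_Icc_add(3)[OF borel_along_path g(2) _ order_refl] mult_left_mono; simp)+
  then show ?thesis unfolding k(2) by linarith
qed

lemma stopped_sum_stay:
  assumes "N > 0" "\<And>u. t0 \<le> u \<Longrightarrow> u \<le> t0 + T \<Longrightarrow> z u \<in> K"
  shows "T \<le> stopped_sum z g K t0 T N"
proof -
  obtain k where k: "k \<le> N" "k < N \<Longrightarrow> z (grid t0 T N k) \<notin> K" "stopped_sum z g K t0 T N = stopped_G (grid t0 T N k)"
    using stopped_sum_eq[OF assms(1)] by metis
  have "z (grid t0 T N k) \<in> K"
    using grid_mono[of T 0 k t0 N] grid_mono[of T k N t0 N] T k(1) assms by (auto simp: grid_N)
  with k(1,2) have "k = N" by (metis le_neq_implies_less)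
  then show ?thesis using k(3) stopped_G_stay[of "t0 + T"] T assms by (simp add: grid_N)
qed

text \<open>Before the first exit time \<sigma> the integrand is at least 1, so a negative
  contribution can only come from the short stretch between that time and the grid time that detects
  the exit. As membership in \<open>K\<close> is known strictly before \<sigma>, the comparison
  starts at a time \<open>s\<close> slightly earlier.\<close>

lemma stopped_sum_leave:
  assumes v: "v \<in> {t0..t0+T}" "z v \<notin> K" and "\<epsilon> > 0"
  shows "\<exists>N0. \<forall>N\<ge>N0. - \<epsilon> \<le> stopped_sum z g K t0 T (Suc N)"
proof -
  \<comment> \<open>Three lengths \<delta> are lost: from \<open>s\<close> to \<sigma>, from
    \<sigma> to \<open>w\<close>, and from \<open>w\<close> to the grid time. Using
    \<open>B + 1\<close> excludes a zero denominator.\<close>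
  define \<delta> where "\<delta> = \<epsilon> / (3 * (B + 1))"
  have \<delta>: "\<delta> > 0" using stopped_bound_nonneg \<open>\<epsilon> > 0\<close> by (simp add: \<delta>_def)
  define V where "V = {v \<in> {t0..t0+T}. z v \<notin> K}"
  define \<sigma> where "\<sigma> = Inf V"
  have V: "V \<noteq> {}" "bdd_below V" using v by (auto simp: V_def)
  obtain w where w: "w \<in> V" "w < \<sigma> + \<delta>" using cInf_lessD[OF V(1), of "\<sigma> + \<delta>"] \<delta> \<sigma>_def by auto
  have \<sigma>: "t0 \<le> \<sigma>" "\<sigma> \<le> w" unfolding \<sigma>_def
    using V w by (auto intro!: cInf_greatest cInf_lower simp: V_def)
  have in_K: "z u \<in> K" if "t0 \<le> u" "u < \<sigma>" for u
  proof (rule ccontr)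
    assume "z u \<notin> K"
    moreover have "u \<le> t0 + T" using that \<sigma> w by (auto simp: V_def)
    ultimately have "\<sigma> \<le> u" unfolding \<sigma>_def using V(2) that by (intro cInf_lower) (auto simp: V_def)
    then show False using that by simp
  qed
  define s where "s = max t0 (\<sigma> - \<delta>)"
  have Gs: "0 \<le> stopped_G s"
  proof (cases "s = t0")
    case True
    then show ?thesis unfolding stopped_G_def using set_integral_Icc_add(3)[OF borel_along_path g(2), of t0 t0 t0] by simp
  next
    case False
    then show ?thesis using stopped_G_stay[of s] in_K \<delta> by (fastforce simp: s_def)
  qed
  obtain N0 where N0: "\<And>N. N \<ge> N0 \<Longrightarrow> \<exists>p\<le>Suc N. z (grid t0 T (Suc N) p) \<notin> K \<and> grid t0 T (Suc N) p \<le> w + \<delta>"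
    using path_grid_leaves[OF z K T, of w t0] w \<delta> unfolding V_def by blast
  have "- \<epsilon> \<le> stopped_sum z g K t0 T (Suc N)" if N: "N \<ge> N0" for N
  proof -
    obtain p where p: "p \<le> Suc N" "z (grid t0 T (Suc N) p) \<notin> K" "grid t0 T (Suc N) p \<le> w + \<delta>"
      using N0[OF N] by blast
    obtain k where k: "k \<le> Suc N" "\<And>i. i < k \<Longrightarrow> z (grid t0 T (Suc N) i) \<in> K"
      "stopped_sum z g K t0 T (Suc N) = stopped_G (grid t0 T (Suc N) k)"
      using stopped_sum_eq[of "Suc N"] by (metis zero_less_Suc)
    have "k \<le> p" using k(2) p(2) by (meson not_le)
    define \<tau> where "\<tau> = grid t0 T (Suc N) k"
    have \<tau>: "t0 \<le> \<tau>" "\<tau> \<le> w + \<delta>"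
      using grid_mono[of T 0 k t0 "Suc N"] grid_mono[of T k p t0 "Suc N"] T p(3) \<open>k \<le> p\<close>
      by (auto simp: \<tau>_def)
    have "- \<epsilon> \<le> stopped_G \<tau>"
    proof (cases "\<tau> < s")
      case True
      then have "\<tau> < \<sigma>" using \<tau>(1) \<delta> by (auto simp: s_def)
      then have "0 \<le> stopped_G \<tau>" using stopped_G_stay[of \<tau>] \<tau>(1) in_K by fastforce
      then show ?thesis using \<open>\<epsilon> > 0\<close> by simp
    next
      case False
      have "\<tau> - s \<le> 3 * \<delta>" using \<tau>(2) w(2) by (auto simp: s_def)
      then have "B * (\<tau> - s) \<le> (B + 1) * (3 * \<delta>)"
        using stopped_bound_nonneg \<delta> False by (intro mult_mono) auto
      also have "\<dots> = \<epsilon>"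
      proof -
        have "B + 1 \<noteq> 0" using stopped_bound_nonneg by linarith
        then show ?thesis unfolding \<delta>_def by (simp add: divide_simps)
      qed
      finally have "B * (\<tau> - s) \<le> \<epsilon>" .
      moreover have "t0 \<le> s" by (simp add: s_def)
      ultimately show ?thesis using stopped_G_lower[of s \<tau>] Gs False by linarith
    qed
    then show ?thesis using k(3) by (simp add: \<tau>_def)
  qed
  then show ?thesis by blast
qed

end

section \<open>Exit from a region\<close>

lemma space_gen_sigma [simp]: "space (gen_sigma M Y T) = space M"
  by (simp add: gen_sigma_def space_measure_of_conv)

lemma sets_gen_sigma:
  "sets (gen_sigma M Y T) = sigma_sets (space M) {Y s -` B \<inter> space M | s B. s \<in> T \<and> B \<in> sets borel}"
  unfolding gen_sigma_def by (intro sets_measure_of) auto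

lemma measurable_gen_sigma: "t \<in> T \<Longrightarrow> Y t \<in> gen_sigma M Y T \<rightarrow>\<^sub>M borel"
  by (rule measurableI) (auto simp: sets_gen_sigma intro!: sigma_sets.Basic)

lemma subalgebra_gen_sigma:
  assumes "\<And>t. t \<in> T \<Longrightarrow> Y t \<in> borel_measurable M"
  shows "subalgebra M (gen_sigma M Y T)"
  unfolding subalgebra_def sets_gen_sigma
  by (auto intro!: sets.sigma_sets_subset measurable_sets[OF assms])

lemma sets_gen_sigma_mono: "T \<subseteq> T' \<Longrightarrow> sets (gen_sigma M Y T) \<subseteq> sets (gen_sigma M Y T')"
  unfolding sets_gen_sigma by (intro sigma_sets_mono') auto

lemma subalgebra_natural_filtration:
  "continuous_process M Y \<Longrightarrow> subalgebra M (natural_filtration M Y t)"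
  unfolding natural_filtration_def continuous_process_def by (intro subalgebra_gen_sigma) auto

lemma space_natural_filtration [simp]: "space (natural_filtration M Y t) = space M"
  by (simp add: natural_filtration_def)

lemma sets_natural_filtration_mono:
  "s \<le> t \<Longrightarrow> sets (natural_filtration M Y s) \<subseteq> sets (natural_filtration M Y t)"
  unfolding natural_filtration_def by (intro sets_gen_sigma_mono) auto

lemma measurable_natural_filtration:
  "0 \<le> s \<Longrightarrow> s \<le> t \<Longrightarrow> Y s \<in> natural_filtration M Y t \<rightarrow>\<^sub>M borel"
  unfolding natural_filtration_def by (intro measurable_gen_sigma) auto

lemma sigma_finite_subalgebraI:
  "prob_space M \<Longrightarrow> subalgebra M G \<Longrightarrow> sigma_finite_subalgebra M G"
  by (intro finite_measure_subalgebra_is_sigma_finite)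
     (simp add: finite_measure_subalgebra_def finite_measure_subalgebra_axioms_def prob_space.finite_measure)

section \<open>Expected exit times\<close>

lemma martingale_from_integral_zero:
  fixes \<phi> \<psi> :: "'b \<Rightarrow> real"
  defines "D \<equiv> \<lambda>Z s t \<omega>. \<phi> (Z t \<omega>) - \<phi> (Z s \<omega>) - (LINT u:{s..t}|lborel. \<psi> (Z u \<omega>))"
  assumes M: "prob_space M" and G: "subalgebra M (G s)"
    and m: "martingale_from M G Z S \<phi> \<psi>" "0 \<le> s" "s \<le> t"
    and A: "A \<in> sets (G s)" "\<And>\<omega>. \<omega> \<in> A \<Longrightarrow> Z s \<omega> \<in> S"
  shows "integrable M (D Z s t)" and "(\<integral>\<omega>. indicator A \<omega> * D Z s t \<omega> \<partial>M) = 0"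
proof -
  interpret sigma_finite_subalgebra M "G s" by (rule sigma_finite_subalgebraI[OF M G])
  show i: "integrable M (D Z s t)"
    using m unfolding martingale_from_def D_def Let_def by blast
  have ae: "AE \<omega> in M. Z s \<omega> \<in> S \<longrightarrow> real_cond_exp M (G s) (D Z s t) \<omega> = 0"
    using m unfolding martingale_from_def D_def Let_def by blast
  have "(\<integral>\<omega>. indicator A \<omega> * D Z s t \<omega> \<partial>M) = (\<integral>\<omega>\<in>A. D Z s t \<omega> \<partial>M)"
    by (simp add: set_lebesgue_integral_def)
  also have "\<dots> = (\<integral>\<omega>\<in>A. real_cond_exp M (G s) (D Z s t) \<omega> \<partial>M)"
    by (rule real_cond_exp_intA[OF i A(1)])
  also have "\<dots> = (\<integral>\<omega>. 0 \<partial>M)"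
    unfolding set_lebesgue_integral_def
  proof (rule integral_cong_AE)
    have "A \<in> sets M" using A(1) G by (auto simp: subalgebra_def)
    then show "(\<lambda>\<omega>. indicator A \<omega> *\<^sub>R real_cond_exp M (G s) (D Z s t) \<omega>) \<in> borel_measurable M"
      by (auto intro!: borel_measurable_scaleR borel_measurable_indicator borel_measurable_cond_exp2)
    show "AE \<omega> in M. indicator A \<omega> *\<^sub>R real_cond_exp M (G s) (D Z s t) \<omega> = 0"
      using ae by eventually_elim (auto simp: indicator_def A(2))
  qed simp
  finally show "(\<integral>\<omega>. indicator A \<omega> * D Z s t \<omega> \<partial>M) = 0" by simp
qed

text \<open>Summation by parts: as the weights \<open>J\<close> decrease and \<open>f\<close> is
  nonnegative, every boundary term except the first is nonnegative.\<close>

lemma abel_lower_bound: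
  fixes J f :: "nat \<Rightarrow> real"
  assumes "\<And>k. 0 \<le> J (Suc k)" "\<And>k. J (Suc k) \<le> J k" "\<And>k. 0 \<le> f k"
  shows "(\<Sum>k<N. J k * (f (Suc k) - f k)) \<ge> - J 0 * f 0"
proof (cases N)
  case 0
  have "0 \<le> J 0" using assms(1,2)[of 0] by linarith
  then show ?thesis using 0 assms(3)[of 0] by simp
next
  case (Suc n)
  \<comment> \<open>The last boundary term is kept until the induction is finished, since the next
    summand consumes it.\<close>
  have "(\<Sum>k<Suc n. J k * (f (Suc k) - f k)) \<ge> J n * f (Suc n) - J 0 * f 0"
  proof (induction n)
    case (Suc n)
    have "J (Suc n) * f (Suc n) \<le> J n * f (Suc n)"
      using assms by (intro mult_right_mono) auto
    with Suc show ?case by (simp add: algebra_simps)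
  qed (simp add: algebra_simps)
  moreover have "0 \<le> J n * f (Suc n)"
    using assms order_trans[OF assms(1,2)[of n]] by (intro mult_nonneg_nonneg) auto
  ultimately show ?thesis using Suc by simp
qed

text \<open>Dynkin's formula for the exit time observed on the grid. On \<open>Ak k\<close> the path
  is in \<open>K\<close>, hence in \<open>S\<close>, at time \<open>tm k\<close>, so the increment
  \<open>D k\<close> has mean zero there. The remaining increments of \<phi> carry decreasing
  indicators, and \<open>abel_lower_bound\<close> leaves only the initial value, at most
  \<open>C\<close>.\<close>

lemma stopped_sum_expectation:
  fixes Z :: "real \<Rightarrow> 'w \<Rightarrow> 'b::topological_space" and N :: nat
  assumes M: "prob_space M" and Z: "continuous_process M Z"
    and m: "martingale_from M (natural_filtration M Z) Z S \<phi> \<psi>"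
    and \<phi>: "\<phi> \<in> borel_measurable borel" "\<And>x. 0 \<le> \<phi> x" "\<And>x. \<phi> x \<le> B"
    and K: "closed K" "K \<subseteq> S" and t0: "0 \<le> t0" and T: "0 < T"
    and A: "A \<in> sets (natural_filtration M Z t0)" "\<And>\<omega>. \<omega> \<in> A \<Longrightarrow> \<phi> (Z t0 \<omega>) \<le> C" and C: "0 \<le> C"
  defines "R \<equiv> \<lambda>\<omega>. indicator A \<omega> * stopped_sum (\<lambda>u. Z u \<omega>) (\<lambda>x. - \<psi> x) K t0 T N"
  shows "integrable M R" and "(\<integral>\<omega>. R \<omega> \<partial>M) \<le> C"
proof -
  interpret prob_space M by fact
  define tm where "tm = grid t0 T N"
  have tm0: "t0 \<le> tm k" for k unfolding tm_def using grid_mono[of T 0 k t0 N] T by simp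
  have tm_mono: "i \<le> k \<Longrightarrow> tm i \<le> tm k" for i k
    unfolding tm_def using T by (intro grid_mono) auto
  define D where "D k \<omega> = \<phi> (Z (tm (Suc k)) \<omega>) - \<phi> (Z (tm k) \<omega>) - (LINT u:{tm k..tm (Suc k)}|lborel. \<psi> (Z u \<omega>))" for k \<omega>
  define Ak where "Ak k = A \<inter> {\<omega> \<in> space M. \<forall>i\<le>k. Z (tm i) \<omega> \<in> K}" for k
  have sub: "subalgebra M (natural_filtration M Z t)" for t by (rule subalgebra_natural_filtration[OF Z])
  have AM: "A \<subseteq> space M" using A(1) sub[of t0] sets.sets_into_space[OF A(1)] by simp
  have Ak: "Ak k \<in> sets (natural_filtration M Z (tm k))" for k
  proof -
    have "{\<omega> \<in> space (natural_filtration M Z (tm k)). Z (tm i) \<omega> \<in> K} \<in> sets (natural_filtration M Z (tm k))"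
      if "i \<le> k" for i
      using measurable_sets[OF measurable_natural_filtration[of "tm i" "tm k" Z M] borel_closed[OF K(1)]]
        tm_mono[OF that] tm0[of i] t0
      by (auto simp: vimage_def Int_def conj_commute)
    then have "{\<omega> \<in> space M. \<forall>i\<in>{..k}. Z (tm i) \<omega> \<in> K} \<in> sets (natural_filtration M Z (tm k))"
      using sets.sets_Collect_finite_All[of "{..k}" "natural_filtration M Z (tm k)" "\<lambda>i \<omega>. Z (tm i) \<omega> \<in> K"]
      by auto
    moreover have "A \<in> sets (natural_filtration M Z (tm k))"
      by (rule subsetD[OF sets_natural_filtration_mono[OF tm0] A(1)])
    moreover have "Ak k = A \<inter> {\<omega> \<in> space M. \<forall>i\<in>{..k}. Z (tm i) \<omega> \<in> K}"
      by (simp add: Ak_def atMost_def)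
    ultimately show ?thesis by simp
  qed
  have AkM: "Ak k \<in> sets M" for k using Ak[of k] sub by (auto simp: subalgebra_def)
  have Di: "integrable M (D k)" and D0: "(\<integral>\<omega>. indicator (Ak k) \<omega> * D k \<omega> \<partial>M) = 0" for k
  proof -
    have t: "0 \<le> tm k" "tm k \<le> tm (Suc k)" using tm0[of k] t0 tm_mono[of k "Suc k"] by auto
    have S: "Z (tm k) \<omega> \<in> S" if "\<omega> \<in> Ak k" for \<omega> using that K(2) by (auto simp: Ak_def)
    show "integrable M (D k)" "(\<integral>\<omega>. indicator (Ak k) \<omega> * D k \<omega> \<partial>M) = 0"
      unfolding D_def using martingale_from_integral_zero[OF M sub m t Ak S] by blast+
  qed
  have \<phi>Z: "integrable M (\<lambda>\<omega>. \<phi> (Z (tm k) \<omega>))" for k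
  proof (rule integrable_const_bound)
    show "AE \<omega> in M. norm (\<phi> (Z (tm k) \<omega>)) \<le> B" using \<phi> by auto
    have "Z (tm k) \<in> borel_measurable M" using Z tm0[of k] t0 by (auto simp: continuous_process_def)
    then show "(\<lambda>\<omega>. \<phi> (Z (tm k) \<omega>)) \<in> borel_measurable M" by (rule measurable_compose[OF _ \<phi>(1)])
  qed
  have R: "R \<omega> = (\<Sum>k<N. indicator (Ak k) \<omega> * (D k \<omega> - (\<phi> (Z (tm (Suc k)) \<omega>) - \<phi> (Z (tm k) \<omega>))))" for \<omega>
    unfolding R_def stopped_sum_def sum_distrib_left tm_def[symmetric]
  proof (intro sum.cong refl)
    fix k
    have "(LINT u:{tm k..tm (Suc k)}|lborel. - \<psi> (Z u \<omega>)) = D k \<omega> - (\<phi> (Z (tm (Suc k)) \<omega>) - \<phi> (Z (tm k) \<omega>))"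
      by (simp add: D_def set_lebesgue_integral_def)
    then show "indicator A \<omega> * (of_bool (\<forall>i\<le>k. Z (tm i) \<omega> \<in> K) * (LINT u:{tm k..tm (Suc k)}|lborel. - \<psi> (Z u \<omega>))) =
        indicator (Ak k) \<omega> * (D k \<omega> - (\<phi> (Z (tm (Suc k)) \<omega>) - \<phi> (Z (tm k) \<omega>)))"
      using AM by (auto simp: Ak_def indicator_def)
  qed
  have int_mult: "integrable M f \<Longrightarrow> integrable M (\<lambda>\<omega>. indicator (Ak k) \<omega> * f \<omega>)" for f :: "'w \<Rightarrow> real" and k
    using integrable_mult_indicator[OF AkM, of f k] by simp
  show Ri: "integrable M R"
    unfolding R[abs_def] by (intro Bochner_Integration.integrable_sum int_mult Bochner_Integration.integrable_diff Di \<phi>Z)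
  have "R \<omega> \<le> (\<Sum>k<N. indicator (Ak k) \<omega> * D k \<omega>) + C" for \<omega>
  proof -
    have "- indicator (Ak 0) \<omega> * \<phi> (Z (tm 0) \<omega>) \<le> (\<Sum>k<N. indicator (Ak k) \<omega> * (\<phi> (Z (tm (Suc k)) \<omega>) - \<phi> (Z (tm k) \<omega>)))"
    proof (rule abel_lower_bound[where J="\<lambda>k. indicator (Ak k) \<omega>" and f="\<lambda>k. \<phi> (Z (tm k) \<omega>)"])
      show "indicator (Ak (Suc k)) \<omega> \<le> (indicator (Ak k) \<omega> :: real)" for k
        by (auto simp: Ak_def indicator_def)
    qed (use \<phi> in auto)
    moreover have "indicator (Ak 0) \<omega> * \<phi> (Z (tm 0) \<omega>) \<le> C"
      using A(2)[of \<omega>] C by (auto simp: Ak_def indicator_def tm_def)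
    ultimately show ?thesis unfolding R by (simp add: right_diff_distrib sum_subtractf)
  qed
  then have "(\<integral>\<omega>. R \<omega> \<partial>M) \<le> (\<integral>\<omega>. (\<Sum>k<N. indicator (Ak k) \<omega> * D k \<omega>) + C \<partial>M)"
    by (intro integral_mono Ri Bochner_Integration.integrable_add Bochner_Integration.integrable_sum int_mult Di) auto
  also have "\<dots> = (\<integral>\<omega>. (\<Sum>k<N. indicator (Ak k) \<omega> * D k \<omega>) \<partial>M) + (\<integral>\<omega>. C \<partial>M)"
    by (intro Bochner_Integration.integral_add Bochner_Integration.integrable_sum int_mult Di integrable_const)
  also have "(\<integral>\<omega>. (\<Sum>k<N. indicator (Ak k) \<omega> * D k \<omega>) \<partial>M) = (\<Sum>k<N. (\<integral>\<omega>. indicator (Ak k) \<omega> * D k \<omega> \<partial>M))"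
    by (intro Bochner_Integration.integral_sum int_mult Di)
  also have "\<dots> + (\<integral>\<omega>. C \<partial>M) = C" by (simp add: D0 prob_space)
  finally show "(\<integral>\<omega>. R \<omega> \<partial>M) \<le> C" .
qed

text \<open>Markov's inequality for the exit time from \<open>K\<close>: along the paths that leave \<open>K\<close> the
  stopped sums are asymptotically nonnegative, along the others they are at least \<open>T\<close>.\<close>

lemma prob_stay_bound:
  fixes Z :: "real \<Rightarrow> 'w \<Rightarrow> 'b::topological_space"
  assumes M: "prob_space M" and Z: "continuous_process M Z"
    and m: "martingale_from M (natural_filtration M Z) Z S \<phi> \<psi>"
    and \<phi>: "\<phi> \<in> borel_measurable borel" "\<And>x. 0 \<le> \<phi> x" "\<And>x. \<phi> x \<le> B"
    and \<psi>: "\<psi> \<in> borel_measurable borel" "\<And>x. \<bar>\<psi> x\<bar> \<le> B'" "\<And>x. x \<in> K \<Longrightarrow> \<psi> x \<le> - 1"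
    and K: "closed K" "K \<subseteq> S" and t0: "0 \<le> t0" and T: "0 < T"
    and A: "A \<in> sets (natural_filtration M Z t0)" "\<And>\<omega>. \<omega> \<in> A \<Longrightarrow> \<phi> (Z t0 \<omega>) \<le> C" and C: "0 \<le> C"
  defines "E \<equiv> {\<omega> \<in> A. \<forall>u\<in>{t0..t0+T}. Z u \<omega> \<in> K}"
  shows "E \<in> sets M" and "T * measure M E \<le> C"
proof -
  interpret prob_space M by fact
  have AM: "A \<in> sets M" using A(1) subalgebra_natural_filtration[OF Z] by (auto simp: subalgebra_def)
  \<comment> \<open>The path is frozen at negative times because the grid lemmas ask for continuity
    on the whole line.\<close>
  define z where "z \<omega> u = Z (max 0 u) \<omega>" for \<omega> u
  have z_eq: "z \<omega> u = Z u \<omega>" if "0 \<le> u" for u \<omega> using that by (simp add: z_def)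
  have zc: "continuous_on UNIV (z \<omega>)" if "\<omega> \<in> space M" for \<omega>
    unfolding z_def
    by (rule continuous_on_compose2[of "{0..}" "\<lambda>t. Z t \<omega>"])
       (use Z that in \<open>auto simp: continuous_process_def intro!: continuous_intros\<close>)
  have g0: "0 \<le> grid t0 T N k" for N k using grid_mono[of T 0 k t0 N] T t0 by simp
  \<comment> \<open>For measurability: with \<open>K\<close> closed, staying in \<open>K\<close> is
    decided at the countably many grid times.\<close>
  have E_eq: "E = {\<omega> \<in> A. \<forall>N. \<forall>k\<le>Suc N. Z (grid t0 T (Suc N) k) \<omega> \<in> K}"
  proof (intro equalityI subsetI)
    fix \<omega> assume "\<omega> \<in> E"
    moreover have "grid t0 T (Suc N) k \<in> {t0..t0+T}" if "k \<le> Suc N" for N k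
      using grid_mono[of T 0 k t0 "Suc N"] grid_mono[of T k "Suc N" t0 "Suc N"] T that by (auto simp: grid_N)
    ultimately show "\<omega> \<in> {\<omega> \<in> A. \<forall>N. \<forall>k\<le>Suc N. Z (grid t0 T (Suc N) k) \<omega> \<in> K}"
      by (auto simp: E_def)
  next
    fix \<omega> assume \<omega>: "\<omega> \<in> {\<omega> \<in> A. \<forall>N. \<forall>k\<le>Suc N. Z (grid t0 T (Suc N) k) \<omega> \<in> K}"
    then have "\<omega> \<in> space M" using AM sets.sets_into_space by auto
    have "Z v \<omega> \<in> K" if v: "v \<in> {t0..t0+T}" for v
    proof (rule ccontr)
      assume "Z v \<omega> \<notin> K"
      then have "z \<omega> v \<notin> K" using v t0 by (simp add: z_eq)
      from path_grid_leaves[OF zc[OF \<open>\<omega> \<in> space M\<close>] K(1) T v this, rule_format, of 1]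
      obtain N p where "p \<le> Suc N" "z \<omega> (grid t0 T (Suc N) p) \<notin> K" by auto
      then show False using \<omega> by (simp add: z_eq g0)
    qed
    then show "\<omega> \<in> E" using \<omega> by (auto simp: E_def)
  qed
  have ZK: "{\<omega> \<in> space M. Z t \<omega> \<in> K} \<in> sets M" if "0 \<le> t" for t
    using measurable_sets[OF _ borel_closed[OF K(1)], of "Z t" M] Z that
    by (auto simp: continuous_process_def vimage_def Int_def conj_commute)
  have "E = A \<inter> {\<omega> \<in> space M. \<forall>N. \<forall>k\<in>{..Suc N}. Z (grid t0 T (Suc N) k) \<omega> \<in> K}"
    unfolding E_eq using sets.sets_into_space[OF AM] by auto
  also have "\<dots> \<in> sets M"
    by (intro sets.Int AM sets.sets_Collect_countable_All sets.sets_Collect_finite_All ZK g0) auto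
  finally show E: "E \<in> sets M" .
  define R where "R N \<omega> = indicator A \<omega> * stopped_sum (\<lambda>u. Z u \<omega>) (\<lambda>x. - \<psi> x) K t0 T (Suc N)" for N \<omega>
  have Ri: "integrable M (R N)" and RC: "(\<integral>\<omega>. R N \<omega> \<partial>M) \<le> C" for N
    unfolding R_def
    using stopped_sum_expectation[OF M Z m \<phi> K t0 T A C, of "Suc N"] by blast+
  have Rz: "R N \<omega> = indicator A \<omega> * stopped_sum (z \<omega>) (\<lambda>x. - \<psi> x) K t0 T (Suc N)" for N \<omega>
  proof -
    have "(LINT u:{grid t0 T (Suc N) k..grid t0 T (Suc N) (Suc k)}|lborel. - \<psi> (Z u \<omega>)) =
       (LINT u:{grid t0 T (Suc N) k..grid t0 T (Suc N) (Suc k)}|lborel. - \<psi> (z \<omega> u))" for k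
      by (rule set_lebesgue_integral_cong) (use order_trans[OF g0] in \<open>auto simp: z_eq\<close>)
    then show ?thesis by (simp add: R_def stopped_sum_def z_eq g0)
  qed
  have \<psi>': "(\<lambda>x. - \<psi> x) \<in> borel_measurable borel" "\<And>x. \<bar>- \<psi> x\<bar> \<le> B'" "\<And>x. x \<in> K \<Longrightarrow> - \<psi> x \<ge> 1"
    using \<psi>(2,3) by (auto intro: borel_measurable_uminus \<psi>(1))
  \<comment> \<open>Capping \<open>R N\<close> turns its one-sided asymptotics into convergence to
    \<open>T * indicator E\<close>, while the mean stays at most \<open>C\<close>.\<close>
  define Q where "Q N \<omega> = min (R N \<omega>) (T * indicator E \<omega>)" for N \<omega>
  have lim: "(\<lambda>N. Q N \<omega>) \<longlonglongrightarrow> T * indicator E \<omega>" if \<omega>: "\<omega> \<in> space M" for \<omega>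
  proof (cases "\<omega> \<in> E")
    case True
    then have "T \<le> R N \<omega>" for N
      using stopped_sum_stay[OF zc[OF \<omega>] K(1) T \<psi>', of "Suc N" t0] t0
      by (auto simp: Rz E_def z_eq)
    then have "Q N \<omega> = T * indicator E \<omega>" for N using True by (simp add: Q_def min_absorb2)
    then show ?thesis by simp
  next
    case False
    have low: "\<exists>N0. \<forall>N\<ge>N0. - \<epsilon> \<le> R N \<omega>" if "\<epsilon> > 0" for \<epsilon>
    proof (cases "\<omega> \<in> A")
      case True
      with False obtain v where v: "v \<in> {t0..t0+T}" "Z v \<omega> \<notin> K" by (auto simp: E_def)
      then have "z \<omega> v \<notin> K" using t0 by (simp add: z_eq)
      from stopped_sum_leave[OF zc[OF \<omega>] K(1) T \<psi>' v(1) this that] show ?thesis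
        using True by (simp add: Rz)
    qed (use that in \<open>simp add: R_def\<close>)
    have "(\<lambda>N. Q N \<omega>) \<longlonglongrightarrow> 0"
    proof (rule LIMSEQ_I)
      fix r :: real assume "0 < r"
      then obtain N0 where "\<And>N. N \<ge> N0 \<Longrightarrow> - (r / 2) \<le> R N \<omega>" using low[of "r / 2"] by auto
      then have "norm (Q N \<omega> - 0) < r" if "N \<ge> N0" for N
        using that \<open>0 < r\<close> False by (fastforce simp: Q_def min_def)
      then show "\<exists>N0. \<forall>N\<ge>N0. norm (Q N \<omega> - 0) < r" by blast
    qed
    then show ?thesis using False by simp
  qed
  have B'0: "0 \<le> B'" using \<psi>(2)[of undefined] by linarith
  have Rb: "\<bar>R N \<omega>\<bar> \<le> B' * T" if \<omega>: "\<omega> \<in> space M" for N \<omega>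
    using stopped_sum_bounded[OF zc[OF \<omega>] K(1) T \<psi>', of "Suc N" t0] B'0 T
    by (auto simp: Rz indicator_def)
  have Qm: "Q N \<in> borel_measurable M" for N
    unfolding Q_def[abs_def] using Ri[of N] E by (auto intro!: borel_measurable_min borel_measurable_times borel_measurable_indicator)
  have Qb: "AE \<omega> in M. norm (Q N \<omega>) \<le> B' * T + T" for N
  proof (rule AE_I2)
    fix \<omega> assume "\<omega> \<in> space M"
    then show "norm (Q N \<omega>) \<le> B' * T + T" using Rb[of \<omega> N] T B'0 mult_nonneg_nonneg[of B' T]
      by (auto simp: Q_def min_def indicator_def split: if_splits)
  qed
  have "(\<lambda>N. \<integral>\<omega>. Q N \<omega> \<partial>M) \<longlonglongrightarrow> (\<integral>\<omega>. T * indicator E \<omega> \<partial>M)"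
  proof (rule integral_dominated_convergence[where w="\<lambda>_. B' * T + T"])
    show "(\<lambda>\<omega>. T * indicator E \<omega>) \<in> borel_measurable M" using E by auto
    show "AE \<omega> in M. (\<lambda>N. Q N \<omega>) \<longlonglongrightarrow> T * indicator E \<omega>" using lim by auto
  qed (use Qm Qb in auto)
  moreover have "(\<integral>\<omega>. Q N \<omega> \<partial>M) \<le> C" for N
  proof -
    have "(\<integral>\<omega>. Q N \<omega> \<partial>M) \<le> (\<integral>\<omega>. R N \<omega> \<partial>M)"
      by (intro integral_mono Ri integrable_const_bound[OF Qb Qm]) (auto simp: Q_def)
    with RC[of N] show ?thesis by linarith
  qed
  ultimately have "(\<integral>\<omega>. T * indicator E \<omega> \<partial>M) \<le> C" by (intro LIMSEQ_le_const2) auto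
  then show "T * measure M E \<le> C" using E by simp
qed

text \<open>For paths starting in \<open>K j\<close>, the probability of spending
  \<open>[t0, t0 + T]\<close> in \<open>K (j + n)\<close> is at most \<open>C' / T\<close>, with
  \<open>C'\<close> independent of \<open>n\<close> by \<open>fin\<close>. By \<open>ex\<close>, a
  path that stays in \<open>S\<close> over this time lies in some \<open>K (j + n)\<close>. The
  increasing union over \<open>n\<close> keeps the bound, and large \<open>T\<close> leaves a null
  set.\<close>

lemma AE_exits_region:
  fixes Z :: "real \<Rightarrow> 'w \<Rightarrow> 'b::topological_space" and K :: "nat \<Rightarrow> 'b set"
  assumes M: "prob_space M" and Z: "continuous_process M Z"
    and m: "\<And>n. martingale_from M (natural_filtration M Z) Z S (\<phi> n) (\<psi> n)"
    and \<phi>: "\<And>n. \<phi> n \<in> borel_measurable borel" "\<And>n x. 0 \<le> \<phi> n x" "\<And>n. \<exists>B. \<forall>x. \<phi> n x \<le> B"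
    and \<psi>: "\<And>n. \<psi> n \<in> borel_measurable borel" "\<And>n. \<exists>B. \<forall>x. \<bar>\<psi> n x\<bar> \<le> B" "\<And>n x. x \<in> K n \<Longrightarrow> \<psi> n x \<le> - 1"
    and K: "\<And>n. closed (K n)" "\<And>n. K n \<subseteq> S" "incseq K"
    and fin: "\<And>j. \<exists>C. \<forall>n\<ge>j. \<forall>x\<in>K j. \<phi> n x \<le> C"
    and ex: "\<And>(z :: real \<Rightarrow> 'b) s t. s \<le> t \<Longrightarrow> continuous_on {s..t} z \<Longrightarrow> z ` {s..t} \<subseteq> S \<Longrightarrow> \<exists>n. z ` {s..t} \<subseteq> K n"
    and t0: "0 \<le> t0"
  shows "AE \<omega> in M. Z t0 \<omega> \<in> S \<longrightarrow> (\<exists>t>t0. Z t \<omega> \<notin> S)"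
proof -
  interpret prob_space M by fact
  have zc: "continuous_on {s..t} (\<lambda>u. Z u \<omega>)" if "\<omega> \<in> space M" "0 \<le> s" for \<omega> s t
    using Z that by (auto simp: continuous_process_def intro: continuous_on_subset)
  define A where "A j = {\<omega> \<in> space M. Z t0 \<omega> \<in> K j}" for j
  have A: "A j \<in> sets (natural_filtration M Z t0)" for j
    using measurable_sets[OF measurable_natural_filtration[OF t0 order_refl, of Z M] borel_closed[OF K(1)[of j]]]
    by (auto simp: A_def vimage_def Int_def conj_commute)
  define E where "E j T n = {\<omega> \<in> A j. \<forall>u\<in>{t0..t0 + T}. Z u \<omega> \<in> K (j + n)}" for j n and T :: real
  have null: "(\<Inter>k. \<Union>n. E j (real (Suc k)) n) \<in> null_sets M" (is "?X \<in> _") for j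
  proof -
    obtain C where C: "\<And>n x. n \<ge> j \<Longrightarrow> x \<in> K j \<Longrightarrow> \<phi> n x \<le> C" using fin[of j] by blast
    define C' where "C' = max 0 C"
    have b: "E j T n \<in> sets M \<and> T * measure M (E j T n) \<le> C'" if "0 < T" for T n
    proof -
      obtain B where B: "\<And>x. \<phi> (j + n) x \<le> B" using \<phi>(3)[of "j + n"] by blast
      obtain B' where B': "\<And>x. \<bar>\<psi> (j + n) x\<bar> \<le> B'" using \<psi>(2)[of "j + n"] by blast
      have *: "\<phi> (j + n) (Z t0 \<omega>) \<le> C'" if "\<omega> \<in> A j" for \<omega>
        using C[of "j + n" "Z t0 \<omega>"] that by (auto simp: A_def C'_def)
      have "0 \<le> C'" by (simp add: C'_def)
      from prob_stay_bound[OF M Z m \<phi>(1,2) B \<psi>(1) B' \<psi>(3) K(1,2) t0 that A * this]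
      show ?thesis unfolding E_def by blast
    qed
    have U: "T * measure M (\<Union>n. E j T n) \<le> C'" if "0 < T" for T
    proof -
      have "incseq (E j T)"
      proof (rule incseq_SucI)
        have "K (j + n) \<subseteq> K (j + Suc n)" for n using K(3) by (simp add: incseq_def)
        then show "E j T n \<subseteq> E j T (Suc n)" for n unfolding E_def by blast
      qed
      then have "(\<lambda>n. measure M (E j T n)) \<longlonglongrightarrow> measure M (\<Union>n. E j T n)"
        using b[OF that] by (intro finite_Lim_measure_incseq) auto
      then have "(\<lambda>n. T * measure M (E j T n)) \<longlonglongrightarrow> T * measure M (\<Union>n. E j T n)"
        by (intro tendsto_intros)
      then show ?thesis using b[OF that] by (intro LIMSEQ_le_const2) auto
    qed
    have UM: "(\<Union>n. E j (real (Suc k)) n) \<in> sets M" for k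
      using b[of "real (Suc k)"] by (intro sets.countable_UN) auto
    then have X: "?X \<in> sets M" by (intro sets.countable_INT) auto
    have "measure M ?X \<le> C' * (1 / real (Suc k))" for k
    proof -
      have "measure M ?X \<le> measure M (\<Union>n. E j (real (Suc k)) n)"
        using UM by (intro finite_measure_mono) auto
      also have "\<dots> \<le> C' / real (Suc k)" using U[of "real (Suc k)"] by (simp add: field_simps)
      finally show ?thesis by simp
    qed
    moreover have "(\<lambda>k. C' * (1 / real (Suc k))) \<longlonglongrightarrow> C' * 0"
      by (intro tendsto_intros LIMSEQ_Suc[OF lim_1_over_n])
    ultimately have "measure M ?X \<le> C' * 0" by (intro LIMSEQ_le_const) auto
    then have "measure M ?X = 0" using measure_nonneg[of M ?X] by linarith
    with X show ?thesis by (simp add: emeasure_eq_measure null_setsI)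
  qed
  have "AE \<omega> in M. \<forall>j. \<omega> \<notin> (\<Inter>k. \<Union>n. E j (real (Suc k)) n)"
    using AE_not_in[OF null] by (simp add: AE_all_countable)
  then show ?thesis
  proof (rule AE_mp, intro AE_I2 impI)
    fix \<omega> assume \<omega>: "\<omega> \<in> space M" and nin: "\<forall>j. \<omega> \<notin> (\<Inter>k. \<Union>n. E j (real (Suc k)) n)" and S: "Z t0 \<omega> \<in> S"
    show "\<exists>t>t0. Z t \<omega> \<notin> S"
    proof (rule ccontr)
      assume "\<not> (\<exists>t>t0. Z t \<omega> \<notin> S)"
      then have stay: "Z t \<omega> \<in> S" if "t0 \<le> t" for t using S that by (cases "t = t0") auto
      have seg: "\<exists>n. \<forall>u\<in>{t0..t0+T}. Z u \<omega> \<in> K n" if "0 \<le> T" for T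
        using ex[OF _ zc[OF \<omega> t0], of "t0 + T"] stay that by (auto simp: image_subset_iff)
      obtain j where j: "Z t0 \<omega> \<in> K j" using seg[of 0] by auto
      have in_U: "\<omega> \<in> (\<Union>n. E j T n)" if T: "0 \<le> T" for T
      proof -
        obtain n where n: "\<forall>u\<in>{t0..t0+T}. Z u \<omega> \<in> K n" using seg[OF T] by blast
        have "K n \<subseteq> K (j + n)" using K(3) by (simp add: incseq_def)
        then show ?thesis using n j \<omega> by (auto simp: E_def A_def)
      qed
      have "\<omega> \<in> (\<Inter>k. \<Union>n. E j (real (Suc k)) n)" by (intro INT_I in_U) simp
      then show False using nin by blast
    qed
  qed
qed

section \<open>Exit of the dual process from the faces and the interior\<close>

text \<open>Continuity is asked on \<open>K\<close> only, which suits the interior generator: it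
  divides by the mass of \<open>[x, y]\<close>, and that vanishes on the diagonal.\<close>

lemma compact_support_bounded:
  fixes h :: "'a::t2_space \<Rightarrow> real"
  assumes "compact K" "continuous_on K h" "\<And>x. x \<notin> K \<Longrightarrow> h x = 0"
  shows "\<exists>B. \<forall>x. \<bar>h x\<bar> \<le> B" and "h \<in> borel_measurable borel"
proof -
  have "bounded (h ` K)" using assms by (intro compact_imp_bounded compact_continuous_image)
  then obtain B where "\<And>x. x \<in> K \<Longrightarrow> \<bar>h x\<bar> \<le> B" unfolding bounded_real by auto
  then have "\<bar>h x\<bar> \<le> max B 0" for x using assms(3)[of x] by (cases "x \<in> K") (auto intro: max.coboundedI1)
  then show "\<exists>B. \<forall>x. \<bar>h x\<bar> \<le> B" by blast
  have "(\<lambda>x. indicator K x *\<^sub>R h x) \<in> borel_measurable borel"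
    using assms by (intro borel_measurable_continuous_on_indicator borel_closed compact_imp_closed) auto
  moreover have "(\<lambda>x. indicator K x *\<^sub>R h x) = h" using assms(3) by (auto simp: indicator_def fun_eq_iff)
  ultimately show "h \<in> borel_measurable borel" by simp
qed

lemma borel_real_fst [measurable]: "(\<lambda>z :: ereal \<times> ereal. real_of_ereal (fst z)) \<in> borel_measurable borel"
  and borel_real_snd [measurable]: "(\<lambda>z :: ereal \<times> ereal. real_of_ereal (snd z)) \<in> borel_measurable borel"
  by (rule borel_measurable_real_of_ereal, rule borel_measurable_continuous_onI,
      intro continuous_intros)+

lemma borel_regions: "Eint \<in> sets borel" "Eright \<in> sets borel" "Eleft \<in> sets borel"
proof -
  have [measurable]: "(fst :: ereal \<times> ereal \<Rightarrow> _) \<in> borel_measurable borel" "(snd :: ereal \<times> ereal \<Rightarrow> _) \<in> borel_measurable borel"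
    by (auto intro!: borel_measurable_continuous_onI continuous_intros)
  have "Eint = {z \<in> space borel. fst z \<noteq> -\<infinity> \<and> snd z \<noteq> \<infinity> \<and> fst z < snd z}"
    unfolding Eint_def by (auto, case_tac a; case_tac b; auto)
  also have "\<dots> \<in> sets borel" by measurable
  finally show "Eint \<in> sets borel" .
  have "Eright = {z \<in> space borel. fst z \<noteq> -\<infinity> \<and> fst z \<noteq> \<infinity> \<and> snd z = \<infinity>}"
    unfolding Eright_def by (auto, case_tac a; auto)
  also have "\<dots> \<in> sets borel" by measurable
  finally show "Eright \<in> sets borel" .
  have "Eleft = {z \<in> space borel. snd z \<noteq> -\<infinity> \<and> snd z \<noteq> \<infinity> \<and> fst z = -\<infinity>}"
    unfolding Eleft_def by (auto, case_tac b; auto)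
  also have "\<dots> \<in> sets borel" by measurable
  finally show "Eleft \<in> sets borel" .
qed

lemma borel_ext_int:
  assumes "(\<lambda>(x, y). h x y) \<in> borel_measurable borel"
  shows "ext_int h \<in> borel_measurable borel"
proof -
  have "(\<lambda>z :: ereal \<times> ereal. (real_of_ereal (fst z), real_of_ereal (snd z))) \<in> borel \<rightarrow>\<^sub>M borel"
    unfolding borel_prod[symmetric] by (intro measurable_Pair) (auto simp: borel_prod)
  from measurable_compose[OF this assms]
  have "(\<lambda>z :: ereal \<times> ereal. h (real_of_ereal (fst z)) (real_of_ereal (snd z))) \<in> borel_measurable borel"
    by simp
  then show ?thesis unfolding ext_int_def[abs_def] using borel_regions by (intro measurable_If_set) auto
qed

text \<open>The plateau extends to \<open>n + 1\<close>, so that each point of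
  \<open>[- n, n]\<close> has a neighbourhood on which the cut-off changes nothing; derivatives
  there are those of the uncut function.\<close>

definition bump :: "nat \<Rightarrow> real \<Rightarrow> real" where
  "bump n y = step (real n + 2 + y) * step (real n + 2 - y)"

lemma smooth_bump: "smooth (bump n)"
  unfolding bump_def[abs_def]
  by (intro smooth_mult smooth_compose[OF smooth_step] smooth_add smooth_diff smooth_const smooth_ident)

lemma bump_nonneg: "0 \<le> bump n y" and bump_le_1: "bump n y \<le> 1"
  by (auto simp: bump_def step_nonneg step_le_1 intro: mult_le_one)

lemma bump_eq_1: "\<bar>y\<bar> \<le> real n + 1 \<Longrightarrow> bump n y = 1"
  and bump_eq_0: "\<bar>y\<bar> \<ge> real n + 2 \<Longrightarrow> bump n y = 0"
  by (auto simp: bump_def step_eq_1 step_eq_0 abs_if split: if_splits)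

context posrec
begin

text \<open>These are the properties that \<open>AE_exits_region\<close> requires of a cut-off
  superharmonic function. The last bound is uniform in \<open>n\<close> because
  \<open>bump n\<close> is at most 1, so \<open>f n\<close> never exceeds
  \<open>P / H\<close>.\<close>

lemma face_test_functions:
  fixes s k C :: real
  assumes P: "\<And>u. (P has_real_derivative s * (poisson k u * \<rho> u)) (at u)" "\<And>u. 0 \<le> P u"
    and H: "\<And>u. (H has_real_derivative s * \<rho> u) (at u)" "\<And>u. H u > 0"
    and sH: "\<And>u. s * (k - F u) = - H u"
  defines "f \<equiv> \<lambda>n u. bump n u * (P u / H u)"
    and "L \<equiv> \<lambda>f y. nabla1 a (nabla1 a f) y + (deriv a y / 2 - b y) * deriv f y
      + 2 * (sqrt (a y) * (s * \<rho> y) / H y) * nabla1 a f y"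
  shows "test_fun (f n)" "f n \<in> borel_measurable borel" "0 \<le> f n y" "\<exists>B. \<forall>y. f n y \<le> B"
    and "L (f n) \<in> borel_measurable borel" "\<exists>B. \<forall>y. \<bar>L (f n) y\<bar> \<le> B"
    and "\<bar>y\<bar> \<le> real n \<Longrightarrow> L (f n) y = - 1"
    and "\<exists>B. \<forall>n. \<forall>y. \<bar>y\<bar> \<le> real j \<longrightarrow> f n y \<le> B"
proof -
  have H0: "H u \<noteq> 0" for u using H(2)[of u] by simp
  have sP: "smooth P"
    by (rule smooth_SucI[OF P(1)]) (intro smooth_mult smooth_const smooth_poisson smooth_rho)
  have sH': "smooth H" by (rule smooth_SucI[OF H(1)]) (intro smooth_mult smooth_const smooth_rho)
  have sPH: "smooth (\<lambda>u. P u / H u)" by (intro smooth_divide sP sH' H0)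
  have sf: "smooth (f n)" unfolding f_def by (intro smooth_mult smooth_bump sPH)
  define K where "K = {- (real n + 2)..real n + 2}"
  have K: "compact K" by (simp add: K_def)
  have f0: "f n y = 0" if "y \<notin> K" for y
    using bump_eq_0[of n y] that by (auto simp: f_def K_def abs_if)
  show "test_fun (f n)" using sf K f0 by (auto simp: test_fun_def)
  show "f n \<in> borel_measurable borel" by (intro borel_measurable_continuous_onI smooth_continuous sf)
  show fn: "0 \<le> f n y" for n y
    using bump_nonneg P(2) H(2) by (auto simp: f_def less_imp_le intro!: mult_nonneg_nonneg divide_nonneg_nonneg)
  show "\<exists>B. \<forall>y. f n y \<le> B"
    using compact_support_bounded(1)[OF K smooth_continuous[OF sf] f0] by (meson abs_le_D1)
  have d0: "deriv h y = 0" if "\<And>u. u \<notin> K \<Longrightarrow> h u = 0" "y \<notin> K" for h y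
    by (rule deriv_eq_on_open[of "- K" y h "\<lambda>_. 0"]) (use that K compact_imp_closed in auto)
  have n0: "nabla1 a (f n) y = 0" if "y \<notin> K" for y using d0[OF f0 that] by (simp add: nabla1_def)
  have nn0: "nabla1 a (nabla1 a (f n)) y = 0" if "y \<notin> K" for y
    using d0[of "nabla1 a (f n)", OF n0 that] by (simp add: nabla1_def)
  have L0: "L (f n) y = 0" if "y \<notin> K" for y using that by (simp add: L_def n0 nn0 d0[OF f0])
  have sn: "smooth (nabla1 a h)" if "smooth h" for h
    unfolding nabla1_def sqa_def[symmetric] by (intro smooth_mult smooth_sqa smooth_deriv that)
  have "smooth (\<lambda>y. nabla1 a (nabla1 a (f n)) y + (deriv a y / 2 - b y) * deriv (f n) y
      + 2 * (sqa y * (s * \<rho> y) / H y) * nabla1 a (f n) y)"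
    by (intro smooth_add smooth_mult smooth_diff smooth_divide sn sf smooth_deriv smooth_a smooth_b
        smooth_const smooth_sqa smooth_rho sH' H0) auto
  then have cL: "continuous_on S (L (f n))" for S
    unfolding L_def sqa_def[symmetric] by (rule smooth_continuous)
  show "L (f n) \<in> borel_measurable borel" "\<exists>B. \<forall>y. \<bar>L (f n) y\<bar> \<le> B"
    using compact_support_bounded[OF K cL L0] by auto
  show "L (f n) y = - 1" if "\<bar>y\<bar> \<le> real n"
    unfolding L_def
  proof (rule face_generator[where P=P and k=k])
    show "open {- (real n + 1)<..<real n + 1}" "y \<in> {- (real n + 1)<..<real n + 1}"
      using that by auto
    show "f n u = P u / H u" if "u \<in> {- (real n + 1)<..<real n + 1}" for u
      using that bump_eq_1[of u n] by (auto simp: f_def abs_le_iff)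
  qed (use P H sH in auto)
  have "bounded ((\<lambda>u. P u / H u) ` {- real j..real j})"
    by (intro compact_imp_bounded compact_continuous_image smooth_continuous sPH) auto
  then obtain B where B: "\<And>y. y \<in> {- real j..real j} \<Longrightarrow> \<bar>P y / H y\<bar> \<le> B"
    unfolding bounded_real by blast
  have "f n y \<le> B" if "\<bar>y\<bar> \<le> real j" for n y
  proof -
    have "f n y \<le> P y / H y"
      unfolding f_def using bump_le_1 bump_nonneg P(2) H(2)
      by (intro mult_left_le_one_le divide_nonneg_nonneg) (auto simp: less_imp_le)
    also have "\<dots> \<le> B"
      by (rule order_trans[OF abs_ge_self B]) (use that in \<open>auto simp: abs_le_iff\<close>)
    finally show ?thesis .
  qed
  then show "\<exists>B. \<forall>n. \<forall>y. \<bar>y\<bar> \<le> real j \<longrightarrow> f n y \<le> B" by blast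
qed

text \<open>A face of the state space is a copy of the real line, with embedding \<open>emb\<close> and
  coordinate \<open>pr\<close>.\<close>

lemma AE_exits_face:
  fixes Z :: "real \<Rightarrow> 'w \<Rightarrow> 'b::t2_space" and emb :: "real \<Rightarrow> 'b" and pr :: "'b \<Rightarrow> real" and s k :: real
  assumes M: "prob_space M" and Z: "continuous_process M Z" and t0: "0 \<le> t0"
    and emb: "continuous_on UNIV emb" "range emb = S" "\<And>y. pr (emb y) = y"
    and S: "S \<in> sets borel" "pr \<in> borel_measurable borel" "continuous_on S pr"
    and P: "\<And>u. (P has_real_derivative s * (poisson k u * \<rho> u)) (at u)" "\<And>u. 0 \<le> P u"
    and H: "\<And>u. (H has_real_derivative s * \<rho> u) (at u)" "\<And>u. H u > 0"
    and sH: "\<And>u. s * (k - F u) = - H u"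
    and L: "\<And>f y. L f y = nabla1 a (nabla1 a f) y + (deriv a y / 2 - b y) * deriv f y
      + 2 * (sqrt (a y) * (s * \<rho> y) / H y) * nabla1 a f y"
    and m: "\<And>f. test_fun f \<Longrightarrow> martingale_from M (natural_filtration M Z) Z S
          (\<lambda>z. if z \<in> S then f (pr z) else 0) (\<lambda>z. if z \<in> S then L f (pr z) else 0)"
  shows "AE \<omega> in M. Z t0 \<omega> \<in> S \<longrightarrow> (\<exists>t>t0. Z t \<omega> \<notin> S)"
proof -
  define f where "f n u = bump n u * (P u / H u)" for n u
  note ft = face_test_functions[OF P H sH, folded f_def L]
  define K where "K n = emb ` {- real n..real n}" for n
  define ext where "ext h z = (if z \<in> S then h (pr z) else 0)" for h :: "real \<Rightarrow> real" and z
  have ext_emb: "ext h (emb y) = h y" for h y using emb by (auto simp: ext_def)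
  have borel_ext: "ext h \<in> borel_measurable borel" if "h \<in> borel_measurable borel" for h
    unfolding ext_def[abs_def] using S measurable_compose[OF S(2) that] by (intro measurable_If_set) auto
  show ?thesis
  proof (rule AE_exits_region[where K=K and \<phi>="\<lambda>n. ext (f n)" and \<psi>="\<lambda>n. ext (L (f n))",
        OF M Z _ _ _ _ _ _ _ _ _ _ _ _ t0])
    show "martingale_from M (natural_filtration M Z) Z S (ext (f n)) (ext (L (f n)))" for n
      unfolding ext_def[abs_def] by (rule m[OF ft(1)])
    show "ext (f n) \<in> borel_measurable borel" for n by (rule borel_ext[OF ft(2)])
    show "0 \<le> ext (f n) x" for n x by (simp add: ext_def ft(3))
    show "\<exists>B. \<forall>x. ext (f n) x \<le> B" for n
    proof -
      obtain B where B: "\<And>y. f n y \<le> B" using ft(4)[of n] by blast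
      have "ext (f n) x \<le> max B 0" for x
        by (auto simp: ext_def intro: max.coboundedI1 B)
      then show ?thesis by blast
    qed
    show "ext (L (f n)) \<in> borel_measurable borel" for n by (rule borel_ext[OF ft(5)])
    show "\<exists>B. \<forall>x. \<bar>ext (L (f n)) x\<bar> \<le> B" for n
    proof -
      obtain B where B: "\<And>y. \<bar>L (f n) y\<bar> \<le> B" using ft(6)[of n] by blast
      have "\<bar>ext (L (f n)) x\<bar> \<le> max B 0" for x
        by (auto simp: ext_def intro: max.coboundedI1 B)
      then show ?thesis by blast
    qed
    show "ext (L (f n)) x \<le> - 1" if "x \<in> K n" for n x
      using that ft(7)[of _ n] by (auto simp: K_def ext_emb)
    have "compact (K n)" for n
      unfolding K_def by (intro compact_continuous_image continuous_on_subset[OF emb(1)]) auto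
    then show "closed (K n)" for n by (rule compact_imp_closed)
    show "K n \<subseteq> S" for n using emb(2) by (auto simp: K_def)
    show "incseq K" unfolding K_def by (intro incseq_SucI image_mono) auto
    show "\<exists>C. \<forall>n\<ge>j. \<forall>x\<in>K j. ext (f n) x \<le> C" for j
    proof -
      obtain B where "\<forall>n y. \<bar>y\<bar> \<le> real j \<longrightarrow> f n y \<le> B" using ft(8)[of j] by blast
      then show ?thesis by (intro exI[of _ B]) (auto simp: K_def ext_emb)
    qed
    show "\<exists>n. z ` {s..t} \<subseteq> K n" if "s \<le> t" "continuous_on {s..t} z" "z ` {s..t} \<subseteq> S"
      for z :: "real \<Rightarrow> 'b" and s t
    proof -
      have zy: "z u = emb (pr (z u))" if "u \<in> {s..t}" for u
        using that \<open>z ` {s..t} \<subseteq> S\<close> emb(2,3) by force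
      have "continuous_on {s..t} (\<lambda>u. pr (z u))"
        by (rule continuous_on_compose2[OF S(3) that(2,3)])
      then have "bounded ((\<lambda>u. pr (z u)) ` {s..t})" by (intro compact_imp_bounded compact_continuous_image) auto
      then obtain B where B: "\<And>u. u \<in> {s..t} \<Longrightarrow> \<bar>pr (z u)\<bar> \<le> B" unfolding bounded_real by blast
      obtain n where n: "B \<le> real n" using real_arch_simple by blast
      have "z u \<in> K n" if "u \<in> {s..t}" for u
        unfolding K_def using B[OF that] n by (subst zy[OF that]) (auto simp: abs_le_iff)
      then show ?thesis by blast
    qed
  qed
qed

text \<open>On this face the mass is \<open>F\<close>, and \<open>s = 1\<close>,
  \<open>k = 0\<close> give \<open>s * (k - F) = - F\<close>. Adding a bound \<open>C\<close> of
  \<bar>W\<bar> makes the numerator nonnegative.\<close>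

lemma AE_exits_left:
  assumes M: "prob_space M" and Z: "continuous_process M Z"
    and m: "\<And>f. test_fun f \<Longrightarrow> martingale_from M (natural_filtration M Z) Z Eleft
          (ext_left f) (ext_left (Lstar_left a b f))" and t0: "0 \<le> t0"
  shows "AE \<omega> in M. Z t0 \<omega> \<in> Eleft \<longrightarrow> (\<exists>t>t0. Z t \<omega> \<notin> Eleft)"
proof -
  obtain C where C: "C \<ge> 0" "\<And>x. \<bar>W 0 x\<bar> \<le> C" using W_bounded[of 0] by auto
  show ?thesis
  proof (rule AE_exits_face[OF M Z t0, where emb="\<lambda>y. (-\<infinity>, ereal y)" and pr="\<lambda>z. real_of_ereal (snd z)"
        and s=1 and k=0 and P="\<lambda>u. C + W 0 u" and H=F and L="Lstar_left a b"])
    show "((\<lambda>u. C + W 0 u) has_real_derivative 1 * (poisson 0 u * \<rho> u)) (at u)" for u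
      by (auto intro!: derivative_eq_intros W_has_deriv)
    show "0 \<le> C + W 0 u" for u using C(2)[of u] by linarith
    show "continuous_on Eleft (\<lambda>z. real_of_ereal (snd z))"
      by (rule continuous_on_compose2[OF continuous_on_real]) (auto intro!: continuous_intros simp: Eleft_def)
    show "Lstar_left a b f y = nabla1 a (nabla1 a f) y + (deriv a y / 2 - b y) * deriv f y
        + 2 * (sqrt (a y) * (1 * \<rho> y) / F y) * nabla1 a f y" for f y
      by (simp add: Lstar_left_def F_def)
    show "martingale_from M (natural_filtration M Z) Z Eleft
       (\<lambda>z. if z \<in> Eleft then f (real_of_ereal (snd z)) else 0)
       (\<lambda>z. if z \<in> Eleft then Lstar_left a b f (real_of_ereal (snd z)) else 0)" if "test_fun f" for f
      using m[OF that] by (simp add: ext_left_def[abs_def])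
  qed (use F_has_deriv F_pos borel_regions in
      \<open>auto simp: Eleft_def intro!: continuous_intros borel_real_snd\<close>)
qed

text \<open>Here the mass is \<open>1 - F\<close>, which decreases: \<open>s = - 1\<close> accounts
  for the sign of the drift, and \<open>k = 1\<close> gives
  \<open>s * (k - F) = - (1 - F)\<close>.\<close>

lemma AE_exits_right:
  assumes M: "prob_space M" and Z: "continuous_process M Z"
    and m: "\<And>f. test_fun f \<Longrightarrow> martingale_from M (natural_filtration M Z) Z Eright
          (ext_right f) (ext_right (Lstar_right a b f))" and t0: "0 \<le> t0"
  shows "AE \<omega> in M. Z t0 \<omega> \<in> Eright \<longrightarrow> (\<exists>t>t0. Z t \<omega> \<notin> Eright)"
proof -
  obtain C where C: "C \<ge> 0" "\<And>x. \<bar>W 1 x\<bar> \<le> C" using W_bounded[of 1] by auto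
  show ?thesis
  proof (rule AE_exits_face[OF M Z t0, where emb="\<lambda>y. (ereal y, \<infinity>)" and pr="\<lambda>z. real_of_ereal (fst z)"
        and s="-1" and k=1 and P="\<lambda>u. C - W 1 u" and H="\<lambda>u. 1 - F u" and L="Lstar_right a b"])
    show "((\<lambda>u. C - W 1 u) has_real_derivative - 1 * (poisson 1 u * \<rho> u)) (at u)" for u
      by (auto intro!: derivative_eq_intros W_has_deriv)
    show "((\<lambda>u. 1 - F u) has_real_derivative - 1 * \<rho> u) (at u)" for u
      by (auto intro!: derivative_eq_intros F_has_deriv)
    show "0 \<le> C - W 1 u" for u using C(2)[of u] by linarith
    show "continuous_on Eright (\<lambda>z. real_of_ereal (fst z))"
      by (rule continuous_on_compose2[OF continuous_on_real]) (auto intro!: continuous_intros simp: Eright_def)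
    show "Lstar_right a b f y = nabla1 a (nabla1 a f) y + (deriv a y / 2 - b y) * deriv f y
        + 2 * (sqrt (a y) * (- 1 * \<rho> y) / (1 - F y)) * nabla1 a f y" for f y
      by (simp add: Lstar_right_def measure_mu_atLeast)
    show "martingale_from M (natural_filtration M Z) Z Eright
       (\<lambda>z. if z \<in> Eright then f (real_of_ereal (fst z)) else 0)
       (\<lambda>z. if z \<in> Eright then Lstar_right a b f (real_of_ereal (fst z)) else 0)" if "test_fun f" for f
      using m[OF that] by (simp add: ext_right_def[abs_def])
  qed (use F_less_1 borel_regions in
      \<open>auto simp: Eright_def intro!: continuous_intros borel_real_fst\<close>)
qed

end

section \<open>Exit from the interior\<close>

context posrec
begin

text \<open>Compact pieces of the half-plane above the diagonal, for \<open>e > 0\<close>. Distance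
  from the diagonal is measured by mass, since this is the denominator to be kept away from 0; the
  two missing bounds on \<open>x\<close> and \<open>y\<close> follow from
  \<open>x < y\<close>.\<close>

definition strip :: "nat \<Rightarrow> real \<Rightarrow> (real \<times> real) set" where
  "strip n e = {(x, y). - real n \<le> x \<and> y \<le> real n \<and> e \<le> F y - F x}"

lemma strip_less: "(x, y) \<in> strip n e \<Longrightarrow> 0 < e \<Longrightarrow> x < y"
  using F_mono[of y x] by (force simp: strip_def)

lemma compact_strip: assumes "0 < e" shows "compact (strip n e)"
proof (rule compact_eq_bounded_closed[THEN iffD2], rule conjI)
  have "strip n e \<subseteq> {- real n..real n} \<times> {- real n..real n}"
    using strip_less[OF _ assms] by (fastforce simp: strip_def)
  then show "bounded (strip n e)" using bounded_subset bounded_Times bounded_closed_interval by metis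
  have "strip n e = {z. - real n \<le> fst z} \<inter> {z. snd z \<le> real n} \<inter> {z. e \<le> F (snd z) - F (fst z)}"
    by (auto simp: strip_def)
  moreover have "closed \<dots>"
    by (intro closed_Int closed_Collect_le continuous_intros continuous_on_compose2[OF smooth_continuous[OF smooth_F, of UNIV]]) auto
  ultimately show "closed (strip n e)" by simp
qed

text \<open>Two cut-offs are needed, \<open>bump\<close> at infinity and \<open>cut_inverse\<close>
  at the diagonal, where the denominator vanishes. With \<bar>W\<bar> at most \<open>C\<close>, the
  constant \<open>2 * C\<close> places the numerator between 0 and \<open>4 * C\<close>.\<close>

lemma AE_exits_interior:
  assumes M: "prob_space M" and Z: "continuous_process M Z"
    and m: "\<And>f. test_fun2 f \<Longrightarrow> martingale_from M (natural_filtration M Z) Z Eint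
          (ext_int f) (ext_int (Lstar_int a b f))" and t0: "0 \<le> t0"
  shows "AE \<omega> in M. Z t0 \<omega> \<in> Eint \<longrightarrow> (\<exists>t>t0. Z t \<omega> \<notin> Eint)"
proof -
  obtain C where C: "C \<ge> 0" "\<And>x. \<bar>W 0 x\<bar> \<le> C" using W_bounded[of 0] by auto
  define P where "P x y = 2 * C + W 0 y - W 0 x" for x y
  have P: "0 \<le> P x y" "P x y \<le> 4 * C" for x y
    using C(2)[of x] C(2)[of y] by (auto simp: P_def abs_le_iff)
  define e where "e n = 1 / (real n + 1)" for n
  have e: "0 < e n" for n by (simp add: e_def)
  have e_anti: "n \<le> n' \<Longrightarrow> e n' \<le> e n" for n n' by (simp add: e_def frac_le)
  define f where "f n x y = bump n x * bump n y * cut_inverse (e n) (F y - F x) * P x y" for n x y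
  have sf: "smooth2 (f n)" for n
    unfolding f_def[abs_def] P_def
    by (intro smooth2_mult smooth2_fst[OF smooth_bump] smooth2_snd[OF smooth_bump]
        smooth2_compose[OF smooth_cut_inverse[OF e]] smooth2_diff smooth2_add
        smooth2_fst[OF smooth_F] smooth2_snd[OF smooth_F] smooth2_fst[OF smooth_W] smooth2_snd[OF smooth_W] smooth2_const)
  \<comment> \<open>\<open>bump n\<close> vanishes outside \<open>[- (n + 2), n + 2]\<close> and
    \<open>cut_inverse (e n)\<close> up to \<open>e n / 2\<close>, so this set carries
    \<open>f n\<close>.\<close>
  define Kc where "Kc n = strip (n + 2) (e n / 2)" for n
  have Kc: "compact (Kc n)" for n unfolding Kc_def using e by (intro compact_strip) auto
  have Kc_less: "x < y" if "(x, y) \<in> Kc n" for x y n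
    using strip_less that e[of n] unfolding Kc_def by (metis half_gt_zero)
  have f0: "f n x y = 0" if "(x, y) \<notin> Kc n" for n x y
  proof -
    from that consider "x < - real (n + 2)" | "real (n + 2) < y" | "F y - F x \<le> e n / 2"
      by (force simp: Kc_def strip_def)
    then show ?thesis
    proof cases
      case 1
      then have "bump n x = 0" by (intro bump_eq_0) auto
      then show ?thesis by (simp add: f_def)
    next
      case 2
      then have "bump n y = 0" by (intro bump_eq_0) auto
      then show ?thesis by (simp add: f_def)
    next
      case 3
      then show ?thesis by (simp add: f_def cut_inverse_eq_0[OF e])
    qed
  qed
  have tf: "test_fun2 (f n)" for n
    unfolding test_fun2_def using sf Kc Kc_less f0 by (intro conjI exI[of _ "Kc n"]) auto
  have f_nonneg: "0 \<le> f n x y" for n x y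
    unfolding f_def by (intro mult_nonneg_nonneg bump_nonneg cut_inverse_nonneg e P)
  have f_supp: "(case z of (x, y) \<Rightarrow> f n x y) = 0" if "z \<notin> Kc n" for z n using f0 that by (cases z) auto
  have cf: "continuous_on S (\<lambda>(x, y). f n x y)" for S n by (rule smooth2_continuous[OF sf])
  have op: "open (- Kc n)" for n using compact_imp_closed[OF Kc] by auto
  have opx: "open {u. (u, y) \<in> - Kc n}" and opy: "open {v. (x, v) \<in> - Kc n}" for x y n
  proof -
    have "open ((\<lambda>u. (u, y)) -` (- Kc n))" "open (Pair x -` (- Kc n))"
      by (intro open_vimage op continuous_intros)+
    then show "open {u. (u, y) \<in> - Kc n}" "open {v. (x, v) \<in> - Kc n}" unfolding vimage_def by auto
  qed
  have d0: "dx h x y = 0" "dy h x y = 0"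
    if h: "\<And>x y. (x, y) \<notin> Kc n \<Longrightarrow> h x y = 0" and xy: "(x, y) \<notin> Kc n" for h n x y
    unfolding dx_def dy_def
    by (rule deriv_eq_on_open[OF opx, of x y n _ "\<lambda>_. 0"] deriv_eq_on_open[OF opy, of y x n _ "\<lambda>_. 0"];
        use h xy in simp)+
  have n0: "nabla a (f n) x y = 0" if "(x, y) \<notin> Kc n" for n x y
    using d0[OF f0 that] by (simp add: nabla_def)
  have nn0: "nabla a (nabla a (f n)) x y = 0" if "(x, y) \<notin> Kc n" for n x y
    using d0[of n "nabla a (f n)", OF n0 that] by (simp add: nabla_def)
  have L_supp: "(case z of (x, y) \<Rightarrow> Lstar_int a b (f n) x y) = 0" if "z \<notin> Kc n" for z n
    using that n0 nn0 d0[OF f0] by (cases z) (simp add: Lstar_int_def)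
  have sn: "smooth2 (nabla a h)" if "smooth2 h" for h
    unfolding nabla_def sqa_def[symmetric]
    by (intro smooth2_diff smooth2_mult smooth2_fst[OF smooth_sqa] smooth2_snd[OF smooth_sqa] smooth2_dx smooth2_dy that)
  have cL: "continuous_on (Kc n) (\<lambda>(x, y). Lstar_int a b (f n) x y)" for n
  proof -
    have c1: "continuous_on (Kc n) (\<lambda>z. h (fst z))" "continuous_on (Kc n) (\<lambda>z. h (snd z))" if "smooth h" for h
      by (rule continuous_on_compose2[OF smooth_continuous[OF that, of UNIV]]; auto intro!: continuous_intros)+
    have c2: "continuous_on (Kc n) (\<lambda>z. h (fst z) (snd z))" if "smooth2 h" for h
      using smooth2_continuous[OF that] by (simp add: case_prod_beta)
    have pos: "F (snd z) - F (fst z) \<noteq> 0" if "z \<in> Kc n" for z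
      using that e[of n] by (auto simp: Kc_def strip_def)
    have "continuous_on (Kc n) (\<lambda>z. nabla a (nabla a (f n)) (fst z) (snd z)
     + (deriv a (fst z) / 2 - b (fst z)) * dx (f n) (fst z) (snd z)
     + (deriv a (snd z) / 2 - b (snd z)) * dy (f n) (fst z) (snd z)
     + 2 * ((sqa (fst z) * \<rho> (fst z) + sqa (snd z) * \<rho> (snd z))
            / (F (snd z) - F (fst z))) * nabla a (f n) (fst z) (snd z))"
      by (intro continuous_intros c1 c2 sn sf smooth2_dx smooth2_dy smooth_deriv smooth_a smooth_b
          smooth_sqa smooth_rho smooth_F) (use pos in auto)
    moreover have "measure (mu a b) {fst z..snd z} = F (snd z) - F (fst z)" if "z \<in> Kc n" for z
      using Kc_less[of "fst z" "snd z" n] that by (intro measure_mu_Icc) auto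
    ultimately show ?thesis
      by (subst continuous_on_cong[OF refl]) (auto simp: Lstar_int_def sqa_def case_prod_beta)
  qed
  \<comment> \<open>The factor 2 leaves room for an open neighbourhood where the mass still exceeds
    \<open>e n\<close>, so that \<open>f n\<close> is the uncut quotient there.\<close>
  have L_gen: "Lstar_int a b (f n) x y = - 1" if "(x, y) \<in> strip n (2 * e n)" for n x y
  proof (rule interior_generator[where C="2 * C" and k=0])
    define U where "U = {z. - (real n + 1) < fst z} \<inter> {z. snd z < real n + 1} \<inter> {z. e n < F (snd z) - F (fst z)}"
    show "open U" unfolding U_def
      by (intro open_Int open_Collect_less continuous_intros continuous_on_compose2[OF smooth_continuous[OF smooth_F, of UNIV]]) auto
    show "(x, y) \<in> U" using that e[of n] by (auto simp: U_def strip_def)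
    show less: "u < v" if "(u, v) \<in> U" for u v
      using that F_mono[of v u] e[of n] by (force simp: U_def)
    show "f n u v = (2 * C + W 0 v - W 0 u) / (F v - F u)" if uv: "(u, v) \<in> U" for u v
    proof -
      have "bump n u = 1" "bump n v = 1" using uv less[OF uv] by (auto intro!: bump_eq_1 simp: U_def)
      moreover have "cut_inverse (e n) (F v - F u) = 1 / (F v - F u)"
        using uv by (intro cut_inverse_eq e) (auto simp: U_def)
      ultimately show ?thesis by (simp add: f_def P_def)
    qed
  qed
  define emb where "emb z = (ereal (fst z), ereal (snd z))" for z
  define K where "K n = emb ` strip n (2 * e n)" for n
  have ext_emb: "ext_int h (emb (x, y)) = h x y" if "x < y" for h x y
    using that by (auto simp: ext_int_def Eint_def emb_def)
  have strip_l: "x < y" if "(x, y) \<in> strip n (2 * e n)" for x y n using strip_less[OF that] e[of n] by simp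
  show ?thesis
  proof (rule AE_exits_region[where K=K and \<phi>="\<lambda>n. ext_int (f n)" and \<psi>="\<lambda>n. ext_int (Lstar_int a b (f n))",
        OF M Z _ _ _ _ _ _ _ _ _ _ _ _ t0])
    show "martingale_from M (natural_filtration M Z) Z Eint (ext_int (f n)) (ext_int (Lstar_int a b (f n)))" for n
      by (rule m[OF tf])
    show "ext_int (f n) \<in> borel_measurable borel" for n
      by (rule borel_ext_int[OF compact_support_bounded(2)[OF Kc cf f_supp]])
    show "0 \<le> ext_int (f n) x" for n x by (simp add: ext_int_def f_nonneg)
    show "\<exists>B. \<forall>x. ext_int (f n) x \<le> B" for n
    proof -
      obtain B where B: "\<And>z. \<bar>case z of (x, y) \<Rightarrow> f n x y\<bar> \<le> B"
        using compact_support_bounded(1)[OF Kc cf f_supp, of n] by blast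
      have "f n x y \<le> B" for x y using B[of "(x, y)"] by simp
      then have "ext_int (f n) x \<le> max B 0" for x by (auto simp: ext_int_def intro: max.coboundedI1)
      then show ?thesis by blast
    qed
    show "ext_int (Lstar_int a b (f n)) \<in> borel_measurable borel" for n
      by (rule borel_ext_int[OF compact_support_bounded(2)[OF Kc cL L_supp]])
    show "\<exists>B. \<forall>x. \<bar>ext_int (Lstar_int a b (f n)) x\<bar> \<le> B" for n
    proof -
      obtain B where B: "\<And>z. \<bar>case z of (x, y) \<Rightarrow> Lstar_int a b (f n) x y\<bar> \<le> B"
        using compact_support_bounded(1)[OF Kc cL L_supp, of n] by blast
      have "\<bar>Lstar_int a b (f n) x y\<bar> \<le> B" for x y using B[of "(x, y)"] by simp
      then have "\<bar>ext_int (Lstar_int a b (f n)) x\<bar> \<le> max B 0" for x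
        by (auto simp: ext_int_def intro: max.coboundedI1)
      then show ?thesis by blast
    qed
    show "ext_int (Lstar_int a b (f n)) x \<le> - 1" if xK: "x \<in> K n" for n x
    proof -
      obtain u v where uv: "(u, v) \<in> strip n (2 * e n)" "x = emb (u, v)" using xK by (auto simp: K_def)
      then show ?thesis by (simp add: ext_emb[OF strip_l[OF uv(1)]] L_gen)
    qed
    have "compact (K n)" for n
      unfolding K_def emb_def using e[of n]
      by (intro compact_continuous_image compact_strip continuous_on_Pair continuous_on_ereal continuous_intros) auto
    then show "closed (K n)" for n by (rule compact_imp_closed)
    show "K n \<subseteq> Eint" for n using strip_l by (auto simp: K_def emb_def Eint_def)
    show "incseq K"
    proof (rule incseq_SucI)
      have "strip n (2 * e n) \<subseteq> strip (Suc n) (2 * e (Suc n))" for n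
        using e_anti[of n "Suc n"] by (auto simp: strip_def)
      then show "K n \<subseteq> K (Suc n)" for n unfolding K_def by (rule image_mono)
    qed
    show "\<exists>B. \<forall>n\<ge>j. \<forall>x\<in>K j. ext_int (f n) x \<le> B" for j
    proof (intro exI allI impI ballI)
      fix n x assume n: "j \<le> n" and "x \<in> K j"
      then obtain u v where uv: "(u, v) \<in> strip j (2 * e j)" "x = emb (u, v)" by (auto simp: K_def)
      \<comment> \<open>As \<open>e n \<le> e j\<close>, the truncation at level \<open>e n\<close>
        is inactive on \<open>K j\<close>, and the bound involves \<open>j\<close> only.\<close>
      have h: "2 * e j \<le> F v - F u" using uv(1) by (simp add: strip_def)
      then have "e n \<le> F v - F u" using e_anti[OF n] e[of j] by linarith
      then have ci: "cut_inverse (e n) (F v - F u) = 1 / (F v - F u)" by (intro cut_inverse_eq e)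
      also have "\<dots> \<le> 1 / (2 * e j)" using h e[of j] by (intro divide_left_mono) auto
      finally have ci: "cut_inverse (e n) (F v - F u) \<le> 1 / (2 * e j)" .
      have "f n u v \<le> 1 * 1 * (1 / (2 * e j)) * (4 * C)"
        unfolding f_def using e[of j]
        by (intro mult_mono bump_le_1 ci P mult_nonneg_nonneg bump_nonneg cut_inverse_nonneg e) auto
      then show "ext_int (f n) x \<le> 1 * 1 * (1 / (2 * e j)) * (4 * C)"
        by (simp add: uv(2) ext_emb[OF strip_l[OF uv(1)]])
    qed
    show "\<exists>n. z ` {s..t} \<subseteq> K n" if st: "s \<le> t" and zc: "continuous_on {s..t} z" and zE: "z ` {s..t} \<subseteq> Eint"
      for z :: "real \<Rightarrow> ereal \<times> ereal" and s t
    proof -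
      define x where "x u = real_of_ereal (fst (z u))" for u
      define y where "y u = real_of_ereal (snd (z u))" for u
      have zxy: "z u = emb (x u, y u)" "x u < y u" if "u \<in> {s..t}" for u
      proof -
        have "z u \<in> Eint" using zE that by auto
        then show "z u = emb (x u, y u)" "x u < y u" by (auto simp: Eint_def emb_def x_def y_def)
      qed
      have xc: "continuous_on {s..t} x" and yc: "continuous_on {s..t} y"
        unfolding x_def y_def
        by (rule continuous_on_compose2[OF continuous_on_real];
            use zc zxy(1) in \<open>force intro!: continuous_intros simp: emb_def\<close>)+
      have bdd: "bounded (x ` {s..t})" "bounded (y ` {s..t})"
        by (intro compact_imp_bounded compact_continuous_image xc yc compact_Icc)+
      obtain B1 where B1: "\<And>u. u \<in> {s..t} \<Longrightarrow> \<bar>x u\<bar> \<le> B1" using bdd(1) unfolding bounded_real by blast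
      obtain B2 where B2: "\<And>u. u \<in> {s..t} \<Longrightarrow> \<bar>y u\<bar> \<le> B2" using bdd(2) unfolding bounded_real by blast
      \<comment> \<open>Over a compact time interval the mass between the endpoints attains a
        minimum \<open>d\<close>, positive since the path avoids the diagonal. Any
        \<open>n \<ge> 2 / d\<close> then satisfies \<open>2 * e n \<le> d\<close>.\<close>
      have "continuous_on {s..t} (\<lambda>u. F (y u) - F (x u))"
        by (intro continuous_intros continuous_on_compose2[OF smooth_continuous[OF smooth_F, of UNIV]] xc yc) auto
      then have "\<exists>w\<in>{s..t}. \<forall>u\<in>{s..t}. F (y w) - F (x w) \<le> F (y u) - F (x u)"
        using st by (intro continuous_attains_inf) auto
      then obtain w where w: "w \<in> {s..t}" "\<And>u. u \<in> {s..t} \<Longrightarrow> F (y w) - F (x w) \<le> F (y u) - F (x u)"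
        by blast
      define d where "d = F (y w) - F (x w)"
      have "0 < d" using F_strict[OF zxy(2)[OF w(1)]] by (simp add: d_def)
      obtain n where n: "max (max B1 B2) (2 / d) \<le> real n" using real_arch_simple by blast
      then have "2 / d \<le> real n + 1" by simp
      then have "2 * e n \<le> d" using \<open>0 < d\<close> by (simp add: e_def divide_le_eq mult.commute)
      have "z u \<in> K n" if u: "u \<in> {s..t}" for u
      proof -
        have "(x u, y u) \<in> strip n (2 * e n)"
          using B1[OF u] B2[OF u] n w(2)[OF u] \<open>2 * e n \<le> d\<close> by (auto simp: strip_def d_def abs_le_iff)
        then show ?thesis unfolding K_def zxy(1)[OF u] by (rule imageI)
      qed
      then show ?thesis by blast
    qed
  qed
qed

end

section \<open>Absorption\<close>

lemma Estar_cases: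
  assumes "z \<in> Estar" "z \<notin> Dstar"
  shows "z \<in> Eint \<or> z \<in> Eright \<or> z \<in> Eleft \<or> z = (-\<infinity>, \<infinity>)"
proof (cases z)
  case (Pair x y)
  then show ?thesis using assms
    by (cases x; cases y) (auto simp: Estar_def Dstar_def Eint_def Eright_def Eleft_def)
qed

context posrec
begin

text \<open>Each exit lemma holds almost surely for one fixed starting time, whereas a face is
  entered at a random time; it is therefore applied at all natural times at once. For the interior
  one time suffices, and time 1 is taken because the process may start on the diagonal, which it
  avoids at positive times.\<close>

lemma AE_reaches_absorbing_state:
  assumes M: "prob_space M" and Z: "dual_process a b M Z"
  shows "AE \<omega> in M. \<exists>t\<ge>0. Z t \<omega> = (-\<infinity>, \<infinity>)"
proof -
  have cp: "continuous_process M Z" and E: "\<And>\<omega> t. \<omega> \<in> space M \<Longrightarrow> 0 \<le> t \<Longrightarrow> Z t \<omega> \<in> Estar"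
    and D: "AE \<omega> in M. \<forall>t>0. Z t \<omega> \<notin> Dstar"
    and mi: "\<And>f. test_fun2 f \<Longrightarrow> martingale_from M (natural_filtration M Z) Z Eint
          (ext_int f) (ext_int (Lstar_int a b f))"
    and mr: "\<And>f. test_fun f \<Longrightarrow> martingale_from M (natural_filtration M Z) Z Eright
          (ext_right f) (ext_right (Lstar_right a b f))"
    and ml: "\<And>f. test_fun f \<Longrightarrow> martingale_from M (natural_filtration M Z) Z Eleft
          (ext_left f) (ext_left (Lstar_left a b f))"
    and st: "AE \<omega> in M. \<forall>s t. 0 \<le> s \<and> s \<le> t \<longrightarrow>
        (Z s \<omega> \<in> Eright \<longrightarrow> Z t \<omega> \<in> {-\<infinity>..<\<infinity>} \<times> {\<infinity>}) \<and>
        (Z s \<omega> \<in> Eleft \<longrightarrow> Z t \<omega> \<in> {-\<infinity>} \<times> {-\<infinity><..\<infinity>}) \<and>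
        (Z s \<omega> = (-\<infinity>, \<infinity>) \<longrightarrow> Z t \<omega> = (-\<infinity>, \<infinity>))"
    using Z unfolding dual_process_def by blast+
  have r: "AE \<omega> in M. \<forall>q::nat. Z (real q) \<omega> \<in> Eright \<longrightarrow> (\<exists>t>real q. Z t \<omega> \<notin> Eright)"
    unfolding AE_all_countable using AE_exits_right[OF M cp mr] by simp
  have l: "AE \<omega> in M. \<forall>q::nat. Z (real q) \<omega> \<in> Eleft \<longrightarrow> (\<exists>t>real q. Z t \<omega> \<notin> Eleft)"
    unfolding AE_all_countable using AE_exits_left[OF M cp ml] by simp
  have i: "AE \<omega> in M. Z 1 \<omega> \<in> Eint \<longrightarrow> (\<exists>t>1. Z t \<omega> \<notin> Eint)"
    using AE_exits_interior[OF M cp mi] by simp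
  show ?thesis
    using D st r l i AE_space
  proof eventually_elim
    case (elim \<omega>)
    have face: "\<exists>t\<ge>0. Z t \<omega> = (-\<infinity>, \<infinity>)" if t: "0 \<le> t" and f: "Z t \<omega> \<in> Eright \<or> Z t \<omega> \<in> Eleft" for t
    proof -
      \<comment> \<open>The first fact about exits is available at integer times: at time
        \<open>q\<close> the path is still on the face, and will leave it, or has already
        left.\<close>
      obtain q :: nat where q: "t \<le> real q" using real_arch_simple by blast
      then have q0: "0 \<le> real q" "\<And>u. real q < u \<Longrightarrow> t \<le> u" using t by auto
      from f show ?thesis
      proof
        assume r: "Z t \<omega> \<in> Eright"
        \<comment> \<open>After entering the right face the second coordinate stays infinite, so off
          the face the first one can only be minus infinity.\<close>
        have stay: "Z u \<omega> = (-\<infinity>, \<infinity>)" if "t \<le> u" "Z u \<omega> \<notin> Eright" for u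
        proof (cases "Z u \<omega>")
          case (Pair x y)
          have "Z u \<omega> \<in> {-\<infinity>..<\<infinity>} \<times> {\<infinity>}" using elim(2) t that(1) r by blast
          then show ?thesis using that(2) Pair by (cases x) (auto simp: Eright_def)
        qed
        show ?thesis
        proof (cases "Z (real q) \<omega> \<in> Eright")
          case True
          then obtain u where "u > real q" "Z u \<omega> \<notin> Eright" using elim(3) by blast
          then show ?thesis using stay[of u] q0 t by (intro exI[of _ u]) auto
        next
          case False
          then show ?thesis using stay[OF q] q0(1) by blast
        qed
      next
        assume l: "Z t \<omega> \<in> Eleft"
        have stay: "Z u \<omega> = (-\<infinity>, \<infinity>)" if "t \<le> u" "Z u \<omega> \<notin> Eleft" for u
        proof (cases "Z u \<omega>")
          case (Pair x y)
          have "Z u \<omega> \<in> {-\<infinity>} \<times> {-\<infinity><..\<infinity>}" using elim(2) t that(1) l by blast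
          then show ?thesis using that(2) Pair by (cases y) (auto simp: Eleft_def)
        qed
        show ?thesis
        proof (cases "Z (real q) \<omega> \<in> Eleft")
          case True
          then obtain u where "u > real q" "Z u \<omega> \<notin> Eleft" using elim(4) by blast
          then show ?thesis using stay[of u] q0 t by (intro exI[of _ u]) auto
        next
          case False
          then show ?thesis using stay[OF q] q0(1) by blast
        qed
      qed
    qed
    have "\<exists>t>0. Z t \<omega> \<notin> Eint"
    proof (cases "Z 1 \<omega> \<in> Eint")
      case True
      then obtain t where "t > 1" "Z t \<omega> \<notin> Eint" using elim(5) by blast
      then show ?thesis by (intro exI[of _ t]) auto
    qed (auto intro: exI[of _ 1])
    then obtain t where t: "t > 0" "Z t \<omega> \<notin> Eint" by blast
    then have "Z t \<omega> \<in> Eright \<or> Z t \<omega> \<in> Eleft \<or> Z t \<omega> = (-\<infinity>, \<infinity>)"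
      using Estar_cases[OF E[OF elim(6)], of t] elim(1) by auto
    then show ?case using face[OF less_imp_le[OF t(1)]] less_imp_le[OF t(1)] by blast
  qed
qed

lemma AE_tau_star_finite:
  assumes "prob_space M" "dual_process a b M Z"
  shows "AE \<omega> in M. tau_star Z \<omega> < \<infinity>"
  using AE_reaches_absorbing_state[OF assms]
proof eventually_elim
  case (elim \<omega>)
  then obtain t where "0 \<le> t" "Z t \<omega> = (-\<infinity>, \<infinity>)" by blast
  then have "tau_star Z \<omega> \<le> ereal t" unfolding tau_star_def by (intro Inf_lower) blast
  then show ?case using le_less_trans by fastforce
qed

end

section \<open>Enlarging the filtration\<close>

lemma continuous_process_Pair:
  fixes X :: "real \<Rightarrow> 'w \<Rightarrow> 'b::second_countable_topology" and Z :: "real \<Rightarrow> 'w \<Rightarrow> 'c::second_countable_topology"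
  assumes "continuous_process M X" "continuous_process M Z"
  shows "continuous_process M (\<lambda>t \<omega>. (X t \<omega>, Z t \<omega>))"
proof -
  have "(\<lambda>\<omega>. (X t \<omega>, Z t \<omega>)) \<in> borel_measurable M" if "0 \<le> t" for t
    unfolding borel_prod[symmetric]
    by (rule measurable_Pair) (use assms that in \<open>auto simp: continuous_process_def\<close>)
  then show ?thesis using assms by (auto simp: continuous_process_def intro!: continuous_on_Pair)
qed

lemma filtration_of_natural_filtration:
  assumes "continuous_process M Y"
  shows "filtration_of M (natural_filtration M Y)"
  unfolding filtration_of_def filtration_def
  using subalgebra_natural_filtration[OF assms] sets_natural_filtration_mono[of _ _ M Y] by auto

lemma sets_natural_filtration_compose:
  assumes "g \<in> borel \<rightarrow>\<^sub>M borel"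
  shows "sets (natural_filtration M (\<lambda>t \<omega>. g (Y t \<omega>)) t) \<subseteq> sets (natural_filtration M Y t)"
  unfolding natural_filtration_def sets_gen_sigma
proof (intro sigma_sets_mono' subsetI)
  fix A assume "A \<in> {(\<lambda>\<omega>. g (Y s \<omega>)) -` B \<inter> space M |s B. s \<in> {0..t} \<and> B \<in> sets borel}"
  then obtain s B where "A = Y s -` (g -` B) \<inter> space M" "s \<in> {0..t}" "B \<in> sets borel" by auto
  moreover have "g -` B \<in> sets borel" using measurable_sets[OF assms \<open>B \<in> sets borel\<close>] by simp
  ultimately show "A \<in> {Y s -` B \<inter> space M |s B. s \<in> {0..t} \<and> B \<in> sets borel}" by blast
qed

lemma sets_natural_filtration_fst:
  fixes X :: "real \<Rightarrow> 'w \<Rightarrow> 'b::second_countable_topology" and Z :: "real \<Rightarrow> 'w \<Rightarrow> 'c::second_countable_topology"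
  shows "sets (natural_filtration M X t) \<subseteq> sets (natural_filtration M (\<lambda>t \<omega>. (X t \<omega>, Z t \<omega>)) t)"
  using sets_natural_filtration_compose[of fst M "\<lambda>t \<omega>. (X t \<omega>, Z t \<omega>)" t]
  by (simp add: borel_measurable_continuous_onI continuous_on_fst)

lemma sets_natural_filtration_snd:
  fixes X :: "real \<Rightarrow> 'w \<Rightarrow> 'b::second_countable_topology" and Z :: "real \<Rightarrow> 'w \<Rightarrow> 'c::second_countable_topology"
  shows "sets (natural_filtration M Z t) \<subseteq> sets (natural_filtration M (\<lambda>t \<omega>. (X t \<omega>, Z t \<omega>)) t)"
  using sets_natural_filtration_compose[of snd M "\<lambda>t \<omega>. (X t \<omega>, Z t \<omega>)" t]
  by (simp add: borel_measurable_continuous_onI continuous_on_snd)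

text \<open>The intersections form an intersection-stable generator, the starting class for the
  Dynkin induction in \<open>cond_exp_join\<close>.\<close>

lemma sets_natural_filtration_Pair:
  fixes X :: "real \<Rightarrow> 'w \<Rightarrow> 'b::second_countable_topology" and Z :: "real \<Rightarrow> 'w \<Rightarrow> 'c::second_countable_topology"
  shows "sets (natural_filtration M (\<lambda>t \<omega>. (X t \<omega>, Z t \<omega>)) t) \<subseteq>
    sigma_sets (space M) {A \<inter> B | A B. A \<in> sets (natural_filtration M X t) \<and> B \<in> sets (natural_filtration M Z t)}"
    (is "_ \<subseteq> sigma_sets _ ?G")
proof -
  define N where "N = sigma (space M) ?G"
  have G: "?G \<subseteq> Pow (space M)"
    using sets.sets_into_space[of _ "natural_filtration M X t"] by fastforce
  have sN: "sets N = sigma_sets (space M) ?G" "space N = space M"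
    unfolding N_def using G by (auto intro: sets_measure_of simp: space_measure_of_conv)
  have X: "A \<in> sets N" if "A \<in> sets (natural_filtration M X t)" for A
  proof -
    have "A = A \<inter> space M" using sets.sets_into_space[OF that] by auto
    moreover have "space M \<in> sets (natural_filtration M Z t)"
      using sets.top[of "natural_filtration M Z t"] by simp
    ultimately show ?thesis unfolding sN using that by (intro sigma_sets.Basic) blast
  qed
  have Z: "B \<in> sets N" if "B \<in> sets (natural_filtration M Z t)" for B
  proof -
    have "B = space M \<inter> B" using sets.sets_into_space[OF that] by auto
    moreover have "space M \<in> sets (natural_filtration M X t)"
      using sets.top[of "natural_filtration M X t"] by simp
    ultimately show ?thesis unfolding sN using that by (intro sigma_sets.Basic) blast
  qed
  have "(\<lambda>\<omega>. (X s \<omega>, Z s \<omega>)) \<in> N \<rightarrow>\<^sub>M borel" if s: "0 \<le> s" "s \<le> t" for s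
  proof -
    have "X s \<in> N \<rightarrow>\<^sub>M borel"
    proof (rule measurableI)
      fix B :: "'b set" assume "B \<in> sets borel"
      from measurable_sets[OF measurable_natural_filtration[OF s, of X M] this]
      show "X s -` B \<inter> space N \<in> sets N" unfolding sN(2) by (intro X) simp
    qed simp
    moreover have "Z s \<in> N \<rightarrow>\<^sub>M borel"
    proof (rule measurableI)
      fix B :: "'c set" assume "B \<in> sets borel"
      from measurable_sets[OF measurable_natural_filtration[OF s, of Z M] this]
      show "Z s -` B \<inter> space N \<in> sets N" unfolding sN(2) by (intro Z) simp
    qed simp
    ultimately show ?thesis unfolding borel_prod[symmetric] by (rule measurable_Pair)
  qed
  note m = this
  have "sets (natural_filtration M (\<lambda>t \<omega>. (X t \<omega>, Z t \<omega>)) t) \<subseteq> sets N"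
    unfolding natural_filtration_def sets_gen_sigma sN(2)[symmetric]
  proof (rule sets.sigma_sets_subset, rule subsetI)
    fix S assume "S \<in> {(\<lambda>\<omega>. (X s \<omega>, Z s \<omega>)) -` B \<inter> space N |s B. s \<in> {0..t} \<and> B \<in> sets borel}"
    then obtain s B where "S = (\<lambda>\<omega>. (X s \<omega>, Z s \<omega>)) -` B \<inter> space N" "0 \<le> s" "s \<le> t" "B \<in> sets borel"
      by auto
    then show "S \<in> sets N" using measurable_sets[OF m] by simp
  qed
  then show ?thesis by (simp add: sN)
qed

text \<open>The hypothesis \<open>ci\<close> says that \<open>FZ\<close> and \<open>FT\<close> are conditionally independent given \<open>FX\<close>.\<close>

lemma cond_exp_join:
  fixes H :: "'w \<Rightarrow> real"
  assumes M: "prob_space M"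
    and FX: "subalgebra M FX" and FT: "subalgebra M FT" and FZ: "subalgebra M FZ" and FJ: "subalgebra M FJ"
    and XT: "sets FX \<subseteq> sets FT" and XJ: "sets FX \<subseteq> sets FJ"
    and gen: "sets FJ \<subseteq> sigma_sets (space M) {A \<inter> B | A B. A \<in> sets FX \<and> B \<in> sets FZ}"
    and ci: "\<And>B. B \<in> sets FZ \<Longrightarrow> AE \<omega> in M. real_cond_exp M FT (indicator B) \<omega> = real_cond_exp M FX (indicator B) \<omega>"
    and H: "integrable M H" "H \<in> borel_measurable FT"
  shows "AE \<omega> in M. real_cond_exp M FJ H \<omega> = real_cond_exp M FX H \<omega>"
proof -
  interpret prob_space M by fact
  interpret X: sigma_finite_subalgebra M FX by (rule sigma_finite_subalgebraI[OF M FX])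
  interpret T: sigma_finite_subalgebra M FT by (rule sigma_finite_subalgebraI[OF M FT])
  interpret J: sigma_finite_subalgebra M FJ by (rule sigma_finite_subalgebraI[OF M FJ])
  define E where "E = real_cond_exp M FX H"
  have Ei: "integrable M E" unfolding E_def by (rule X.real_cond_exp_int(1)[OF H(1)])
  have EX: "E \<in> borel_measurable FX" unfolding E_def by (rule borel_measurable_cond_exp)
  have sub: "sets FX \<subseteq> sets M" "sets FZ \<subseteq> sets M" "space FX = space M" "space FZ = space M" "space FT = space M" "space FJ = space M"
    using FX FZ FT FJ by (auto simp: subalgebra_def)
  \<comment> \<open>Since \<open>H\<close> is \<open>FT\<close>-measurable, the indicator of
    \<open>B\<close> may be replaced by its conditional expectation given \<open>FT\<close>, which
    is \<open>q\<close> by \<open>ci\<close>. As \<open>q\<close> is \<open>FX\<close>-measurable,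
    \<open>H\<close> may then be replaced by \<open>E\<close>, and finally \<open>q\<close> by the
    indicator of \<open>B\<close> again.\<close>
  have base: "(\<integral>\<omega>. indicator (A \<inter> B) \<omega> * H \<omega> \<partial>M) = (\<integral>\<omega>. indicator (A \<inter> B) \<omega> * E \<omega> \<partial>M)"
    if A: "A \<in> sets FX" and B: "B \<in> sets FZ" for A B
  proof -
    have AM[measurable]: "A \<in> sets M" and BM[measurable]: "B \<in> sets M" using A B sub by auto
    define q where "q = real_cond_exp M FX (indicator B)"
    have qX: "q \<in> borel_measurable FX" unfolding q_def by (rule borel_measurable_cond_exp)
    have iB: "integrable M (indicator B :: 'w \<Rightarrow> real)" using BM by (simp add: emeasure_eq_measure)
    have AH: "integrable M (\<lambda>\<omega>. indicator A \<omega> * H \<omega>)" using integrable_mult_indicator[OF AM H(1)] by simp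
    have AE: "integrable M (\<lambda>\<omega>. indicator A \<omega> * E \<omega>)" using integrable_mult_indicator[OF AM Ei] by simp
    have mB: "integrable M (\<lambda>\<omega>. f \<omega> * indicator B \<omega>)" if "integrable M f" for f :: "'w \<Rightarrow> real"
      using integrable_mult_indicator[OF BM that] by (simp add: mult.commute)
    have AHT: "(\<lambda>\<omega>. indicator A \<omega> * H \<omega>) \<in> borel_measurable FT"
      using A XT H(2) by (intro borel_measurable_times borel_measurable_indicator) auto
    have AEX: "(\<lambda>\<omega>. indicator A \<omega> * E \<omega>) \<in> borel_measurable FX"
      using A EX by (intro borel_measurable_times borel_measurable_indicator)
    have AqX: "(\<lambda>\<omega>. indicator A \<omega> * q \<omega>) \<in> borel_measurable FX"
      using A qX by (intro borel_measurable_times borel_measurable_indicator)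
    have aeq: "AE \<omega> in M. real_cond_exp M FT (indicator B) \<omega> = q \<omega>" unfolding q_def by (rule ci[OF B])
    note t1 = T.real_cond_exp_intg[OF mB[OF AH] AHT borel_measurable_indicator[OF BM]]
    have meas: "(\<lambda>\<omega>. (indicator A \<omega> * H \<omega>) * q \<omega>) \<in> borel_measurable M"
      using measurable_from_subalg[OF FT AHT] measurable_from_subalg[OF FX qX] by (rule borel_measurable_times)
    have int: "integrable M (\<lambda>\<omega>. (indicator A \<omega> * H \<omega>) * q \<omega>)"
      by (rule integrable_cong_AE_imp[OF t1(1) meas]) (use aeq in auto)
    have "(\<integral>\<omega>. indicator (A \<inter> B) \<omega> * H \<omega> \<partial>M) = (\<integral>\<omega>. (indicator A \<omega> * H \<omega>) * indicator B \<omega> \<partial>M)"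
      by (simp add: indicator_inter_arith ac_simps)
    also have "\<dots> = (\<integral>\<omega>. (indicator A \<omega> * H \<omega>) * real_cond_exp M FT (indicator B) \<omega> \<partial>M)"
      by (rule t1(2)[symmetric])
    also have "\<dots> = (\<integral>\<omega>. (indicator A \<omega> * H \<omega>) * q \<omega> \<partial>M)"
      by (rule integral_cong_AE) (use t1(1) meas aeq in auto)
    also have "\<dots> = (\<integral>\<omega>. (indicator A \<omega> * q \<omega>) * H \<omega> \<partial>M)" by (simp add: ac_simps)
    also have "\<dots> = (\<integral>\<omega>. (indicator A \<omega> * q \<omega>) * E \<omega> \<partial>M)"
      unfolding E_def
      by (rule X.real_cond_exp_intg(2)[symmetric]) (use int AqX H(1) in \<open>auto simp: ac_simps\<close>)
    also have "\<dots> = (\<integral>\<omega>. (indicator A \<omega> * E \<omega>) * q \<omega> \<partial>M)" by (simp add: ac_simps)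
    also have "\<dots> = (\<integral>\<omega>. (indicator A \<omega> * E \<omega>) * indicator B \<omega> \<partial>M)"
      unfolding q_def
      by (rule X.real_cond_exp_intg(2)[OF mB[OF AE] AEX borel_measurable_indicator[OF BM]])
    also have "\<dots> = (\<integral>\<omega>. indicator (A \<inter> B) \<omega> * E \<omega> \<partial>M)"
      by (simp add: indicator_inter_arith ac_simps)
    finally show ?thesis .
  qed
  let ?G = "{A \<inter> B | A B. A \<in> sets FX \<and> B \<in> sets FZ}"
  have Gs: "?G \<subseteq> Pow (space M)" using sets.sets_into_space[of _ FX] sub by fastforce
  have GM: "?G \<subseteq> sets M" using sub by blast
  have iI: "integrable M (\<lambda>\<omega>. indicator S \<omega> * f \<omega>)" if "S \<in> sets M" "integrable M f" for S and f :: "'w \<Rightarrow> real"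
    using integrable_mult_indicator[OF that] by simp
  have stable: "Int_stable ?G"
  proof (rule Int_stableI)
    fix S S' assume "S \<in> ?G" "S' \<in> ?G"
    then obtain A B A' B' where AB: "S = A \<inter> B" "S' = A' \<inter> B'" "A \<in> sets FX" "A' \<in> sets FX" "B \<in> sets FZ" "B' \<in> sets FZ"
      by blast
    then have "S \<inter> S' = (A \<inter> A') \<inter> (B \<inter> B')" "A \<inter> A' \<in> sets FX" "B \<inter> B' \<in> sets FZ" by auto
    then show "S \<inter> S' \<in> ?G" by blast
  qed
  have eq: "(\<integral>\<omega>. indicator S \<omega> * H \<omega> \<partial>M) = (\<integral>\<omega>. indicator S \<omega> * E \<omega> \<partial>M)" if "S \<in> sets FJ" for S
  proof -
    have "S \<in> sigma_sets (space M) ?G" using gen that by blast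
    from stable Gs this show ?thesis
    proof (induction rule: sigma_sets_induct_disjoint)
      case (basic S)
      then show ?case using base by blast
    next
      case empty
      then show ?case by simp
    next
      case (compl S)
      have S: "S \<in> sets M" using compl(1) GM sets.sigma_sets_subset by blast
      have "space M \<in> sets FX" "space M \<in> sets FZ" using sub sets.top by metis+
      from base[OF this] have full: "(\<integral>\<omega>. H \<omega> \<partial>M) = (\<integral>\<omega>. E \<omega> \<partial>M)"
        by (simp add: E_def X.real_cond_exp_int(2)[OF H(1)])
      have c: "(\<integral>\<omega>. indicator (space M - S) \<omega> * f \<omega> \<partial>M) = (\<integral>\<omega>. f \<omega> \<partial>M) - (\<integral>\<omega>. indicator S \<omega> * f \<omega> \<partial>M)"
        if "integrable M f" for f :: "'w \<Rightarrow> real"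
      proof -
        have "(\<integral>\<omega>. indicator (space M - S) \<omega> * f \<omega> \<partial>M) = (\<integral>\<omega>. f \<omega> - indicator S \<omega> * f \<omega> \<partial>M)"
          by (intro Bochner_Integration.integral_cong refl) (auto simp: indicator_def)
        also have "\<dots> = (\<integral>\<omega>. f \<omega> \<partial>M) - (\<integral>\<omega>. indicator S \<omega> * f \<omega> \<partial>M)"
          by (rule Bochner_Integration.integral_diff[OF that iI[OF S that]])
        finally show ?thesis .
      qed
      show ?case unfolding c[OF H(1)] c[OF Ei] full compl(2) ..
    next
      case (union S)
      have S: "S n \<in> sets M" for n using union(2) GM sets.sigma_sets_subset by blast
      have u: "(\<integral>\<omega>. indicator (\<Union>n. S n) \<omega> * f \<omega> \<partial>M) = (\<Sum>n. \<integral>\<omega>. indicator (S n) \<omega> * f \<omega> \<partial>M)"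
        if f: "integrable M f" for f :: "'w \<Rightarrow> real"
      proof -
        have "set_integrable M (\<Union>n. S n) f"
          using iI[OF _ f, of "\<Union>n. S n"] S by (simp add: set_integrable_def sets.countable_UN)
        from lebesgue_integral_countable_add[OF S _ this] union(1)
        show ?thesis by (simp add: set_lebesgue_integral_def disjoint_family_on_def)
      qed
      show ?case unfolding u[OF H(1)] u[OF Ei] union(3) ..
    qed
  qed
  show ?thesis
    unfolding E_def[symmetric]
  proof (rule J.real_cond_exp_charact)
    show "(LINT \<omega>:S|M. H \<omega>) = (LINT \<omega>:S|M. E \<omega>)" if "S \<in> sets FJ" for S
      using eq[OF that] by (simp add: set_lebesgue_integral_def)
    show "E \<in> borel_measurable FJ"
      using EX XJ sub by (auto simp: measurable_def)
  qed (rule H(1) Ei)+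
qed

text \<open>The process is a pointwise limit of its time discretisations, which makes it jointly
  measurable with respect to the \<open>\<sigma>\<close>-algebra it generates.\<close>

lemma borel_measurable_time_integral:
  fixes X :: "real \<Rightarrow> 'w \<Rightarrow> real" and g :: "real \<Rightarrow> real"
  assumes X: "continuous_process M X" and g: "g \<in> borel_measurable borel" and s: "0 \<le> s"
  shows "(\<lambda>\<omega>. LINT u:{s..t}|lborel. g (X u \<omega>)) \<in> borel_measurable (gen_sigma M X {0..})"
proof -
  let ?N = "gen_sigma M X {0..}"
  \<comment> \<open>Rounding leaves countably many times, so joint measurability reduces to that of
    single coordinates; \<open>max 0\<close> keeps to the times at which the process is
    controlled.\<close>
  define Y where "Y n = (\<lambda>(\<omega>, u). X (max 0 (of_int \<lceil>u * real (Suc n)\<rceil> / real (Suc n))) \<omega>)" for n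
  have X_measurable: "X r \<in> borel_measurable ?N" if "0 \<le> r" for r using that by (intro measurable_gen_sigma) auto
  have Ym: "Y n \<in> borel_measurable (?N \<Otimes>\<^sub>M lborel)" for n
  proof -
    have "(\<lambda>p. X (max 0 (of_int \<lceil>snd p * real (Suc n)\<rceil> / real (Suc n))) (fst p)) \<in> borel_measurable (?N \<Otimes>\<^sub>M lborel)"
    proof (rule measurable_compose_countable[where f="\<lambda>(i::int) p. X (max 0 (of_int i / real (Suc n))) (fst p)"])
      show "(\<lambda>p. X (max 0 (of_int i / real (Suc n))) (fst p)) \<in> borel_measurable (?N \<Otimes>\<^sub>M lborel)" for i :: int
        by (rule measurable_compose[OF measurable_fst X_measurable]) simp
      show "(\<lambda>p. \<lceil>snd p * real (Suc n)\<rceil>) \<in> ?N \<Otimes>\<^sub>M lborel \<rightarrow>\<^sub>M count_space UNIV"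
        by measurable
    qed
    then show ?thesis by (simp add: Y_def case_prod_beta)
  qed
  have "(\<lambda>(\<omega>, u). X (max 0 u) \<omega>) \<in> borel_measurable (?N \<Otimes>\<^sub>M lborel)"
  proof (rule borel_measurable_LIMSEQ_metric[OF Ym])
    fix p :: "'w \<times> real" assume "p \<in> space (?N \<Otimes>\<^sub>M lborel)"
    then obtain \<omega> u where p: "p = (\<omega>, u)" "\<omega> \<in> space M" by (auto simp: space_pair_measure)
    have "(\<lambda>n. of_int \<lceil>u * real (Suc n)\<rceil> / real (Suc n)) \<longlonglongrightarrow> u"
    proof (rule tendsto_sandwich)
      show "\<forall>\<^sub>F n in sequentially. u \<le> of_int \<lceil>u * real (Suc n)\<rceil> / real (Suc n)"
        by (intro always_eventually allI) (simp add: le_divide_eq del: of_nat_Suc)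
      have "of_int \<lceil>u * real (Suc n)\<rceil> / real (Suc n) \<le> u + 1 / real (Suc n)" for n
      proof -
        have "of_int \<lceil>u * real (Suc n)\<rceil> / real (Suc n) \<le> (u * real (Suc n) + 1) / real (Suc n)"
          by (intro divide_right_mono of_int_ceiling_le_add_one) auto
        also have "\<dots> = u + 1 / real (Suc n)" by (simp add: add_divide_distrib del: of_nat_Suc)
        finally show ?thesis .
      qed
      then show "\<forall>\<^sub>F n in sequentially. of_int \<lceil>u * real (Suc n)\<rceil> / real (Suc n) \<le> u + 1 / real (Suc n)"
        by simp
      have "(\<lambda>n. u + 1 / real (Suc n)) \<longlonglongrightarrow> u + 0"
        by (intro tendsto_intros LIMSEQ_Suc[OF lim_1_over_n])
      then show "(\<lambda>n. u + 1 / real (Suc n)) \<longlonglongrightarrow> u" by simp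
    qed simp
    then have "(\<lambda>n. max 0 (of_int \<lceil>u * real (Suc n)\<rceil> / real (Suc n))) \<longlonglongrightarrow> max 0 u"
      by (intro tendsto_intros)
    moreover have "continuous_on {0..} (\<lambda>t. X t \<omega>)" using X p(2) by (simp add: continuous_process_def)
    ultimately have "(\<lambda>n. X (max 0 (of_int \<lceil>u * real (Suc n)\<rceil> / real (Suc n))) \<omega>) \<longlonglongrightarrow> X (max 0 u) \<omega>"
      by (intro continuous_on_tendsto_compose[of "{0..}" "\<lambda>t. X t \<omega>"]) auto
    then show "(\<lambda>n. Y n p) \<longlonglongrightarrow> (case p of (\<omega>, u) \<Rightarrow> X (max 0 u) \<omega>)" by (simp add: p Y_def)
  qed
  from measurable_compose[OF this g]
  have gm: "(\<lambda>p. g (X (max 0 (snd p)) (fst p))) \<in> borel_measurable (?N \<Otimes>\<^sub>M lborel)"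
    by (simp add: case_prod_beta)
  have "(\<lambda>p. indicator {s..t} (snd p) * g (X (max 0 (snd p)) (fst p))) \<in> borel_measurable (?N \<Otimes>\<^sub>M lborel)"
    by (intro borel_measurable_times gm) measurable
  then have "(\<lambda>\<omega>. \<integral>u. indicator {s..t} u * g (X (max 0 u) \<omega>) \<partial>lborel) \<in> borel_measurable ?N"
    by (intro lborel.borel_measurable_lebesgue_integral) (simp add: case_prod_beta)
  moreover have "(LINT u:{s..t}|lborel. g (X u \<omega>)) = (\<integral>u. indicator {s..t} u * g (X (max 0 u) \<omega>) \<partial>lborel)" for \<omega>
    unfolding set_lebesgue_integral_def using s
    by (intro Bochner_Integration.integral_cong) (auto simp: indicator_def max_def)
  ultimately show ?thesis by simp
qed

text \<open>The Markov property and the martingale problem both prescribe conditional expectations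
  of functionals of the trajectory of \<open>X\<close>. By \<open>cond_exp_join\<close> these do not
  change when the past of \<open>Z\<close> is added to the past of \<open>X\<close>; for the
  martingale problem this needs the time integral to be measurable with respect to \<open>X\<close>
  alone.\<close>

lemma diffusion_enlarge:
  fixes X :: "real \<Rightarrow> 'w \<Rightarrow> real" and Z :: "real \<Rightarrow> 'w \<Rightarrow> 'c::second_countable_topology"
  assumes M: "prob_space M" and sa: "smooth a" "smooth b"
    and X: "diffusion a b M (natural_filtration M X) X" and Z: "continuous_process M Z"
    and ci: "\<And>t B. 0 \<le> t \<Longrightarrow> B \<in> sets (natural_filtration M Z t) \<Longrightarrow>
        AE \<omega> in M. real_cond_exp M (gen_sigma M X {0..}) (indicator B) \<omega>
                  = real_cond_exp M (natural_filtration M X t) (indicator B) \<omega>"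
  shows "diffusion a b M (natural_filtration M (\<lambda>t \<omega>. (X t \<omega>, Z t \<omega>))) X"
proof -
  interpret prob_space M by fact
  let ?J = "natural_filtration M (\<lambda>t \<omega>. (X t \<omega>, Z t \<omega>))" and ?X = "natural_filtration M X"
  let ?T = "gen_sigma M X {0..}"
  have cX: "continuous_process M X" using X by (simp add: diffusion_def)
  have sT: "subalgebra M ?T" using cX by (intro subalgebra_gen_sigma) (auto simp: continuous_process_def)
  have join: "AE \<omega> in M. real_cond_exp M (?J s) H \<omega> = real_cond_exp M (?X s) H \<omega>"
    if "0 \<le> s" "integrable M H" "H \<in> borel_measurable ?T" for s H
  proof (rule cond_exp_join[OF M subalgebra_natural_filtration[OF cX] sT subalgebra_natural_filtration[OF Z]
        subalgebra_natural_filtration[OF continuous_process_Pair[OF cX Z]]])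
    show "sets (?X s) \<subseteq> sets ?T" unfolding natural_filtration_def by (intro sets_gen_sigma_mono) auto
    show "sets (?X s) \<subseteq> sets (?J s)" by (rule sets_natural_filtration_fst)
    show "sets (?J s) \<subseteq> sigma_sets (space M)
        {A \<inter> B | A B. A \<in> sets (?X s) \<and> B \<in> sets (natural_filtration M Z s)}"
      by (rule sets_natural_filtration_Pair)
  qed (use that ci in auto)
  have XT: "X r \<in> borel_measurable ?T" if "0 \<le> r" for r using that by (intro measurable_gen_sigma) auto
  have "markov_process M ?J X"
  proof -
    obtain P :: "real \<Rightarrow> real \<Rightarrow> real measure" where P: "\<forall>t\<ge>0. P t \<in> borel \<rightarrow>\<^sub>M prob_algebra borel"
      "\<And>s t B. 0 \<le> s \<Longrightarrow> 0 \<le> t \<Longrightarrow> B \<in> sets borel \<Longrightarrow>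
         AE \<omega> in M. real_cond_exp M (?X s) (\<lambda>\<omega>'. indicator B (X (s + t) \<omega>')) \<omega> = measure (P t (X s \<omega>)) B"
      using X unfolding diffusion_def markov_process_def by blast
    have "AE \<omega> in M. real_cond_exp M (?J s) (\<lambda>\<omega>'. indicator B (X (s + t) \<omega>')) \<omega> = measure (P t (X s \<omega>)) B"
      if st: "0 \<le> s" "0 \<le> t" "B \<in> sets borel" for s t B
    proof -
      have m: "(\<lambda>\<omega>'. indicator B (X (s + t) \<omega>') :: real) \<in> borel_measurable ?T"
        by (rule measurable_compose[OF XT borel_measurable_indicator]) (use st in auto)
      have "integrable M (\<lambda>\<omega>'. indicator B (X (s + t) \<omega>') :: real)"
        by (rule integrable_const_bound[where B=1]) (use measurable_from_subalg[OF sT m] in auto)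
      from join[OF st(1) this m] P(2)[OF st] show ?thesis by eventually_elim simp
    qed
    moreover have "X t \<in> borel_measurable (?J t)" if "0 \<le> t" for t
      using measurable_compose[OF measurable_natural_filtration[OF that order_refl, of "\<lambda>t \<omega>. (X t \<omega>, Z t \<omega>)" M], of fst borel]
      by (simp add: borel_measurable_continuous_onI continuous_on_fst)
    ultimately show ?thesis unfolding markov_process_def using P(1) by blast
  qed
  moreover have "martingale_from M ?J X UNIV f (L_gen a b f)" if f: "test_fun f" for f
  proof -
    have sf: "smooth f" using f by (simp add: test_fun_def)
    have "smooth (L_gen a b f)"
      unfolding L_gen_def[abs_def] by (intro smooth_add smooth_mult sa smooth_deriv sf)
    then have gm: "L_gen a b f \<in> borel_measurable borel" and fm: "f \<in> borel_measurable borel"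
      using sf by (auto intro: borel_measurable_continuous_onI smooth_continuous)
    have mX: "martingale_from M ?X X UNIV f (L_gen a b f)" using X f by (simp add: diffusion_def)
    show ?thesis
      unfolding martingale_from_def Let_def
    proof (intro allI impI)
      fix s t :: real assume st: "0 \<le> s \<and> s \<le> t"
      define D where "D \<omega> = f (X t \<omega>) - f (X s \<omega>) - (LINT u:{s..t}|lborel. L_gen a b f (X u \<omega>))" for \<omega>
      have D: "integrable M D" "AE \<omega> in M. X s \<omega> \<in> UNIV \<longrightarrow> real_cond_exp M (?X s) D \<omega> = 0"
        using mX st unfolding martingale_from_def Let_def D_def by blast+
      have "D \<in> borel_measurable ?T"
        unfolding D_def using st
        by (intro borel_measurable_diff borel_measurable_time_integral[OF cX gm] measurable_compose[OF XT fm]) auto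
      from join[OF conjunct1[OF st] D(1) this] D(2)
      have "AE \<omega> in M. X s \<omega> \<in> UNIV \<longrightarrow> real_cond_exp M (?J s) D \<omega> = 0"
        by eventually_elim simp
      with D(1) show "integrable M (\<lambda>\<omega>. f (X t \<omega>) - f (X s \<omega>) - (LINT u:{s..t}|lborel. L_gen a b f (X u \<omega>))) \<and>
         (AE \<omega> in M. X s \<omega> \<in> UNIV \<longrightarrow> real_cond_exp M (?J s)
           (\<lambda>\<omega>. f (X t \<omega>) - f (X s \<omega>) - (LINT u:{s..t}|lborel. L_gen a b f (X u \<omega>))) \<omega> = 0)"
        unfolding D_def by blast
    qed
  qed
  ultimately show ?thesis using cX by (simp add: diffusion_def)
qed

section \<open>The absorption time as a stopping time\<close>

text \<open>By continuity the times in \<open>[0, s]\<close> spent at the corner form a compact set,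
  so the infimum is a minimum.\<close>

lemma tau_star_attained:
  assumes c: "continuous_on {0..} (\<lambda>t. Z t \<omega>)" and s: "0 \<le> s" "Z s \<omega> = (-\<infinity>, \<infinity>)"
  obtains r where "0 \<le> r" "r \<le> s" "Z r \<omega> = (-\<infinity>, \<infinity>)" "tau_star Z \<omega> = ereal r"
proof -
  define C where "C = {0..s} \<inter> (\<lambda>t. Z t \<omega>) -` {(-\<infinity>, \<infinity>)}"
  have "closed C" unfolding C_def
    by (intro continuous_closed_preimage continuous_on_subset[OF c]) auto
  moreover have "C = {0..s} \<inter> C" by (auto simp: C_def)
  ultimately have "compact C" by (metis compact_Icc compact_Int_closed)
  moreover have "C \<noteq> {}" using s by (auto simp: C_def)
  ultimately obtain r where r: "r \<in> C" "\<And>t. t \<in> C \<Longrightarrow> r \<le> t" using compact_attains_inf by metis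
  have "tau_star Z \<omega> = ereal r"
    unfolding tau_star_def
  proof (rule Inf_eqI)
    show "y \<le> ereal r" if "\<And>i. i \<in> {ereal t |t. 0 \<le> t \<and> Z t \<omega> = (-\<infinity>, \<infinity>)} \<Longrightarrow> y \<le> i" for y
      using that r(1) by (auto simp: C_def)
    fix i assume "i \<in> {ereal t |t. 0 \<le> t \<and> Z t \<omega> = (-\<infinity>, \<infinity>)}"
    then obtain t where t: "i = ereal t" "0 \<le> t" "Z t \<omega> = (-\<infinity>, \<infinity>)" by auto
    show "ereal r \<le> i"
    proof (cases "t \<le> s")
      case True
      then show ?thesis using t r(2)[of t] by (simp add: C_def)
    next
      case False
      then show ?thesis using t r(1) by (simp add: C_def)
    qed
  qed
  then show ?thesis using that r(1) by (auto simp: C_def)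
qed

lemma tau_star_le_iff:
  assumes c: "continuous_on {0..} (\<lambda>t. Z t \<omega>)"
  shows "tau_star Z \<omega> \<le> ereal t \<longleftrightarrow> (\<exists>s\<in>{0..t}. Z s \<omega> = (-\<infinity>, \<infinity>))"
proof
  assume "\<exists>s\<in>{0..t}. Z s \<omega> = (-\<infinity>, \<infinity>)"
  then obtain s where "0 \<le> s" "s \<le> t" "Z s \<omega> = (-\<infinity>, \<infinity>)" by auto
  then have "tau_star Z \<omega> \<le> ereal s" unfolding tau_star_def by (intro Inf_lower) blast
  also have "\<dots> \<le> ereal t" using \<open>s \<le> t\<close> by simp
  finally show "tau_star Z \<omega> \<le> ereal t" .
next
  assume le: "tau_star Z \<omega> \<le> ereal t"
  have "{ereal t |t. 0 \<le> t \<and> Z t \<omega> = (-\<infinity>, \<infinity>)} \<noteq> {}"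
  proof
    assume "{ereal t |t. 0 \<le> t \<and> Z t \<omega> = (-\<infinity>, \<infinity>)} = {}"
    then have "tau_star Z \<omega> = \<infinity>" unfolding tau_star_def by (simp only: Inf_empty top_ereal_def)
    with le show False by simp
  qed
  then obtain s where s: "0 \<le> s" "Z s \<omega> = (-\<infinity>, \<infinity>)" by auto
  obtain r where r: "0 \<le> r" "Z r \<omega> = (-\<infinity>, \<infinity>)" "tau_star Z \<omega> = ereal r"
    by (rule tau_star_attained[where Z=Z, OF c s])
  then have "r \<le> t" using le by simp
  with r show "\<exists>s\<in>{0..t}. Z s \<omega> = (-\<infinity>, \<infinity>)" by auto
qed

lemma tau_star_nonneg: "0 \<le> tau_star Z \<omega>"
  unfolding tau_star_def by (intro Inf_greatest) auto

text \<open>Approaching the corner at grid times: the open sets \<open>U n\<close> shrink to the corner, and so do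
  their closures.\<close>

lemma reaches_corner_iff_grid:
  fixes z :: "real \<Rightarrow> ereal \<times> ereal"
  assumes z: "continuous_on UNIV z" and t: "0 < t"
  defines "U \<equiv> \<lambda>n::nat. {w :: ereal \<times> ereal. fst w < ereal (- real n) \<and> ereal (real n) < snd w}"
  shows "(\<exists>s\<in>{0..t}. z s = (-\<infinity>, \<infinity>)) \<longleftrightarrow> (\<forall>n. \<exists>N. \<exists>k\<in>{..Suc N}. z (grid 0 t (Suc N) k) \<in> U n)"
proof
  assume "\<exists>s\<in>{0..t}. z s = (-\<infinity>, \<infinity>)"
  then obtain s where s: "s \<in> {0..0 + t}" "z s = (-\<infinity>, \<infinity>)" by auto
  show "\<forall>n. \<exists>N. \<exists>k\<in>{..Suc N}. z (grid 0 t (Suc N) k) \<in> U n"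
  proof
    fix n
    have "open (U n)" unfolding U_def
      by (intro open_Collect_conj open_Collect_less continuous_intros)
    then have "closed (- U n)" by auto
    from path_grid_leaves[OF z this t s(1), rule_format, of 1] s(2)
    obtain N p where "p \<le> Suc N" "z (grid 0 t (Suc N) p) \<notin> - U n" by (auto simp: U_def)
    then show "\<exists>N. \<exists>k\<in>{..Suc N}. z (grid 0 t (Suc N) k) \<in> U n" by auto
  qed
next
  assume g: "\<forall>n. \<exists>N. \<exists>k\<in>{..Suc N}. z (grid 0 t (Suc N) k) \<in> U n"
  define V where "V n = {w :: ereal \<times> ereal. fst w \<le> ereal (- real n) \<and> ereal (real n) \<le> snd w}" for n
  define C where "C n = {0..t} \<inter> z -` V n" for n
  have V: "closed (V n)" for n unfolding V_def
    by (intro closed_Collect_conj closed_Collect_le continuous_intros)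
  have C: "compact (C n)" for n
    unfolding C_def by (intro compact_Int_closed compact_Icc closed_vimage V z)
  have ne: "C n \<noteq> {}" for n
  proof -
    obtain N k where k: "k \<le> Suc N" "z (grid 0 t (Suc N) k) \<in> U n"
      using g[rule_format, of n] by auto
    then have "grid 0 t (Suc N) k \<in> {0..t}"
      using grid_mono[of t 0 k 0 "Suc N"] grid_mono[of t k "Suc N" 0 "Suc N"] t by (auto simp: grid_N)
    then show ?thesis using k(2) by (auto simp: C_def V_def U_def)
  qed
  have mono: "C n \<subseteq> C m" if "m \<le> n" for m n
    using that by (auto simp: C_def V_def elim: order_trans[rotated] order_trans)
  have "(\<Inter>n. C n) \<noteq> {}" by (rule compact_nest[OF C ne mono])
  then obtain s where s: "\<And>n. s \<in> C n" by auto
  have "fst (z s) = -\<infinity>"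
  proof (rule ereal_bot)
    fix B :: real
    obtain n :: nat where "- B \<le> real n" using real_arch_simple by blast
    then have "ereal (- real n) \<le> ereal B" by simp
    moreover have "fst (z s) \<le> ereal (- real n)" using s[of n] by (simp add: C_def V_def)
    ultimately show "fst (z s) \<le> ereal B" by (rule order_trans[rotated])
  qed
  moreover have "snd (z s) = \<infinity>"
  proof (rule ereal_top)
    fix B :: real
    obtain n :: nat where "B \<le> real n" using real_arch_simple by blast
    then have "ereal B \<le> ereal (real n)" by simp
    moreover have "ereal (real n) \<le> snd (z s)" using s[of n] by (simp add: C_def V_def)
    ultimately show "ereal B \<le> snd (z s)" by (rule order_trans)
  qed
  ultimately have "z s = (-\<infinity>, \<infinity>)" by (simp add: prod_eq_iff)
  then show "\<exists>s\<in>{0..t}. z s = (-\<infinity>, \<infinity>)" using s[of 0] by (auto simp: C_def)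
qed

text \<open>The grid criterion expresses the event through countably many coordinates at times up to
  \<open>t\<close>, hence within the uncompleted natural filtration of \<open>Z\<close>.\<close>

lemma tau_star_stopping:
  assumes Z: "continuous_process M Z" and t: "0 \<le> t"
  shows "{\<omega> \<in> space M. tau_star Z \<omega> \<le> ereal t} \<in> sets (natural_filtration M Z t)"
proof -
  have c: "continuous_on {0..} (\<lambda>t. Z t \<omega>)" if "\<omega> \<in> space M" for \<omega>
    using Z that by (simp add: continuous_process_def)
  have meas: "{\<omega> \<in> space M. Z s \<omega> \<in> S} \<in> sets (natural_filtration M Z t)" if "0 \<le> s" "s \<le> t" "S \<in> sets borel" for s S
    using measurable_sets[OF measurable_natural_filtration[OF that(1,2), of Z M] that(3)]
    by (simp add: vimage_def Int_def conj_commute)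
  show ?thesis
  \<comment> \<open>The grid criterion requires a positive length; at time 0 the event just says
    that \<open>Z\<close> starts at the corner.\<close>
  proof (cases "t = 0")
    case True
    have "{\<omega> \<in> space M. tau_star Z \<omega> \<le> ereal t} = {\<omega> \<in> space M. Z 0 \<omega> \<in> {(-\<infinity>, \<infinity>)}}"
      using tau_star_le_iff[of Z _ t, OF c] True by auto
    also have "\<dots> \<in> sets (natural_filtration M Z t)" using t by (intro meas) auto
    finally show ?thesis .
  next
    case False
    then have t: "0 < t" using t by simp
    define U where "U n = {w :: ereal \<times> ereal. fst w < ereal (- real n) \<and> ereal (real n) < snd w}" for n :: nat
    have U: "U n \<in> sets borel" for n
      unfolding U_def by (intro borel_open open_Collect_conj open_Collect_less continuous_intros)
    have g: "0 \<le> grid 0 t (Suc N) k" for N k using grid_mono[of t 0 k 0 "Suc N"] t by simp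
    have g': "grid 0 t (Suc N) k \<le> t" if "k \<le> Suc N" for N k
      using grid_mono[OF less_imp_le[OF t] that, of 0 "Suc N"] by (simp add: grid_N)
    have "tau_star Z \<omega> \<le> ereal t \<longleftrightarrow> (\<forall>n. \<exists>N. \<exists>k\<in>{..Suc N}. Z (grid 0 t (Suc N) k) \<omega> \<in> U n)"
      if \<omega>: "\<omega> \<in> space M" for \<omega>
    proof -
      have zc: "continuous_on UNIV (\<lambda>u. Z (max 0 u) \<omega>)"
        by (rule continuous_on_compose2[OF c[OF \<omega>]]) (auto intro!: continuous_intros)
      have "tau_star Z \<omega> \<le> ereal t \<longleftrightarrow> (\<exists>s\<in>{0..t}. Z (max 0 s) \<omega> = (-\<infinity>, \<infinity>))"
        unfolding tau_star_le_iff[where Z=Z, OF c[OF \<omega>]] by (intro bex_cong refl) (auto simp: max_def)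
      also have "\<dots> \<longleftrightarrow> (\<forall>n. \<exists>N. \<exists>k\<in>{..Suc N}. Z (max 0 (grid 0 t (Suc N) k)) \<omega> \<in> U n)"
        unfolding U_def by (rule reaches_corner_iff_grid[OF zc t])
      also have "\<dots> \<longleftrightarrow> (\<forall>n. \<exists>N. \<exists>k\<in>{..Suc N}. Z (grid 0 t (Suc N) k) \<omega> \<in> U n)"
        by (simp only: max_absorb2[OF g])
      finally show ?thesis .
    qed
    then have "{\<omega> \<in> space M. tau_star Z \<omega> \<le> ereal t} =
        {\<omega> \<in> space (natural_filtration M Z t). \<forall>n. \<exists>N. \<exists>k\<in>{..Suc N}. Z (grid 0 t (Suc N) k) \<omega> \<in> U n}"
      by auto
    also have "\<dots> \<in> sets (natural_filtration M Z t)"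
      by (intro sets.sets_Collect_countable_All sets.sets_Collect_countable_Ex sets.sets_Collect_finite_Ex)
         (auto intro!: meas g g' U)
    finally show ?thesis .
  qed
qed

text \<open>On the event that the absorption time is at most \<open>t\<close>, it coincides with its
  minimum with \<open>t\<close>, and this minimum is measurable at time \<open>t\<close>.\<close>

lemma tau_star_event:
  assumes Z: "continuous_process M Z" and t: "0 \<le> t" and T: "T \<in> sets borel"
  shows "{\<omega> \<in> space M. tau_star Z \<omega> \<le> ereal t \<and> tau_star Z \<omega> \<in> T} \<in> sets (natural_filtration M Z t)"
proof -
  let ?F = "natural_filtration M Z t"
  have "(\<lambda>\<omega>. min (tau_star Z \<omega>) (ereal t)) \<in> borel_measurable ?F"
  proof (rule borel_measurableI_le)
    fix y :: ereal
    show "{\<omega> \<in> space ?F. min (tau_star Z \<omega>) (ereal t) \<le> y} \<in> sets ?F"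
    proof (cases "ereal t \<le> y")
      case True
      then have "{\<omega> \<in> space ?F. min (tau_star Z \<omega>) (ereal t) \<le> y} = space ?F"
        by (auto intro: min.coboundedI2)
      then show ?thesis by (simp only: sets.top)
    next
      case False
      then have eq: "{\<omega> \<in> space ?F. min (tau_star Z \<omega>) (ereal t) \<le> y} = {\<omega> \<in> space M. tau_star Z \<omega> \<le> y}"
        by (auto simp: min_le_iff_disj)
      show ?thesis
      proof (cases "0 \<le> y")
        case True
        with False obtain r where r: "y = ereal r" "0 \<le> r" "r \<le> t" by (cases y) auto
        show ?thesis unfolding eq unfolding r(1)
          by (rule subsetD[OF sets_natural_filtration_mono[OF r(3)] tau_star_stopping[OF Z r(2)]])
      next
        case False
        then have "{\<omega> \<in> space M. tau_star Z \<omega> \<le> y} = {}"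
          using tau_star_nonneg[of Z] by (auto dest: order_trans[OF tau_star_nonneg])
        then show ?thesis unfolding eq by (simp only: sets.empty_sets)
      qed
    qed
  qed
  from sets.Int[OF tau_star_stopping[OF Z t] measurable_sets[OF this T]]
  have "{\<omega> \<in> space M. tau_star Z \<omega> \<le> ereal t} \<inter>
      ((\<lambda>\<omega>. min (tau_star Z \<omega>) (ereal t)) -` T \<inter> space ?F) \<in> sets ?F" .
  also have "{\<omega> \<in> space M. tau_star Z \<omega> \<le> ereal t} \<inter>
      ((\<lambda>\<omega>. min (tau_star Z \<omega>) (ereal t)) -` T \<inter> space ?F)
      = {\<omega> \<in> space M. tau_star Z \<omega> \<le> ereal t \<and> tau_star Z \<omega> \<in> T}"
    by (auto simp: min_absorb1)
  finally show ?thesis .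
qed

lemma borel_measurable_tau_star:
  assumes Z: "continuous_process M Z"
  shows "tau_star Z \<in> borel_measurable M"
proof (rule borel_measurableI_le)
  fix y :: ereal
  have sub: "sets (natural_filtration M Z t) \<subseteq> sets M" for t
    using subalgebra_natural_filtration[OF Z] by (simp add: subalgebra_def)
  consider "y < 0" | r where "y = ereal r" "0 \<le> r" | "y = \<infinity>" by (cases y) fastforce+
  then show "{\<omega> \<in> space M. tau_star Z \<omega> \<le> y} \<in> sets M"
  proof cases
    case 1
    then have "{\<omega> \<in> space M. tau_star Z \<omega> \<le> y} = {}"
      using tau_star_nonneg[of Z] by (auto dest: order_trans[OF tau_star_nonneg])
    then show ?thesis by (simp only: sets.empty_sets)
  next
    case (2 r)
    then show ?thesis using tau_star_stopping[OF Z, of r] sub by auto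
  qed simp
qed

section \<open>Position at the absorption time\<close>

lemma ceiling_grid_index:
  fixes r :: ereal and n :: nat
  assumes "0 \<le> r" "r < \<infinity>"
  defines "\<kappa> \<equiv> LEAST k. r \<le> ereal (real k / real (Suc n))"
  shows "r \<le> ereal (real \<kappa> / real (Suc n))" and "real \<kappa> / real (Suc n) \<le> real_of_ereal r + 1 / real (Suc n)"
    and "real_of_ereal r \<le> real \<kappa> / real (Suc n)"
proof -
  obtain x where x: "r = ereal x" "0 \<le> x" using assms by (cases r) auto
  obtain k :: nat where "x * real (Suc n) \<le> real k" using real_arch_simple by blast
  then have "r \<le> ereal (real k / real (Suc n))" by (simp add: x le_divide_eq del: of_nat_Suc)
  then show le: "r \<le> ereal (real \<kappa> / real (Suc n))" unfolding \<kappa>_def by (rule LeastI)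
  then show "real_of_ereal r \<le> real \<kappa> / real (Suc n)" by (simp add: x)
  show "real \<kappa> / real (Suc n) \<le> real_of_ereal r + 1 / real (Suc n)"
  proof (cases \<kappa>)
    case 0
    then show ?thesis using x by simp
  next
    case (Suc j)
    then have "\<not> r \<le> ereal (real j / real (Suc n))" unfolding \<kappa>_def by (metis lessI not_less_Least)
    then have "real j / real (Suc n) < x" by (simp add: x)
    then show ?thesis using Suc by (simp add: x add_divide_distrib)
  qed
qed

lemma Int_stable_vimage_sets: "Int_stable {f -` A \<inter> \<Omega> |A. A \<in> sets N}"
proof (rule Int_stableI)
  fix S R assume "S \<in> {f -` A \<inter> \<Omega> |A. A \<in> sets N}" "R \<in> {f -` A \<inter> \<Omega> |A. A \<in> sets N}"
  then obtain A B where "A \<in> sets N" "B \<in> sets N" "S = f -` A \<inter> \<Omega>" "R = f -` B \<inter> \<Omega>" by auto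
  then have "A \<inter> B \<in> sets N" "S \<inter> R = f -` (A \<inter> B) \<inter> \<Omega>" by auto
  then show "S \<inter> R \<in> {f -` A \<inter> \<Omega> |A. A \<in> sets N}" by blast
qed

context posrec
begin

lemma Lambda_corner:
  assumes "A \<in> sets borel"
  shows "measure (Lambda a b (-\<infinity>, \<infinity>)) A = measure (mu a b) A"
proof -
  have "Lambda a b (-\<infinity>, \<infinity>) = uniform_measure (mu a b) UNIV"
    by (simp add: Lambda_def)
  moreover have "measure (uniform_measure (mu a b) UNIV) A = measure (mu a b) (UNIV \<inter> A) / measure (mu a b) UNIV"
    using assms mu.emeasure_space_1 by (intro measure_uniform_measure) auto
  ultimately show ?thesis using mu.prob_space by simp
qed

context
  fixes M :: "'w measure" and X :: "real \<Rightarrow> 'w \<Rightarrow> real" and Z :: "real \<Rightarrow> 'w \<Rightarrow> ereal \<times> ereal"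
  assumes M: "prob_space M" and X: "continuous_process M X" and Z: "continuous_process M Z"
    and absorbed: "AE \<omega> in M. \<forall>s t. 0 \<le> s \<and> s \<le> t \<longrightarrow> Z s \<omega> = (-\<infinity>, \<infinity>) \<longrightarrow> Z t \<omega> = (-\<infinity>, \<infinity>)"
    and cond: "\<And>t A. 0 \<le> t \<Longrightarrow> A \<in> sets borel \<Longrightarrow>
        AE \<omega> in M. real_cond_exp M (natural_filtration M Z t) (\<lambda>\<omega>'. indicator A (X t \<omega>')) \<omega>
                  = measure (Lambda a b (Z t \<omega>)) A"
    and fin: "AE \<omega> in M. tau_star Z \<omega> < \<infinity>"
begin

interpretation prob_space M by (rule M)

lemma X_measurable: "0 \<le> t \<Longrightarrow> X t \<in> borel_measurable M"
  using X by (simp add: continuous_process_def)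

lemma tau_star_measurable [measurable]: "tau_star Z \<in> borel_measurable M"
  by (rule borel_measurable_tau_star[OF Z])

text \<open>The time is deterministic and \<open>B\<close> is any past event of \<open>Z\<close>
  implying absorption; this lets the lemma be applied to each value of the discretised absorption
  time.\<close>

lemma stationary_after_absorption:
  assumes t: "0 \<le> t" and A: "A \<in> sets borel" and B: "B \<in> sets (natural_filtration M Z t)"
    and le: "\<And>\<omega>. \<omega> \<in> B \<Longrightarrow> tau_star Z \<omega> \<le> ereal t"
  shows "measure M (B \<inter> {\<omega> \<in> space M. X t \<omega> \<in> A}) = measure (mu a b) A * measure M B"
proof -
  have sub: "subalgebra M (natural_filtration M Z t)" by (rule subalgebra_natural_filtration[OF Z])
  interpret G: sigma_finite_subalgebra M "natural_filtration M Z t" by (rule sigma_finite_subalgebraI[OF M sub])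
  have BM: "B \<in> sets M" using B sub by (auto simp: subalgebra_def)
  have XA: "{\<omega> \<in> space M. X t \<omega> \<in> A} \<in> sets M"
    using measurable_sets[OF X_measurable[OF t] A] by (simp add: vimage_def Int_def conj_commute)
  have mI: "(\<lambda>\<omega>. indicator A (X t \<omega>) :: real) \<in> borel_measurable M"
    by (rule measurable_compose[OF X_measurable[OF t] borel_measurable_indicator[OF A]])
  have I: "integrable M (\<lambda>\<omega>. indicator A (X t \<omega>) :: real)"
    by (rule integrable_const_bound[where B=1]) (use mI in auto)
  have p: "AE \<omega> in M. \<omega> \<in> B \<longrightarrow> Z t \<omega> = (-\<infinity>, \<infinity>)"
    using absorbed AE_space
  proof eventually_elim
    case (elim \<omega>)
    show ?case
    proof
      assume "\<omega> \<in> B"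
      have "continuous_on {0..} (\<lambda>t. Z t \<omega>)" using Z elim(2) by (simp add: continuous_process_def)
      from tau_star_le_iff[of Z \<omega> t, OF this] le[OF \<open>\<omega> \<in> B\<close>]
      obtain s where "s \<in> {0..t}" "Z s \<omega> = (-\<infinity>, \<infinity>)" by auto
      then show "Z t \<omega> = (-\<infinity>, \<infinity>)" using elim(1) by auto
    qed
  qed
  have "measure M (B \<inter> {\<omega> \<in> space M. X t \<omega> \<in> A}) = (\<integral>\<omega>. indicator (B \<inter> {\<omega> \<in> space M. X t \<omega> \<in> A}) \<omega> \<partial>M)"
    using BM XA by simp
  also have "\<dots> = (\<integral>\<omega>\<in>B. indicator A (X t \<omega>) \<partial>M)"
    unfolding set_lebesgue_integral_def
    by (intro Bochner_Integration.integral_cong) (auto simp: indicator_def)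
  also have "\<dots> = (\<integral>\<omega>\<in>B. real_cond_exp M (natural_filtration M Z t) (\<lambda>\<omega>'. indicator A (X t \<omega>')) \<omega> \<partial>M)"
    by (rule G.real_cond_exp_intA[OF I B])
  also have "\<dots> = (\<integral>\<omega>. measure (mu a b) A * indicator B \<omega> \<partial>M)"
    unfolding set_lebesgue_integral_def
  proof (rule integral_cong_AE)
    show "AE \<omega> in M. indicator B \<omega> *\<^sub>R real_cond_exp M (natural_filtration M Z t) (\<lambda>\<omega>'. indicator A (X t \<omega>')) \<omega>
       = measure (mu a b) A * indicator B \<omega>"
      using p cond[OF t A] by eventually_elim (auto simp: indicator_def Lambda_corner[OF A])
  qed (use BM in \<open>auto intro!: borel_measurable_scaleR borel_measurable_indicator borel_measurable_cond_exp2\<close>)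
  also have "\<dots> = measure (mu a b) A * measure M B" using BM by simp
  finally show ?thesis .
qed

section \<open>Discretisation of the absorption time from above\<close>

definition tau_index :: "nat \<Rightarrow> 'w \<Rightarrow> nat" where
  "tau_index n \<omega> = (LEAST k. tau_star Z \<omega> \<le> ereal (real k / real (Suc n)))"

text \<open>Where the absorption time is infinite, the value \<open>X 0\<close> agrees with
  \<open>X_tau\<close>, since \<open>real_of_ereal \<infinity> = 0\<close>; convergence to
  \<open>X_tau\<close> then holds for every path.\<close>

definition X_grid :: "nat \<Rightarrow> 'w \<Rightarrow> real" where
  "X_grid n \<omega> = (if tau_star Z \<omega> < \<infinity> then X (real (tau_index n \<omega>) / real (Suc n)) \<omega> else X 0 \<omega>)"

definition X_tau :: "'w \<Rightarrow> real" where
  "X_tau \<omega> = X (real_of_ereal (tau_star Z \<omega>)) \<omega>"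

lemma X_grid_measurable [measurable]: "X_grid n \<in> borel_measurable M"
proof -
  have "tau_index n \<in> M \<rightarrow>\<^sub>M count_space UNIV" unfolding tau_index_def[abs_def] by measurable
  then have "(\<lambda>\<omega>. X (real (tau_index n \<omega>) / real (Suc n)) \<omega>) \<in> borel_measurable M"
    by (rule measurable_compose_countable[where f="\<lambda>k \<omega>. X (real k / real (Suc n)) \<omega>", rotated]) (intro X_measurable, simp)
  moreover have "X 0 \<in> borel_measurable M" by (rule X_measurable) simp
  ultimately show ?thesis unfolding X_grid_def[abs_def] by measurable
qed

lemma X_grid_tendsto:
  assumes "\<omega> \<in> space M"
  shows "(\<lambda>n. X_grid n \<omega>) \<longlonglongrightarrow> X_tau \<omega>"
proof (cases "tau_star Z \<omega> < \<infinity>")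
  case True
  let ?r = "real_of_ereal (tau_star Z \<omega>)"
  note idx = ceiling_grid_index[OF tau_star_nonneg True, folded tau_index_def]
  have lim: "(\<lambda>n. real (tau_index n \<omega>) / real (Suc n)) \<longlonglongrightarrow> ?r"
  proof (rule tendsto_sandwich)
    show "\<forall>\<^sub>F n in sequentially. ?r \<le> real (tau_index n \<omega>) / real (Suc n)"
      using idx(3) by (intro always_eventually allI)
    show "\<forall>\<^sub>F n in sequentially. real (tau_index n \<omega>) / real (Suc n) \<le> ?r + 1 / real (Suc n)"
      using idx(2) by (intro always_eventually allI)
    have "(\<lambda>n. ?r + 1 / real (Suc n)) \<longlonglongrightarrow> ?r + 0"
      by (intro tendsto_intros LIMSEQ_Suc[OF lim_1_over_n])
    then show "(\<lambda>n. ?r + 1 / real (Suc n)) \<longlonglongrightarrow> ?r" by simp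
  qed simp
  have "continuous_on {0..} (\<lambda>t. X t \<omega>)" using X assms by (simp add: continuous_process_def)
  from continuous_on_tendsto_compose[OF this lim]
  have "(\<lambda>n. X (real (tau_index n \<omega>) / real (Suc n)) \<omega>) \<longlonglongrightarrow> X ?r \<omega>"
    using real_of_ereal_pos[OF tau_star_nonneg[of Z \<omega>]] by simp
  then show ?thesis using True by (simp add: X_grid_def X_tau_def)
next
  case False
  then have "tau_star Z \<omega> = \<infinity>" by simp
  then show ?thesis by (simp add: X_grid_def X_tau_def)
qed

lemma X_tau_measurable [measurable]: "X_tau \<in> borel_measurable M"
  by (rule borel_measurable_LIMSEQ_metric[OF X_grid_measurable X_grid_tendsto])

text \<open>On \<open>B k\<close> the absorption time lies in \<open>T\<close> and its grid index is
  \<open>k\<close>, so \<open>X_grid n\<close> is \<open>X\<close> at the fixed time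
  \<open>s k\<close>, and \<open>B k\<close> belongs to the past of \<open>Z\<close> at that time.
  The law on each \<open>B k\<close> is known, and almost sure finiteness lets the disjoint pieces
  exhaust the event.\<close>

lemma X_grid_law:
  assumes A: "A \<in> sets borel" and T: "T \<in> sets borel"
  shows "prob {\<omega> \<in> space M. X_grid n \<omega> \<in> A \<and> tau_star Z \<omega> \<in> T} =
    measure (mu a b) A * prob {\<omega> \<in> space M. tau_star Z \<omega> \<in> T}"
proof -
  define s where "s k = real k / real (Suc n)" for k
  have s0: "0 \<le> s k" for k by (simp add: s_def)
  have s_mono: "j \<le> k \<Longrightarrow> s j \<le> s k" for j k unfolding s_def by (intro divide_right_mono) auto
  define B where "B k = {\<omega> \<in> space M. tau_star Z \<omega> \<le> ereal (s k) \<and> tau_star Z \<omega> \<in> T} -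
      (\<Union>j<k. {\<omega> \<in> space M. tau_star Z \<omega> \<le> ereal (s j)})" for k
  have B: "B k \<in> sets (natural_filtration M Z (s k))" for k
    unfolding B_def
    using tau_star_event[OF Z s0 T] subsetD[OF sets_natural_filtration_mono[OF s_mono] tau_star_stopping[OF Z s0]]
    by (intro sets.Diff sets.finite_UN) auto
  have BM: "B k \<in> sets M" for k
    using B[of k] subalgebra_natural_filtration[OF Z] by (auto simp: subalgebra_def)
  have idx: "tau_index n \<omega> = k" if "\<omega> \<in> B k" for \<omega> k
    unfolding tau_index_def
  proof (rule Least_equality)
    show "tau_star Z \<omega> \<le> ereal (real k / real (Suc n))" using that by (simp add: B_def s_def)
    fix j assume "tau_star Z \<omega> \<le> ereal (real j / real (Suc n))"
    then show "k \<le> j" using that unfolding B_def s_def[symmetric] by (auto simp: not_less[symmetric])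
  qed
  have in_B: "\<omega> \<in> B (tau_index n \<omega>)"
    if "\<omega> \<in> space M" "tau_star Z \<omega> < \<infinity>" "tau_star Z \<omega> \<in> T" for \<omega>
  proof -
    have "tau_star Z \<omega> \<le> ereal (s (tau_index n \<omega>))"
      using ceiling_grid_index(1)[OF tau_star_nonneg that(2), of n] by (simp add: s_def tau_index_def)
    moreover have "\<not> tau_star Z \<omega> \<le> ereal (s j)" if "j < tau_index n \<omega>" for j
      using not_less_Least[OF that[unfolded tau_index_def]] by (simp add: s_def)
    ultimately show ?thesis using that by (auto simp: B_def)
  qed
  have B_fin: "tau_star Z \<omega> < \<infinity>" if "\<omega> \<in> B k" for \<omega> k
    using that by (auto simp: B_def intro: le_less_trans)
  have disj: "disjoint_family B"
    using idx by (auto simp: disjoint_family_on_def)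
  define C where "C k = B k \<inter> {\<omega> \<in> space M. X (s k) \<omega> \<in> A}" for k
  have XA: "{\<omega> \<in> space M. X (s k) \<omega> \<in> A} \<in> sets M" for k
    using measurable_sets[OF X_measurable[OF s0] A] by (simp add: vimage_def Int_def conj_commute)
  have CM: "C k \<in> sets M" for k unfolding C_def using BM XA by auto
  have disjC: "disjoint_family C" using disj by (auto simp: disjoint_family_on_def C_def)
  have law: "prob (C k) = measure (mu a b) A * prob (B k)" for k
    unfolding C_def by (rule stationary_after_absorption[OF s0 A B]) (simp add: B_def)
  have C_eq: "(\<Union>k. C k) = {\<omega> \<in> space M. tau_star Z \<omega> < \<infinity> \<and> X_grid n \<omega> \<in> A \<and> tau_star Z \<omega> \<in> T}"
  proof (intro equalityI subsetI)
    fix \<omega> assume "\<omega> \<in> (\<Union>k. C k)"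
    then obtain k where k: "\<omega> \<in> B k" "\<omega> \<in> space M" "X (s k) \<omega> \<in> A" by (auto simp: C_def)
    then show "\<omega> \<in> {\<omega> \<in> space M. tau_star Z \<omega> < \<infinity> \<and> X_grid n \<omega> \<in> A \<and> tau_star Z \<omega> \<in> T}"
      using B_fin[OF k(1)] idx[OF k(1)] by (auto simp: X_grid_def s_def B_def)
  next
    fix \<omega> assume "\<omega> \<in> {\<omega> \<in> space M. tau_star Z \<omega> < \<infinity> \<and> X_grid n \<omega> \<in> A \<and> tau_star Z \<omega> \<in> T}"
    then show "\<omega> \<in> (\<Union>k. C k)" using in_B[of \<omega>] by (auto simp: C_def X_grid_def s_def)
  qed
  have B_eq: "(\<Union>k. B k) = {\<omega> \<in> space M. tau_star Z \<omega> < \<infinity> \<and> tau_star Z \<omega> \<in> T}"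
  proof (intro equalityI subsetI)
    fix \<omega> assume "\<omega> \<in> (\<Union>k. B k)"
    then obtain k where "\<omega> \<in> B k" by blast
    then show "\<omega> \<in> {\<omega> \<in> space M. tau_star Z \<omega> < \<infinity> \<and> tau_star Z \<omega> \<in> T}"
      using B_fin[of \<omega> k] by (simp add: B_def)
  next
    fix \<omega> assume "\<omega> \<in> {\<omega> \<in> space M. tau_star Z \<omega> < \<infinity> \<and> tau_star Z \<omega> \<in> T}"
    then show "\<omega> \<in> (\<Union>k. B k)" using in_B[of \<omega>] by blast
  qed
  have "(\<lambda>k. prob (C k)) sums prob (\<Union>k. C k)" using CM disjC by (intro finite_measure_UNION) auto
  moreover have "(\<lambda>k. prob (B k)) sums prob (\<Union>k. B k)" using BM disj by (intro finite_measure_UNION) auto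
  then have "(\<lambda>k. prob (C k)) sums (measure (mu a b) A * prob (\<Union>k. B k))"
    unfolding law by (rule sums_mult)
  ultimately have "prob (\<Union>k. C k) = measure (mu a b) A * prob (\<Union>k. B k)" by (rule sums_unique2)
  moreover have "prob (\<Union>k. C k) = prob {\<omega> \<in> space M. X_grid n \<omega> \<in> A \<and> tau_star Z \<omega> \<in> T}"
    unfolding C_eq
  proof (rule finite_measure_eq_AE)
    show "AE \<omega> in M. (\<omega> \<in> {\<omega> \<in> space M. tau_star Z \<omega> < \<infinity> \<and> X_grid n \<omega> \<in> A \<and> tau_star Z \<omega> \<in> T}) =
       (\<omega> \<in> {\<omega> \<in> space M. X_grid n \<omega> \<in> A \<and> tau_star Z \<omega> \<in> T})"
      using fin by eventually_elim auto
  qed (use A T in measurable)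
  moreover have "prob (\<Union>k. B k) = prob {\<omega> \<in> space M. tau_star Z \<omega> \<in> T}"
    unfolding B_eq
  proof (rule finite_measure_eq_AE)
    show "AE \<omega> in M. (\<omega> \<in> {\<omega> \<in> space M. tau_star Z \<omega> < \<infinity> \<and> tau_star Z \<omega> \<in> T}) =
       (\<omega> \<in> {\<omega> \<in> space M. tau_star Z \<omega> \<in> T})"
      using fin by eventually_elim auto
  qed (use T in measurable)
  ultimately show ?thesis by simp
qed

text \<open>Fatou's lemma for events: \<open>S\<close> lies in the limit inferior of the
  \<open>R n\<close>.\<close>

lemma prob_liminf_bound:
  assumes S: "S \<in> sets M" and R: "\<And>n. R n \<in> sets M" "\<And>n. prob (R n) \<le> p"
    and ev: "\<And>\<omega>. \<omega> \<in> S \<Longrightarrow> \<forall>\<^sub>F n in sequentially. \<omega> \<in> R n"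
  shows "prob S \<le> p"
proof -
  have "(\<lambda>n. \<integral>\<omega>. indicator (S \<inter> R n) \<omega> \<partial>M) \<longlonglongrightarrow> (\<integral>\<omega>. indicator S \<omega> \<partial>M :: real)"
  proof (rule integral_dominated_convergence[where w="\<lambda>_. 1"])
    show "AE \<omega> in M. (\<lambda>n. indicator (S \<inter> R n) \<omega>) \<longlonglongrightarrow> (indicator S \<omega> :: real)"
    proof (rule AE_I2)
      fix \<omega>
      show "(\<lambda>n. indicator (S \<inter> R n) \<omega>) \<longlonglongrightarrow> (indicator S \<omega> :: real)"
      proof (cases "\<omega> \<in> S")
        case True
        have "\<forall>\<^sub>F n in sequentially. indicator (S \<inter> R n) \<omega> = (indicator S \<omega> :: real)"
          using ev[OF True] by eventually_elim (use True in simp)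
        then show ?thesis by (rule tendsto_eventually)
      qed simp
    qed
  qed (use S R in \<open>auto simp: indicator_def\<close>)
  then have "(\<lambda>n. prob (S \<inter> R n)) \<longlonglongrightarrow> prob S" using S R by simp
  moreover have "prob (S \<inter> R n) \<le> p" for n
    using finite_measure_mono[of "S \<inter> R n" "R n"] R(1,2)[of n] by auto
  ultimately show ?thesis by (intro LIMSEQ_le_const2) auto
qed

text \<open>Pointwise convergence passes to open half-lines only. The upper bound enlarges
  \<open>{..x}\<close> to \<open>{..x + 1 / real (Suc j)}\<close> and uses the continuity of
  \<open>F\<close>; the lower bound is the upper bound for the complementary half-line
  \<open>{x<..}\<close>.\<close>

lemma X_tau_cdf:
  assumes T: "T \<in> sets borel"
  shows "prob {\<omega> \<in> space M. X_tau \<omega> \<in> {..x} \<and> tau_star Z \<omega> \<in> T} = F x * prob {\<omega> \<in> space M. tau_star Z \<omega> \<in> T}"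
    (is "?p x = F x * ?q")
proof (rule antisym)
  have "?p x \<le> F (x + 1 / real (Suc j)) * ?q" for j
  proof (rule prob_liminf_bound)
    show "prob {\<omega> \<in> space M. X_grid n \<omega> \<in> {..x + 1 / real (Suc j)} \<and> tau_star Z \<omega> \<in> T} \<le> F (x + 1 / real (Suc j)) * ?q" for n
      unfolding F_def by (subst X_grid_law[OF _ T]) auto
    fix \<omega> assume "\<omega> \<in> {\<omega> \<in> space M. X_tau \<omega> \<in> {..x} \<and> tau_star Z \<omega> \<in> T}"
    then have \<omega>: "\<omega> \<in> space M" "X_tau \<omega> \<le> x" "tau_star Z \<omega> \<in> T" by auto
    then have "X_tau \<omega> < x + 1 / real (Suc j)" by (simp add: add_strict_increasing2 le_less_trans)
    from order_tendstoD(2)[OF X_grid_tendsto[OF \<omega>(1)] this]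
    show "\<forall>\<^sub>F n in sequentially. \<omega> \<in> {\<omega> \<in> space M. X_grid n \<omega> \<in> {..x + 1 / real (Suc j)} \<and> tau_star Z \<omega> \<in> T}"
      by eventually_elim (use \<omega> in auto)
  qed (use T in measurable)
  moreover have "(\<lambda>j. F (x + 1 / real (Suc j)) * ?q) \<longlonglongrightarrow> F x * ?q"
  proof -
    have "(\<lambda>j. x + 1 / real (Suc j)) \<longlonglongrightarrow> x + 0"
      by (intro tendsto_intros LIMSEQ_Suc[OF lim_1_over_n])
    from continuous_on_tendsto_compose[OF smooth_continuous[OF smooth_F, of UNIV] this]
    show ?thesis by (intro tendsto_mult_right) simp
  qed
  ultimately show "?p x \<le> F x * ?q" by (intro LIMSEQ_le_const) auto
next
  have "prob {\<omega> \<in> space M. X_tau \<omega> \<in> {x<..} \<and> tau_star Z \<omega> \<in> T} \<le> measure (mu a b) {x<..} * ?q"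
  proof (rule prob_liminf_bound)
    show "prob {\<omega> \<in> space M. X_grid n \<omega> \<in> {x<..} \<and> tau_star Z \<omega> \<in> T} \<le> measure (mu a b) {x<..} * ?q" for n
      by (subst X_grid_law[OF _ T]) auto
    fix \<omega> assume "\<omega> \<in> {\<omega> \<in> space M. X_tau \<omega> \<in> {x<..} \<and> tau_star Z \<omega> \<in> T}"
    then have \<omega>: "\<omega> \<in> space M" "x < X_tau \<omega>" "tau_star Z \<omega> \<in> T" by auto
    from order_tendstoD(1)[OF X_grid_tendsto[OF \<omega>(1)] \<omega>(2)]
    show "\<forall>\<^sub>F n in sequentially. \<omega> \<in> {\<omega> \<in> space M. X_grid n \<omega> \<in> {x<..} \<and> tau_star Z \<omega> \<in> T}"
      by eventually_elim (use \<omega> in auto)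
  qed (use T in measurable)
  moreover have "measure (mu a b) {x<..} = 1 - F x"
    using mu.prob_compl[of "{..x}"] by (simp add: F_def Compl_eq_Diff_UNIV[symmetric] not_le)
  moreover have "?q = ?p x + prob {\<omega> \<in> space M. X_tau \<omega> \<in> {x<..} \<and> tau_star Z \<omega> \<in> T}"
  proof -
    have "{\<omega> \<in> space M. tau_star Z \<omega> \<in> T} = {\<omega> \<in> space M. X_tau \<omega> \<in> {..x} \<and> tau_star Z \<omega> \<in> T} \<union>
       {\<omega> \<in> space M. X_tau \<omega> \<in> {x<..} \<and> tau_star Z \<omega> \<in> T}" by auto
    then show ?thesis
      by (simp only:) (rule finite_measure_Union, (use T in measurable), auto)
  qed
  ultimately show "F x * ?q \<le> ?p x" by (simp add: left_diff_distrib)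
qed

text \<open>For fixed \<open>T\<close> both sides are finite Borel measures as functions of
  \<open>A\<close>, and \<open>X_tau_cdf\<close> equates their distribution functions.\<close>

lemma X_tau_law:
  assumes A: "A \<in> sets borel" and T: "T \<in> sets borel"
  shows "prob {\<omega> \<in> space M. X_tau \<omega> \<in> A \<and> tau_star Z \<omega> \<in> T} =
    measure (mu a b) A * prob {\<omega> \<in> space M. tau_star Z \<omega> \<in> T}"
proof -
  define q where "q = prob {\<omega> \<in> space M. tau_star Z \<omega> \<in> T}"
  have TM: "{\<omega> \<in> space M. tau_star Z \<omega> \<in> T} \<in> sets M" using T by measurable
  define N1 where "N1 = distr (density M (indicator {\<omega> \<in> space M. tau_star Z \<omega> \<in> T})) borel X_tau"
  define N2 where "N2 = scale_measure (ennreal q) (mu a b)"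
  have N1: "measure N1 B = prob {\<omega> \<in> space M. X_tau \<omega> \<in> B \<and> tau_star Z \<omega> \<in> T}" if B: "B \<in> sets borel" for B
  proof -
    have XB: "X_tau -` B \<inter> space M \<in> sets M" using measurable_sets[OF X_tau_measurable B] .
    have "emeasure N1 B = emeasure (density M (indicator {\<omega> \<in> space M. tau_star Z \<omega> \<in> T})) (X_tau -` B \<inter> space M)"
      unfolding N1_def using B by (subst emeasure_distr) auto
    also have "\<dots> = emeasure M ({\<omega> \<in> space M. tau_star Z \<omega> \<in> T} \<inter> (X_tau -` B \<inter> space M))"
      using TM XB by (subst emeasure_density) (auto simp: indicator_inter_arith[symmetric])
    also have "{\<omega> \<in> space M. tau_star Z \<omega> \<in> T} \<inter> (X_tau -` B \<inter> space M) = {\<omega> \<in> space M. X_tau \<omega> \<in> B \<and> tau_star Z \<omega> \<in> T}"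
      by auto
    finally show ?thesis by (simp add: measure_def)
  qed
  have N2: "measure N2 B = q * measure (mu a b) B" for B
    unfolding N2_def by (simp add: measure_def q_def enn2real_mult)
  have "N1 = N2"
  proof (rule cdf_unique')
    show "finite_borel_measure N1"
    proof (intro finite_borel_measure.intro finite_borel_measure_axioms.intro finite_measureI)
      have "emeasure N1 (space N1) \<le> emeasure M (space M)"
        unfolding N1_def using TM by (subst emeasure_distr) (auto simp: emeasure_density intro!: emeasure_mono)
      then show "emeasure N1 (space N1) \<noteq> \<infinity>" using emeasure_finite by (auto simp: top_unique)
    qed (simp add: N1_def)
    show "finite_borel_measure N2"
    proof (intro finite_borel_measure.intro finite_borel_measure_axioms.intro finite_measureI)
      show "emeasure N2 (space N2) \<noteq> \<infinity>"
        using mu.emeasure_space_1 by (simp add: N2_def space_scale_measure)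
    qed (simp add: N2_def)
    show "cdf N1 = cdf N2"
      using X_tau_cdf[OF T] by (simp add: fun_eq_iff cdf_def N1 N2 q_def F_def mult.commute)
  qed
  then show ?thesis using N1[OF A] N2[of A] by (simp add: q_def mult.commute)
qed

text \<open>The library's \<open>indep_var\<close> asks for two variables with the same range, whence the embedding
  \<open>ereal\<close>.\<close>

lemma indep_tau_X_tau: "indep_var borel (tau_star Z) borel (\<lambda>\<omega>. ereal (X_tau \<omega>))"
proof -
  have Xe: "(\<lambda>\<omega>. ereal (X_tau \<omega>)) \<in> borel_measurable M" by measurable
  have "indep_set {tau_star Z -` A \<inter> space M |A. A \<in> sets borel} {(\<lambda>\<omega>. ereal (X_tau \<omega>)) -` A \<inter> space M |A. A \<in> sets borel}"
    unfolding indep_sets2_eq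
  proof (intro conjI ballI)
    fix S R assume "S \<in> {tau_star Z -` A \<inter> space M |A. A \<in> sets borel}"
      "R \<in> {(\<lambda>\<omega>. ereal (X_tau \<omega>)) -` A \<inter> space M |A. A \<in> sets borel}"
    then obtain T B where T: "T \<in> sets borel" "S = {\<omega> \<in> space M. tau_star Z \<omega> \<in> T}"
      and B: "B \<in> sets borel" "R = (\<lambda>\<omega>. ereal (X_tau \<omega>)) -` B \<inter> space M" by auto
    define A where "A = (ereal -` B :: real set)"
    have A: "A \<in> sets borel" "R = {\<omega> \<in> space M. X_tau \<omega> \<in> A \<and> tau_star Z \<omega> \<in> UNIV}"
      using measurable_sets[OF borel_measurable_ereal[OF measurable_ident_sets[OF refl]] B(1)] B(2)
      by (auto simp: A_def vimage_def)
    have "S \<inter> R = {\<omega> \<in> space M. X_tau \<omega> \<in> A \<and> tau_star Z \<omega> \<in> T}" unfolding T A by auto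
    then have "prob (S \<inter> R) = measure (mu a b) A * prob S" using X_tau_law[OF A(1) T(1)] T(2) by simp
    moreover have "prob R = measure (mu a b) A"
      using X_tau_law[OF A(1), of UNIV] A(2) by (simp add: prob_space)
    ultimately show "prob (S \<inter> R) = prob S * prob R" by simp
  qed (auto intro: measurable_sets[OF tau_star_measurable] measurable_sets[OF Xe])
  from indep_set_sigma_sets[OF this Int_stable_vimage_sets Int_stable_vimage_sets] Xe
  show ?thesis unfolding indep_var_eq by (intro conjI tau_star_measurable)
qed

lemma distr_X_tau: "distr M borel X_tau = mu a b"
proof (rule measure_eqI)
  fix A assume "A \<in> sets (distr M borel X_tau)"
  then have A: "A \<in> sets borel" by simp
  have "emeasure (distr M borel X_tau) A = emeasure M (X_tau -` A \<inter> space M)" using A by (subst emeasure_distr) auto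
  also have "X_tau -` A \<inter> space M = {\<omega> \<in> space M. X_tau \<omega> \<in> A \<and> tau_star Z \<omega> \<in> UNIV}" by auto
  also have "emeasure M \<dots> = emeasure (mu a b) A"
    using X_tau_law[OF A, of UNIV] by (simp add: emeasure_eq_measure mu.emeasure_eq_measure prob_space)
  finally show "emeasure (distr M borel X_tau) A = emeasure (mu a b) A" .
qed simp

lemmas stationary_at_tau = indep_tau_X_tau[unfolded X_tau_def[abs_def]] distr_X_tau[unfolded X_tau_def[abs_def]]

end

end

theorem proposition5:
  fixes a b :: "real \<Rightarrow> real"
    and M :: "'w measure"
    and X :: "real \<Rightarrow> 'w \<Rightarrow> real"
    and Z :: "real \<Rightarrow> 'w \<Rightarrow> ereal \<times> ereal"
    and m0 :: "real measure"
    and m0star :: "(ereal \<times> ereal) measure"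
  assumes "smooth a" and "smooth b" and "\<And>x. a x > 0"
    and "positive_recurrent a b"
    and "prob_space M"
    and "prob_space m0star" and "sets m0star = sets (restrict_space borel Estar)"
    and "m0star \<bind> Lambda a b = m0"
    and "diffusion a b M (natural_filtration M X) X"
    and "distr M borel (X 0) = m0"
    and "dual_process a b M Z"
    and "distr M (restrict_space borel Estar) (Z 0) = m0star"
    and "intertwined a b M X Z"
    and "I_max a b < \<infinity>"
  shows "(AE \<omega> in M. tau_star Z \<omega> < \<infinity>) \<and>
    strong_stationary_time a b M (natural_filtration M (\<lambda>t \<omega>. (X t \<omega>, Z t \<omega>))) X (tau_star Z)"
proof -
  interpret posrec a b
    by unfold_locales (use assms in auto)
  have X: "continuous_process M X" using \<open>diffusion a b M (natural_filtration M X) X\<close> by (simp add: diffusion_def)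
  have Z: "continuous_process M Z" using \<open>dual_process a b M Z\<close> by (simp add: dual_process_def)
  have absorbed: "AE \<omega> in M. \<forall>s t. 0 \<le> s \<and> s \<le> t \<longrightarrow> Z s \<omega> = (-\<infinity>, \<infinity>) \<longrightarrow> Z t \<omega> = (-\<infinity>, \<infinity>)"
  proof -
    have "AE \<omega> in M. \<forall>s t. 0 \<le> s \<and> s \<le> t \<longrightarrow>
        (Z s \<omega> \<in> Eright \<longrightarrow> Z t \<omega> \<in> {-\<infinity>..<\<infinity>} \<times> {\<infinity>}) \<and>
        (Z s \<omega> \<in> Eleft \<longrightarrow> Z t \<omega> \<in> {-\<infinity>} \<times> {-\<infinity><..\<infinity>}) \<and>
        (Z s \<omega> = (-\<infinity>, \<infinity>) \<longrightarrow> Z t \<omega> = (-\<infinity>, \<infinity>))"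
      using \<open>dual_process a b M Z\<close> unfolding dual_process_def by blast
    then show ?thesis by eventually_elim blast
  qed
  have cond: "AE \<omega> in M. real_cond_exp M (natural_filtration M Z t) (\<lambda>\<omega>'. indicator A (X t \<omega>')) \<omega>
                  = measure (Lambda a b (Z t \<omega>)) A" if "0 \<le> t" "A \<in> sets borel" for t A
    using \<open>intertwined a b M X Z\<close> that unfolding intertwined_def by blast
  have ci: "AE \<omega> in M. real_cond_exp M (gen_sigma M X {0..}) (indicator B) \<omega>
                  = real_cond_exp M (natural_filtration M X t) (indicator B) \<omega>"
    if "0 \<le> t" "B \<in> sets (natural_filtration M Z t)" for t B
    using \<open>intertwined a b M X Z\<close> that unfolding intertwined_def by blast
  have fin: "AE \<omega> in M. tau_star Z \<omega> < \<infinity>"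
    by (rule AE_tau_star_finite[OF \<open>prob_space M\<close> \<open>dual_process a b M Z\<close>])
  have stopping: "{\<omega> \<in> space M. tau_star Z \<omega> \<le> ereal t} \<in> sets (natural_filtration M (\<lambda>t \<omega>. (X t \<omega>, Z t \<omega>)) t)"
    if "0 \<le> t" for t
    by (rule subsetD[OF sets_natural_filtration_snd tau_star_stopping[OF Z that]])
  have indep: "prob_space.indep_var M borel (tau_star Z) borel (\<lambda>\<omega>. X (real_of_ereal (tau_star Z \<omega>)) \<omega>)"
    by (rule stationary_at_tau(1)[OF \<open>prob_space M\<close> X Z absorbed _ fin]) (rule cond)
  have law: "distr M borel (\<lambda>\<omega>. X (real_of_ereal (tau_star Z \<omega>)) \<omega>) = mu a b"
    by (rule stationary_at_tau(2)[OF \<open>prob_space M\<close> X Z absorbed _ fin]) (rule cond)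
  \<comment> \<open>The absorption time is a stopping time of \<open>Z\<close> alone, but
    \<open>X\<close> has to be Markov in the same filtration; the joint filtration serves
    both.\<close>
  have diff: "diffusion a b M (natural_filtration M (\<lambda>t \<omega>. (X t \<omega>, Z t \<omega>))) X"
    by (rule diffusion_enlarge[OF \<open>prob_space M\<close> smooth_a smooth_b
          \<open>diffusion a b M (natural_filtration M X) X\<close> Z ci])
  have filt: "filtration_of M (natural_filtration M (\<lambda>t \<omega>. (X t \<omega>, Z t \<omega>)))"
    by (rule filtration_of_natural_filtration[OF continuous_process_Pair[OF X Z]])
  show ?thesis
    unfolding strong_stationary_time_def
    by (intro conjI allI impI ballI fin \<open>prob_space M\<close> filt diff stopping tau_star_nonneg indep law)
qed

end
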